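(* Let $n,k,a$ be integers with $0<k<n$. Then there exists a $0^+$-stable coherent system of type $(n,na,k)$ on $\mathbb P^1$ if and only if $$ka\ge n-k+\frac{k^2-1}{n}.$$
   Context: Work on $\mathbb P^1$ over an algebraically closed field. A coherent system of type $(n,d,k)$ is a pair $(E,V)$ with $E$ a vector bundle of rank $n$ and degree $d$ on $\mathbb P^1$ and $V\subset H^0(E)$ a linear subspace of dimension $k$. For a real number $\alpha$, the $\alpha$-slope is $\mu_\alpha(E,V)=\frac dn+\alpha\frac kn$. A coherent subsystem $(F,W)$ of $(E,V)$ consists of a subbundle $F\subset E$ and a subspace $W\subset V\cap H^0(F)$. $(E,V)$ is $\alpha$-stable if $\mu_\alpha(F,W)<\mu_\alpha(E,V)$ for every proper coherent subsystem $(F,W)$. A coherent system is $0^+$-stable if it is $\alpha$-stable for all sufficiently small $\alpha>0$. *)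

theory Defs
  imports "HOL-Computational_Algebra.Polynomial" "HOL-Computational_Algebra.Fraction_Field"
begin

text \<open>
Model of vector bundles on the projective line P1 over a field k.
K = k(t) is the function field ('k poly fract), t the affine coordinate,
0 = (t = 0) and infinity = (t = infinity).  A vector bundle E of rank n is
given by its generic fibre K^n (vectors: functions nat => K supported on
indices < n) together with the two lattices
  L0   = E(P1 - infinity), a free k[t]-module of rank n, spanned by K-linearly
         independent columns e0 0, ..., e0 (n-1);
  Linf = E(P1 - 0), a free k[1/t]-module of rank n, spanned by K-linearly
         independent columns einf 0, ..., einf (n-1).
Global sections of the twist E(m) = E tensor O(m * infinity) are
L0 intersected with t^m Linf.  Subbundles of E correspond to K-subspaces U of
K^n (F = E intersected with U, saturated), and H0(F(m)) = U \<inter> H0(E(m)).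
Degrees are defined through the Hilbert polynomial: h0(F(m)) = deg F + r (m+1)
for all large m (Riemann-Roch on P1).
\<close>

type_synonym 'k rf = "'k poly fract"
type_synonym 'k vecK = "nat \<Rightarrow> 'k rf"

definition const_rf :: "'k::field \<Rightarrow> 'k rf" where
  "const_rf c = Fract [:c:] 1"

definition tpow :: "nat \<Rightarrow> 'k::field rf" where
  "tpow m = Fract (monom 1 m) 1"

definition in_kt :: "'k::field rf \<Rightarrow> bool" where
  "in_kt x \<longleftrightarrow> (\<exists>p. x = Fract p 1)"

definition in_kinvt :: "'k::field rf \<Rightarrow> bool" where
  "in_kinvt x \<longleftrightarrow> (\<exists>p m. degree p \<le> m \<and> x = Fract p (monom 1 m))"

definition supp_lt :: "nat \<Rightarrow> 'k::field vecK \<Rightarrow> bool" where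
  "supp_lt n v \<longleftrightarrow> (\<forall>i\<ge>n. v i = 0)"

definition Kcomb :: "nat \<Rightarrow> (nat \<Rightarrow> 'k::field rf) \<Rightarrow> (nat \<Rightarrow> 'k vecK) \<Rightarrow> 'k vecK" where
  "Kcomb r c b = (\<lambda>i. \<Sum>j<r. c j * b j i)"

definition Klin_indep :: "nat \<Rightarrow> (nat \<Rightarrow> 'k::field vecK) \<Rightarrow> bool" where
  "Klin_indep r b \<longleftrightarrow> (\<forall>c. Kcomb r c b = (\<lambda>i. 0) \<longrightarrow> (\<forall>j<r. c j = 0))"

definition Kspan :: "nat \<Rightarrow> (nat \<Rightarrow> 'k::field vecK) \<Rightarrow> 'k vecK set" where
  "Kspan r b = {Kcomb r c b | c. True}"

definition frame :: "nat \<Rightarrow> nat \<Rightarrow> (nat \<Rightarrow> 'k::field vecK) \<Rightarrow> bool" where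
  "frame n r b \<longleftrightarrow> (\<forall>j<r. supp_lt n (b j)) \<and> Klin_indep r b"

definition lattice0 :: "nat \<Rightarrow> (nat \<Rightarrow> 'k::field vecK) \<Rightarrow> 'k vecK set" where
  "lattice0 n e0 = {Kcomb n c e0 | c. \<forall>j<n. in_kt (c j)}"

definition latticeInf :: "nat \<Rightarrow> (nat \<Rightarrow> 'k::field vecK) \<Rightarrow> nat \<Rightarrow> 'k vecK set" where
  "latticeInf n einf m = {(\<lambda>i. tpow m * v i) | v. v \<in> {Kcomb n c einf | c. \<forall>j<n. in_kinvt (c j)}}"

definition H0 :: "nat \<Rightarrow> (nat \<Rightarrow> 'k::field vecK) \<Rightarrow> (nat \<Rightarrow> 'k vecK) \<Rightarrow> 'k vecK set \<Rightarrow> nat \<Rightarrow> 'k vecK set" where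
  "H0 n e0 einf U m = U \<inter> lattice0 n e0 \<inter> latticeInf n einf m"

definition klin_indep :: "'k::field vecK list \<Rightarrow> bool" where
  "klin_indep vs \<longleftrightarrow> (\<forall>c. (\<forall>i. (\<Sum>j<length vs. const_rf (c j) * (vs ! j) i) = 0)
                          \<longrightarrow> (\<forall>j<length vs. c j = 0))"

definition ksubspace :: "'k::field vecK set \<Rightarrow> bool" where
  "ksubspace S \<longleftrightarrow> (\<lambda>i. 0) \<in> S \<and> (\<forall>v\<in>S. \<forall>w\<in>S. (\<lambda>i. v i + w i) \<in> S)
                   \<and> (\<forall>c. \<forall>v\<in>S. (\<lambda>i. const_rf c * v i) \<in> S)"

definition kdim :: "'k::field vecK set \<Rightarrow> nat" where
  "kdim S = Max {length vs | vs. set vs \<subseteq> S \<and> klin_indep vs}"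

definition has_degree :: "nat \<Rightarrow> (nat \<Rightarrow> 'k::field vecK) \<Rightarrow> (nat \<Rightarrow> 'k vecK) \<Rightarrow> nat \<Rightarrow> 'k vecK set \<Rightarrow> int \<Rightarrow> bool" where
  "has_degree n e0 einf r U d \<longleftrightarrow>
     (\<exists>M. \<forall>m\<ge>M. int (kdim (H0 n e0 einf U m)) = d + int r * (int m + 1))"

definition bdeg :: "nat \<Rightarrow> (nat \<Rightarrow> 'k::field vecK) \<Rightarrow> (nat \<Rightarrow> 'k vecK) \<Rightarrow> nat \<Rightarrow> 'k vecK set \<Rightarrow> int" where
  "bdeg n e0 einf r U = (THE d. has_degree n e0 einf r U d)"

definition fullspace :: "nat \<Rightarrow> 'k::field vecK set" where
  "fullspace n = {v. supp_lt n v}"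

definition coherent_system :: "nat \<Rightarrow> int \<Rightarrow> nat \<Rightarrow> (nat \<Rightarrow> 'k::field vecK) \<Rightarrow> (nat \<Rightarrow> 'k vecK) \<Rightarrow> 'k vecK set \<Rightarrow> bool" where
  "coherent_system n d kk e0 einf V \<longleftrightarrow>
     frame n n e0 \<and> frame n n einf \<and> bdeg n e0 einf n (fullspace n) = d \<and>
     ksubspace V \<and> V \<subseteq> H0 n e0 einf (fullspace n) 0 \<and> kdim V = kk"

definition alpha_slope :: "real \<Rightarrow> int \<Rightarrow> nat \<Rightarrow> nat \<Rightarrow> real" where
  "alpha_slope \<alpha> d r kk = real_of_int d / real r + \<alpha> * real kk / real r"

text \<open>alpha-stability: proper coherent subsystems (F,W), F a subbundle of rank r >= 1
  with generic fibre Kspan r u, W a k-subspace of V \<inter> H0(F), (F,W) \<noteq> (E,V)\<close>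
definition alpha_stable :: "real \<Rightarrow> nat \<Rightarrow> (nat \<Rightarrow> 'k::field vecK) \<Rightarrow> (nat \<Rightarrow> 'k vecK) \<Rightarrow> 'k vecK set \<Rightarrow> bool" where
  "alpha_stable \<alpha> n e0 einf V \<longleftrightarrow>
     (\<forall>r u W. 1 \<le> r \<and> r \<le> n \<and> frame n r u \<and> ksubspace W \<and> W \<subseteq> V \<inter> Kspan r u
        \<and> (r < n \<or> W \<noteq> V) \<longrightarrow>
        alpha_slope \<alpha> (bdeg n e0 einf r (Kspan r u)) r (kdim W)
          < alpha_slope \<alpha> (bdeg n e0 einf n (fullspace n)) n (kdim V))"

definition zero_plus_stable :: "nat \<Rightarrow> (nat \<Rightarrow> 'k::field vecK) \<Rightarrow> (nat \<Rightarrow> 'k vecK) \<Rightarrow> 'k vecK set \<Rightarrow> bool" where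
  "zero_plus_stable n e0 einf V \<longleftrightarrow>
     (\<exists>\<alpha>0>0. \<forall>\<alpha>. 0 < \<alpha> \<and> \<alpha> < \<alpha>0 \<longrightarrow> alpha_stable \<alpha> n e0 einf V)"

definition alg_closed :: "'k::field itself \<Rightarrow> bool" where
  "alg_closed _ \<longleftrightarrow> (\<forall>p::'k poly. 0 < degree p \<longrightarrow> (\<exists>x. poly p x = 0))"

end

theory Submission
  imports "Jordan_Normal_Form.Char_Poly" Defs "HOL-Library.Function_Algebras"
    "HOL-Computational_Algebra.Polynomial_Factorial"
begin

text \<open>
  A \<open>0\<^sup>+\<close>-stable system of degree \<open>na\<close> lives on a semistable bundle. For such a bundle Riemann--Roch
  gives \<open>n\<close> sections of \<open>E(-a)\<close>, none of which vanishes anywhere, so \<open>E = O(a)^n\<close>. The subspace \<open>V\<close>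
  of \<open>H\<^sup>0(O(a)) \<otimes> k^n\<close> is then a representation of the Kronecker quiver with \<open>a + 1\<close> arrows
  and dimension vector \<open>(k, n)\<close>, and \<open>0\<^sup>+\<close>-stability is slope stability of this representation. The
  numerical condition says that the Tits form \<open>k\<^sup>2 + n\<^sup>2 - (a + 1)kn\<close> is at most 1.

  Necessity: over an algebraically closed field a stable representation has only scalar endomorphisms,
  and these form the kernel of a linear map from a space of dimension \<open>k\<^sup>2 + n\<^sup>2\<close> to one
  of dimension \<open>(a + 1)kn\<close>.

  Sufficiency: if \<open>n < ak\<close>, let the arrows send the \<open>i\<close>-th basis vector to \<open>a + 1\<close> consecutive basis
  vectors, starting just below the \<open>i\<close>-th multiple of \<open>n/k\<close>. The arrows preserve the order of the bases,
  so passing to leading terms reduces stability to an expansion property of unions of intervals.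
  If \<open>n \<ge> ak\<close>, a reflection functor reduces \<open>(k, n)\<close> to the smaller vector \<open>((a + 1)k - n, k)\<close>.
\<close>

hide_const (open) Module.smult

section \<open>Finite-dimensional subspaces\<close>

text \<open>A separate locale, because names added to \<open>vector_space\<close> itself are captured by its
  unqualified interpretation for real vector spaces.\<close>

locale vec_space = vector_space
begin

definition fin_dim :: "'b set \<Rightarrow> bool" where
  "fin_dim S \<longleftrightarrow> (\<exists>B. finite B \<and> S \<subseteq> span B)"

definition indep_fam :: "nat \<Rightarrow> (nat \<Rightarrow> 'b) \<Rightarrow> bool" where
  "indep_fam r b \<longleftrightarrow> (\<forall>c. (\<Sum>j<r. c j *s b j) = 0 \<longrightarrow> (\<forall>j<r. c j = 0))"

lemma fin_dim_subset: "fin_dim T \<Longrightarrow> S \<subseteq> T \<Longrightarrow> fin_dim S"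
  unfolding fin_dim_def by blast

lemma fin_dim_independent:
  assumes "fin_dim S" "B \<subseteq> S" "independent B"
  shows "finite B"
  using assms independent_span_bound unfolding fin_dim_def by (meson subset_trans)

lemma fin_dim_basis:
  assumes "fin_dim S"
  obtains B where "finite B" "B \<subseteq> S" "independent B" "S \<subseteq> span B" "card B = dim S"
  using assms basis_exists[of S] fin_dim_independent by metis

lemma independent_card_le_fin_dim:
  assumes "fin_dim S" "B \<subseteq> S" "independent B"
  shows "card B \<le> dim S"
proof -
  obtain C where "finite C" "S \<subseteq> span C" "card C = dim S"
    using fin_dim_basis[OF assms(1)] by metis
  then show ?thesis using independent_span_bound[of C B] assms by auto
qed

lemma dim_mono_fin_dim:
  assumes "fin_dim T" "S \<subseteq> T"
  shows "dim S \<le> dim T"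
proof -
  obtain B where "B \<subseteq> S" "independent B" "card B = dim S"
    using basis_exists by metis
  then show ?thesis using independent_card_le_fin_dim[OF assms(1), of B] assms(2) by auto
qed

lemma subspace_eq_fin_dim:
  assumes T: "fin_dim T" and S: "subspace S" "S \<subseteq> T" and le: "dim T \<le> dim S"
  shows "S = T"
proof -
  obtain B where B: "B \<subseteq> S" "independent B" "card B = dim S"
    using basis_exists by metis
  have "T \<subseteq> span B"
  proof (rule subsetI, rule ccontr)
    fix x assume x: "x \<in> T" "x \<notin> span B"
    have "finite B" using B S by (intro fin_dim_independent[OF T]) auto
    moreover have "card (insert x B) \<le> dim T"
      using B S x independent_insertI by (intro independent_card_le_fin_dim[OF T]) auto
    moreover have "x \<notin> B" using x span_base by auto
    ultimately show False using B le by simp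
  qed
  then show ?thesis using B S span_minimal by blast
qed

lemma dim_zero_set: "dim {0} = 0"
  using dim_span_eq_card_independent[of "{}"] independent_empty by simp

lemma dim_eq_0_iff_fin_dim:
  assumes "fin_dim S" "subspace S"
  shows "dim S = 0 \<longleftrightarrow> S = {0}"
  using subspace_eq_fin_dim[OF assms(1) subspace_single_0] subspace_0[OF assms(2)]
  by (auto simp: dim_zero_set)

lemma indep_famD: "indep_fam r b \<Longrightarrow> (\<Sum>j<r. c j *s b j) = 0 \<Longrightarrow> j < r \<Longrightarrow> c j = 0"
  unfolding indep_fam_def by blast

lemma indep_fam_cong: "(\<And>j. j < r \<Longrightarrow> b j = b' j) \<Longrightarrow> indep_fam r b \<longleftrightarrow> indep_fam r b'"
  unfolding indep_fam_def by simp

lemma indep_fam_scale: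
  assumes "indep_fam r b" "\<And>j. j < r \<Longrightarrow> a j \<noteq> 0"
  shows "indep_fam r (\<lambda>j. a j *s b j)"
  unfolding indep_fam_def
proof (intro allI impI)
  fix c j assume "(\<Sum>j<r. c j *s a j *s b j) = 0" "j < r"
  then show "c j = 0" using indep_famD[OF assms(1), of "\<lambda>j. c j * a j" j] assms(2) by simp
qed

lemma indep_fam_inj_on:
  assumes "indep_fam r b"
  shows "inj_on b {..<r}"
proof (rule inj_onI, rule ccontr)
  fix i j assume ij: "i \<in> {..<r}" "j \<in> {..<r}" "b i = b j" "i \<noteq> j"
  define c where "c = (\<lambda>l. if l = i then 1 else if l = j then -1 else (0::'a))"
  have "(\<Sum>l<r. c l *s b l) = (\<Sum>l\<in>{i,j}. c l *s b l)"
    using ij by (intro sum.mono_neutral_right) (auto simp: c_def)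
  also have "\<dots> = 0" using ij by (simp add: c_def)
  finally have "c i = 0" using indep_famD[OF assms] ij by blast
  then show False by (simp add: c_def)
qed

lemma indep_fam_iff_independent:
  "indep_fam r b \<longleftrightarrow> inj_on b {..<r} \<and> independent (b ` {..<r})"
proof (intro iffI conjI)
  assume b: "indep_fam r b"
  then show inj: "inj_on b {..<r}" by (rule indep_fam_inj_on)
  show "independent (b ` {..<r})"
  proof (rule independent_if_scalars_zero)
    fix f x assume "(\<Sum>x\<in>b ` {..<r}. f x *s x) = 0" "x \<in> b ` {..<r}"
    then show "f x = 0" using indep_famD[OF b, of "f \<circ> b"] by (auto simp: sum.reindex[OF inj])
  qed simp
next
  assume b: "inj_on b {..<r} \<and> independent (b ` {..<r})"
  show "indep_fam r b"
    unfolding indep_fam_def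
  proof (intro allI impI)
    fix c j assume c: "(\<Sum>j<r. c j *s b j) = 0" and j: "j < r"
    define f where "f = c \<circ> the_inv_into {..<r} b"
    have f: "f (b i) = c i" if "i < r" for i
      using b that by (simp add: f_def the_inv_into_f_f)
    have "(\<Sum>x\<in>b ` {..<r}. f x *s x) = 0"
      using b c by (simp add: sum.reindex f)
    then have "f (b j) = 0" using b j by (intro independentD[of "b ` {..<r}"]) auto
    then show "c j = 0" using f j by simp
  qed
qed

lemma indep_fam_le_dim:
  assumes "fin_dim S" "\<And>j. j < r \<Longrightarrow> b j \<in> S" "indep_fam r b"
  shows "r \<le> dim S"
  using independent_card_le_fin_dim[OF assms(1), of "b ` {..<r}"] assms(2,3)
  by (auto simp: indep_fam_iff_independent card_image)

lemma basis_fam: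
  assumes "fin_dim S"
  obtains b where "indep_fam (dim S) b" "\<And>j. j < dim S \<Longrightarrow> b j \<in> S"
    "\<And>v. v \<in> S \<Longrightarrow> \<exists>c. v = (\<Sum>j<dim S. c j *s b j)"
proof -
  obtain B where B: "finite B" "B \<subseteq> S" "independent B" "S \<subseteq> span B" "card B = dim S"
    using fin_dim_basis[OF assms] by metis
  obtain b where b: "bij_betw b {..<dim S} B"
    using B ex_bij_betw_nat_finite[of B] by (auto simp: atLeast0LessThan)
  show thesis
  proof
    show "indep_fam (dim S) b" using b B by (simp add: indep_fam_iff_independent bij_betw_def)
    show "b j \<in> S" if "j < dim S" for j using b B that by (auto simp: bij_betw_def)
    show "\<exists>c. v = (\<Sum>j<dim S. c j *s b j)" if "v \<in> S" for v
    proof -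
      obtain f where "v = (\<Sum>x\<in>B. f x *s x)" using \<open>v \<in> S\<close> B span_finite[OF B(1)] by auto
      then show ?thesis
        using sum.reindex_bij_betw[OF b, of "\<lambda>x. f x *s x"] by (intro exI[of _ "f \<circ> b"]) simp
    qed
  qed
qed

lemma span_Int_span_Diff:
  assumes "independent C" "B \<subseteq> C"
  shows "span B \<inter> span (C - B) = {0}"
proof (intro equalityI subsetI)
  fix x assume x: "x \<in> span B \<inter> span (C - B)"
  then have "x \<in> span C" using span_mono[OF assms(2)] by blast
  have "representation C x = representation B x" "representation C x = representation (C - B) x"
    using x assms by (auto intro: representation_extend)
  then have "representation C x b = 0" for b
    using representation_ne_zero by (metis DiffD2)
  then have "x = 0" using sum_nonzero_representation_eq[OF assms(1) \<open>x \<in> span C\<close>] by simp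
  then show "x \<in> {0}" by simp
qed (simp add: span_zero)

end

locale vec_space_pair = vs1: vec_space s1 + vs2: vec_space s2
  for s1 :: "'a::field \<Rightarrow> 'b::ab_group_add \<Rightarrow> 'b"
  and s2 :: "'a::field \<Rightarrow> 'c::ab_group_add \<Rightarrow> 'c"
begin

sublocale vector_space_pair s1 s2 ..

lemma linearI:
  "(\<And>x y. f (x + y) = f x + f y) \<Longrightarrow> (\<And>c x. f (s1 c x) = s2 c (f x)) \<Longrightarrow> Vector_Spaces.linear s1 s2 f"
  unfolding Vector_Spaces.linear_iff using vs1.vector_space_axioms vs2.vector_space_axioms by blast

lemma subspace_kernel_on:
  assumes "Vector_Spaces.linear s1 s2 f" "vs1.subspace S"
  shows "vs1.subspace {x \<in> S. f x = 0}"
  using vs1.subspace_inter[OF assms(2) linear_subspace_kernel[OF assms(1)]]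
  by (simp add: Collect_conj_eq)

lemma fin_dim_image:
  assumes "Vector_Spaces.linear s1 s2 f" "vs1.fin_dim S"
  shows "vs2.fin_dim (f ` S)"
proof -
  obtain B where "finite B" "S \<subseteq> vs1.span B" using assms unfolding vs1.fin_dim_def by blast
  then show ?thesis unfolding vs2.fin_dim_def
    by (intro exI[of _ "f ` B"]) (auto simp: linear_span_image[OF assms(1)])
qed

lemma rank_nullity:
  assumes f: "Vector_Spaces.linear s1 s2 f" and S: "vs1.subspace S" "vs1.fin_dim S"
  shows "vs1.dim S = vs1.dim {x \<in> S. f x = 0} + vs2.dim (f ` S)"
proof -
  let ?K = "{x \<in> S. f x = 0}"
  obtain B where B: "B \<subseteq> ?K" "vs1.independent B" "?K \<subseteq> vs1.span B" "card B = vs1.dim ?K"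
    by (rule vs1.basis_exists)
  obtain C where C: "B \<subseteq> C" "C \<subseteq> S" "vs1.independent C" "S \<subseteq> vs1.span C"
    using vs1.maximal_independent_subset_extend[of B S] B by auto
  have "finite C" using vs1.fin_dim_independent[OF S(2) C(2,3)] .
  have inj: "inj_on f (vs1.span (C - B))"
  proof (subst linear_inj_on_iff_eq_0[OF f vs1.subspace_span], intro ballI impI)
    fix x assume x: "x \<in> vs1.span (C - B)" "f x = 0"
    have "vs1.span (C - B) \<subseteq> S" using C(2) S(1) by (intro vs1.span_minimal) auto
    then have "x \<in> vs1.span B" using x B(3) by auto
    then show "x = 0" using x vs1.span_Int_span_Diff[OF C(3,1)] by blast
  qed
  have "vs2.dim (f ` S) = card (f ` (C - B))"
  proof (rule vs2.dim_unique)
    have "f ` C \<subseteq> insert 0 (f ` (C - B))" using B(1) by auto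
    then have "vs2.span (f ` C) \<subseteq> vs2.span (f ` (C - B))"
      using vs2.span_mono vs2.span_insert_0 by metis
    then show "f ` S \<subseteq> vs2.span (f ` (C - B))"
      using C(4) linear_span_image[OF f] by blast
    show "vs2.independent (f ` (C - B))"
      using linear_independent_injective_image[OF f _ inj] vs1.independent_mono[OF C(3)] by auto
  qed (use C(2) in auto)
  also have "\<dots> = card (C - B)"
    using inj vs1.span_superset by (intro card_image) (rule inj_on_subset)
  finally have "vs2.dim (f ` S) + card B = card C"
    using C(1) \<open>finite C\<close> by (simp add: card_Diff_subset card_mono finite_subset)
  moreover have "card C = vs1.dim S" using C by (intro vs1.basis_card_eq_dim)
  ultimately show ?thesis using B(4) by simp
qed

lemma dim_image_inj:
  assumes f: "Vector_Spaces.linear s1 s2 f" and S: "vs1.subspace S" "vs1.fin_dim S"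
    and inj: "\<And>x. x \<in> S \<Longrightarrow> f x = 0 \<Longrightarrow> x = 0"
  shows "vs2.dim (f ` S) = vs1.dim S"
proof -
  have "{x \<in> S. f x = 0} = {0}"
    using inj vs1.subspace_0[OF S(1)] linear_0[OF f] by auto
  then show ?thesis using rank_nullity[OF f S] vs1.dim_zero_set by simp
qed

lemma dim_image_le_fin_dim:
  assumes f: "Vector_Spaces.linear s1 s2 f" and S: "vs1.subspace S" "vs1.fin_dim S"
  shows "vs2.dim (f ` S) \<le> vs1.dim S"
  using rank_nullity[OF assms] by simp

end

definition fscale :: "'k::field \<Rightarrow> ('i \<Rightarrow> 'k) \<Rightarrow> 'i \<Rightarrow> 'k" where
  "fscale c f = (\<lambda>i. c * f i)"

definition pscale :: "'k::field \<Rightarrow> (nat \<Rightarrow> 'k poly) \<Rightarrow> nat \<Rightarrow> 'k poly" where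
  "pscale c p = (\<lambda>i. smult c (p i))"

definition kscale :: "'k::field \<Rightarrow> 'k vecK \<Rightarrow> 'k vecK" where
  "kscale c v = (\<lambda>i. const_rf c * v i)"

lemma fscale_apply: "fscale c f i = c * f i"
  by (simp add: fscale_def)

lemma pscale_apply: "pscale c p i = smult c (p i)"
  by (simp add: pscale_def)

lemma kscale_apply: "kscale c v i = const_rf c * v i"
  by (simp add: kscale_def)

text \<open>As default simp rules these would also rewrite eta-expanded occurrences such as the scalar
  multiplication argument of \<open>fs.dim\<close>.\<close>

lemmas vec_apply = plus_fun_apply zero_fun_apply fscale_apply pscale_apply kscale_apply

declare plus_fun_apply [simp del] zero_fun_apply [simp del]

lemma const_rf_to_fract: "const_rf c = to_fract [:c:]"
  by (simp add: const_rf_def to_fract_def)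

lemma kscale_eq_fscale: "kscale c v = fscale (to_fract [:c:]) v"
  by (simp add: fun_eq_iff vec_apply const_rf_to_fract)

interpretation fs: vec_space "fscale :: 'k::field \<Rightarrow> ('i \<Rightarrow> 'k) \<Rightarrow> _"
  by unfold_locales (auto simp: vec_apply fun_eq_iff algebra_simps)

interpretation ps: vec_space "pscale :: 'k::field \<Rightarrow> _"
  by unfold_locales (auto simp: vec_apply fun_eq_iff algebra_simps smult_add_right smult_add_left)

interpretation ks: vec_space "kscale :: 'k::field \<Rightarrow> _"
proof unfold_locales
  have const: "[:a + b:] = [:a:] + [:b:]" "[:a * b:] = [:a:] * [:b:]" "[:1:] = 1" for a b :: 'k
    by (auto simp: one_pCons)
  fix a b :: 'k and x y :: "'k vecK"
  show "kscale a (x + y) = kscale a x + kscale a y" "kscale (a + b) x = kscale a x + kscale b x"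
    by (simp_all only: kscale_eq_fscale const to_fract_add fs.scale_right_distrib fs.scale_left_distrib)
  show "kscale a (kscale b x) = kscale (a * b) x" "kscale 1 x = x"
    by (simp_all only: kscale_eq_fscale const to_fract_mult to_fract_1 fs.scale_scale fs.scale_one)
qed

interpretation ff: vec_space_pair "fscale :: 'k::field \<Rightarrow> ('i \<Rightarrow> 'k) \<Rightarrow> _" "fscale :: 'k::field \<Rightarrow> ('j \<Rightarrow> 'k) \<Rightarrow> _"
  by unfold_locales
interpretation pf: vec_space_pair "pscale :: 'k::field \<Rightarrow> _" "fscale :: 'k::field \<Rightarrow> ('j \<Rightarrow> 'k) \<Rightarrow> _"
  by unfold_locales
interpretation fp: vec_space_pair "fscale :: 'k::field \<Rightarrow> ('j \<Rightarrow> 'k) \<Rightarrow> _" "pscale :: 'k::field \<Rightarrow> _"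
  by unfold_locales
interpretation pp: vec_space_pair "pscale :: 'k::field \<Rightarrow> _" "pscale :: 'k::field \<Rightarrow> _"
  by unfold_locales
interpretation fk: vec_space_pair "fscale :: 'k::field \<Rightarrow> ('j \<Rightarrow> 'k) \<Rightarrow> _" "kscale :: 'k::field \<Rightarrow> _"
  by unfold_locales
interpretation pk: vec_space_pair "pscale :: 'k::field \<Rightarrow> _" "kscale :: 'k::field \<Rightarrow> _"
  by unfold_locales

lemma sum_fun_apply: "(\<Sum>j\<in>A. f j) i = (\<Sum>j\<in>A. f j i)"
  for f :: "'a \<Rightarrow> 'b \<Rightarrow> 'c::comm_monoid_add"
  by (induction A rule: infinite_finite_induct) (auto simp: vec_apply)

definition supported :: "'i set \<Rightarrow> ('i \<Rightarrow> 'k::field) set" where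
  "supported T = {f. \<forall>i. i \<notin> T \<longrightarrow> f i = 0}"

abbreviation coord_space :: "nat \<Rightarrow> (nat \<Rightarrow> 'k::field) set" where
  "coord_space n \<equiv> supported {..<n}"

definition unitv :: "'i \<Rightarrow> 'i \<Rightarrow> 'k::field" where
  "unitv i = (\<lambda>j. if j = i then 1 else 0)"

lemma subspace_supported: "fs.subspace (supported T)"
  by (rule fs.subspaceI) (auto simp: vec_apply supported_def)

lemma unitv_in_supported: "i \<in> T \<Longrightarrow> unitv i \<in> supported T"
  by (auto simp: supported_def unitv_def)

lemma sum_unitv_apply:
  assumes "finite T"
  shows "(\<Sum>i\<in>T. fscale (c i) (unitv i)) j = (if j \<in> T then c j else 0)"
proof -
  have "(\<Sum>i\<in>T. fscale (c i) (unitv i)) j = (\<Sum>i\<in>T. if j = i then c i else 0)"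
    unfolding sum_fun_apply by (rule sum.cong) (auto simp: vec_apply unitv_def)
  then show ?thesis using assms by simp
qed

lemma supported_expand:
  assumes "finite T" "f \<in> supported T"
  shows "f = (\<Sum>i\<in>T. fscale (f i) (unitv i))"
  using assms by (auto simp: fun_eq_iff sum_unitv_apply supported_def)

lemma indep_unitv: "fs.indep_fam n (unitv :: nat \<Rightarrow> nat \<Rightarrow> 'k::field)"
  unfolding fs.indep_fam_def
proof (intro allI impI)
  fix c :: "nat \<Rightarrow> 'k" and j assume "(\<Sum>j<n. fscale (c j) (unitv j)) = 0" "j < n"
  then show "c j = 0" using sum_unitv_apply[of "{..<n}" c j] by (simp add: vec_apply)
qed

lemma inj_unitv: "inj_on (unitv :: 'i \<Rightarrow> 'i \<Rightarrow> 'k::field) T"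
  by (rule inj_onI) (metis unitv_def zero_neq_one)

lemma independent_unitv: "fs.independent ((unitv :: 'i \<Rightarrow> 'i \<Rightarrow> 'k::field) ` T)"
  unfolding fs.independent_explicit_finite_subsets
proof (intro allI impI ballI)
  fix A u v assume A: "A \<subseteq> unitv ` T" "finite A" "(\<Sum>v\<in>A. fscale (u v) v) = 0" "v \<in> A"
  obtain T' where T': "A = unitv ` T'" "finite T'"
    using A(1,2) by (metis finite_imageD finite_subset inj_unitv subset_imageE)
  obtain i where i: "i \<in> T'" "v = unitv i" using A(4) T' by auto
  have "(\<Sum>v\<in>A. fscale (u v) v) i = u v"
    unfolding T'(1) using T'(2) i by (simp add: sum.reindex inj_unitv sum_unitv_apply)
  then show "u v = 0" using A(3) by (simp add: vec_apply)
qed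

lemma span_unitv:
  assumes "finite T"
  shows "fs.span (unitv ` T :: ('i \<Rightarrow> 'k::field) set) = supported T"
proof
  show "fs.span (unitv ` T) \<subseteq> (supported T :: ('i \<Rightarrow> 'k) set)"
    by (intro fs.span_minimal subspace_supported) (auto intro: unitv_in_supported)
  show "(supported T :: ('i \<Rightarrow> 'k) set) \<subseteq> fs.span (unitv ` T)"
  proof
    fix f :: "'i \<Rightarrow> 'k" assume f: "f \<in> supported T"
    show "f \<in> fs.span (unitv ` T)"
      by (subst supported_expand[OF assms f]) (intro fs.span_sum fs.span_scale fs.span_base imageI)
  qed
qed

lemma fin_dim_supported: "finite T \<Longrightarrow> fs.fin_dim (supported T :: ('i \<Rightarrow> 'k::field) set)"
  unfolding fs.fin_dim_def using span_unitv by (intro exI[of _ "unitv ` T"]) auto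

lemma dim_supported: "finite T \<Longrightarrow> fs.dim (supported T :: ('i \<Rightarrow> 'k::field) set) = card T"
  using fs.dim_span_eq_card_independent[OF independent_unitv, of T]
  by (simp add: span_unitv card_image[OF inj_unitv])

lemma (in vec_space) coordinate_iso:
  assumes "fin_dim S" "subspace S"
  obtains h where "Vector_Spaces.linear fscale scale h" "h ` coord_space (dim S) = S"
    "\<And>c. c \<in> coord_space (dim S) \<Longrightarrow> h c = 0 \<Longrightarrow> c = 0"
proof -
  obtain b where b: "indep_fam (dim S) b" "\<And>j. j < dim S \<Longrightarrow> b j \<in> S"
    "\<And>v. v \<in> S \<Longrightarrow> \<exists>c. v = (\<Sum>j<dim S. c j *s b j)"
    using basis_fam[OF assms(1)] by metis
  interpret pair: vec_space_pair "fscale :: 'a \<Rightarrow> (nat \<Rightarrow> 'a) \<Rightarrow> _" scale ..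
  define h where "h c = (\<Sum>j<dim S. c j *s b j)" for c :: "nat \<Rightarrow> 'a"
  show thesis
  proof
    show "Vector_Spaces.linear fscale scale h"
      by (rule pair.linearI)
        (simp_all add: h_def vec_apply scale_left_distrib sum.distrib scale_sum_right)
    show "h ` coord_space (dim S) = S"
    proof (intro equalityI subsetI)
      show "v \<in> S" if "v \<in> h ` coord_space (dim S)" for v
        using that b(2) by (auto simp: h_def intro!: subspace_sum[OF assms(2)]
          intro: subspace_scale[OF assms(2)])
      fix v assume "v \<in> S"
      then obtain c where "v = (\<Sum>j<dim S. c j *s b j)" using b(3) by blast
      then have "v = h (\<lambda>j. if j < dim S then c j else 0)" by (simp add: h_def)
      then show "v \<in> h ` coord_space (dim S)" by (auto simp: supported_def)
    qed
    show "c = 0" if "c \<in> coord_space (dim S)" "h c = 0" for c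
      using indep_famD[OF b(1), of c] that
      by (auto simp: h_def supported_def fun_eq_iff zero_fun_def not_less[symmetric])
  qed
qed

lemma exists_kernel_vector:
  assumes f: "Vector_Spaces.linear fscale fscale (f :: ('i \<Rightarrow> 'k::field) \<Rightarrow> ('j \<Rightarrow> 'k))"
    and T: "finite T" "finite T'" "card T' < card T" and im: "f ` supported T \<subseteq> supported T'"
  obtains w where "w \<in> supported T" "w \<noteq> 0" "f w = 0"
proof -
  have "fs.dim (f ` supported T) \<le> card T'"
    using fs.dim_mono_fin_dim[OF fin_dim_supported[OF T(2)] im] by (simp add: dim_supported T)
  moreover have "card T = fs.dim {x \<in> supported T. f x = 0} + fs.dim (f ` supported T)"
    using ff.rank_nullity[OF f subspace_supported fin_dim_supported[OF T(1)]]
      by (simp add: dim_supported T)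
  ultimately have "fs.dim {x \<in> supported T. f x = 0} \<noteq> 0" using T by linarith
  then have "{x \<in> supported T. f x = 0} \<noteq> {0}" using fs.dim_zero_set by metis
  moreover have "0 \<in> {x \<in> supported T. f x = 0}"
    using fs.subspace_0[OF ff.subspace_kernel_on[OF f subspace_supported]] .
  ultimately show thesis using that by blast
qed

lemma exists_adapted_basis:
  fixes R :: "('i \<Rightarrow> 'k::field) set"
  assumes T: "finite T" and R: "fs.subspace R" "R \<subseteq> supported T"
  obtains B C where "B \<subseteq> C" "fs.independent C" "fs.span B = R" "fs.span C = supported T"
    "finite (C - B)" "fs.dim R + card (C - B) = card T"
proof -
  have fin: "fs.fin_dim (supported T :: ('i \<Rightarrow> 'k) set)" by (rule fin_dim_supported[OF T])
  obtain B where B: "B \<subseteq> R" "fs.independent B" "R \<subseteq> fs.span B" "card B = fs.dim R"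
    by (rule fs.basis_exists)
  obtain C where C: "B \<subseteq> C" "C \<subseteq> supported T" "fs.independent C" "supported T \<subseteq> fs.span C"
    by (rule fs.maximal_independent_subset_extend[of B "supported T"]) (use B R in auto)
  have "finite C" by (rule fs.fin_dim_independent[OF fin C(2,3)])
  then have "card (C - B) = card C - card B" "card B \<le> card C"
    using C(1) by (simp_all add: card_Diff_subset card_mono finite_subset)
  moreover have "card C = card T"
    using fs.basis_card_eq_dim[OF C(2,4,3)] dim_supported[OF T] by simp
  ultimately have "fs.dim R + card (C - B) = card T" using B(4) by simp
  moreover have "fs.span B = R" using B fs.span_minimal[OF B(1) R(1)] by blast
  moreover have "fs.span C = supported T"
    using C fs.span_minimal[OF C(2) subspace_supported] by blast
  ultimately show thesis using that[OF C(1,3)] \<open>finite C\<close> by simp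
qed

lemma exists_quotient_map:
  fixes R :: "('i \<Rightarrow> 'k::field) set"
  assumes T: "finite T" and R: "fs.subspace R" "R \<subseteq> supported T" "fs.dim R + n = card T"
  obtains Q :: "('i \<Rightarrow> 'k) \<Rightarrow> nat \<Rightarrow> 'k" where "Vector_Spaces.linear fscale fscale Q"
    "Q ` supported T = coord_space n" "{w \<in> supported T. Q w = 0} = R"
proof -
  obtain B C where C: "B \<subseteq> C" "fs.independent C" "fs.span B = R" "fs.span C = supported T"
    "finite (C - B)" "fs.dim R + card (C - B) = card T"
    by (rule exists_adapted_basis[OF T R(1,2)])
  have "card (C - B) = n" using C(6) R(3) by linarith
  then obtain g where g: "bij_betw g (C - B) {..<n}"
    using ex_bij_betw_finite_nat[OF C(5)] by (auto simp: atLeast0LessThan)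
  obtain Q where Q: "Vector_Spaces.linear fscale fscale Q"
      "\<And>v. v \<in> C \<Longrightarrow> Q v = (if v \<in> B then 0 else unitv (g v) :: nat \<Rightarrow> 'k)"
    using ff.linear_independent_extend[OF C(2), of "\<lambda>v. if v \<in> B then 0 else unitv (g v)"] by blast
  have "Q ` (C - B) = unitv ` g ` (C - B)"
    unfolding image_image using Q(2) by (intro image_cong) auto
  then have span: "fs.span (Q ` (C - B)) = coord_space n"
    using g span_unitv[of "{..<n}", where ?'k = 'k] by (simp add: bij_betw_def)
  have "Q ` C \<subseteq> insert 0 (Q ` (C - B))" using Q(2) by auto
  then have "fs.span (Q ` C) \<subseteq> coord_space n"
    using fs.span_mono[of "Q ` C" "insert 0 (Q ` (C - B))"] span by simp
  moreover have "coord_space n \<subseteq> fs.span (Q ` C)"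
    unfolding span[symmetric] by (intro fs.span_mono image_mono) auto
  ultimately have im: "Q ` supported T = coord_space n"
    using C(4) ff.linear_span_image[OF Q(1), of C] by auto
  have "R = {w \<in> supported T. Q w = 0}"
  proof (rule fs.subspace_eq_fin_dim[OF fs.fin_dim_subset[OF fin_dim_supported[OF T]] R(1)])
    have "Q v = 0" if "v \<in> B" for v using that Q(2)[of v] C(1) by auto
    then have "Q w = 0" if "w \<in> R" for w
      using ff.linear_eq_0_on_span[OF Q(1), of B w] C(3) that by blast
    then show "R \<subseteq> {w \<in> supported T. Q w = 0}" using R(2) by auto
    show "fs.dim {w \<in> supported T. Q w = 0} \<le> fs.dim R"
      using ff.rank_nullity[OF Q(1) subspace_supported fin_dim_supported[OF T]] im R(3) T
      by (simp add: dim_supported)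
  qed auto
  then show thesis using that[OF Q(1) im] by simp
qed

lemma exists_matrix_eigenvector:
  fixes M :: "'k::field mat"
  assumes closed: "alg_closed TYPE('k)" and M: "M \<in> carrier_mat k k" and k: "0 < k"
  obtains l v where "v \<in> carrier_vec k" "v \<noteq> 0\<^sub>v k" "M *\<^sub>v v = l \<cdot>\<^sub>v v"
proof -
  have "degree (char_poly M) = k" using degree_monic_char_poly[OF M] by simp
  then obtain l where "eigenvalue M l"
    using closed k eigenvalue_root_char_poly[OF M] unfolding alg_closed_def by metis
  then show thesis using that M unfolding eigenvalue_def eigenvector_def by auto
qed

lemma exists_eigenvector:
  fixes f :: "(nat \<Rightarrow> 'k::field) \<Rightarrow> nat \<Rightarrow> 'k"
  assumes closed: "alg_closed TYPE('k)" and f: "Vector_Spaces.linear fscale fscale f"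
    and maps: "\<And>c. c \<in> coord_space k \<Longrightarrow> f c \<in> coord_space k" and k: "0 < k"
  obtains l c where "c \<in> coord_space k" "c \<noteq> 0" "f c = fscale l c"
proof -
  define M where "M = mat k k (\<lambda>(i, j). f (unitv j) i)"
  obtain l v where v: "v \<in> carrier_vec k" "v \<noteq> 0\<^sub>v k" "M *\<^sub>v v = l \<cdot>\<^sub>v v"
    by (rule exists_matrix_eigenvector[OF closed _ k, of M]) (auto simp: M_def)
  define c where "c i = (if i < k then v $ i else 0)" for i
  have c: "c \<in> coord_space k" by (simp add: c_def supported_def)
  have "c \<noteq> 0"
  proof
    assume "c = 0"
    then have "v $ i = 0" if "i < k" for i using that by (metis c_def zero_fun_apply)
    then have "v = 0\<^sub>v k" using v(1) by (intro eq_vecI) auto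
    then show False using v(2) by simp
  qed
  moreover have "f c i = fscale l c i" for i
  proof (cases "i < k")
    case True
    have "f c = (\<Sum>j<k. fscale (c j) (f (unitv j)))"
      by (subst supported_expand[OF _ c]) (simp_all add: ff.linear_sum[OF f] ff.linear_scale[OF f])
    then have "f c i = (\<Sum>j<k. v $ j * f (unitv j) i)"
      by (simp add: sum_fun_apply fscale_apply c_def)
    also have "\<dots> = (M *\<^sub>v v) $ i"
      using True v(1) by (simp add: M_def scalar_prod_def atLeast0LessThan mult.commute)
    finally show ?thesis using True v by (simp add: fscale_apply c_def)
  next
    case False
    then show ?thesis using maps[OF c] c by (simp add: supported_def fscale_apply)
  qed
  ultimately show thesis using that[OF c] by blast
qed

lemma ksubspace_iff: "ksubspace S \<longleftrightarrow> ks.subspace S"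
  unfolding ksubspace_def ks.subspace_def by (auto simp: plus_fun_def zero_fun_def kscale_def)

lemma klin_indep_iff: "klin_indep vs \<longleftrightarrow> ks.indep_fam (length vs) (\<lambda>j. vs ! j)"
  unfolding klin_indep_def ks.indep_fam_def by (simp add: vec_apply fun_eq_iff sum_fun_apply)

lemma kdim_eq_dim:
  assumes "ks.fin_dim S"
  shows "kdim S = ks.dim S"
  unfolding kdim_def
proof (rule Max_eqI)
  let ?L = "{length vs |vs. set vs \<subseteq> S \<and> klin_indep vs}"
  have bound: "?L \<subseteq> {..ks.dim S}"
  proof
    fix l assume "l \<in> ?L"
    then obtain vs where "l = length vs" "set vs \<subseteq> S" "klin_indep vs" by blast
    then show "l \<in> {..ks.dim S}"
      using ks.indep_fam_le_dim[OF assms, of l "\<lambda>j. vs ! j"] by (simp add: klin_indep_iff subset_iff)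
  qed
  show "finite ?L" by (rule finite_subset[OF bound]) simp
  show "l \<le> ks.dim S" if "l \<in> ?L" for l using bound that by auto
  obtain b where b: "ks.indep_fam (ks.dim S) b" "\<And>j. j < ks.dim S \<Longrightarrow> b j \<in> S"
    using ks.basis_fam[OF assms] by metis
  have "klin_indep (map b [0..<ks.dim S])"
    using b(1) unfolding klin_indep_iff ks.indep_fam_def by simp
  then show "ks.dim S \<in> ?L"
    using b(2) by (intro CollectI exI[of _ "map b [0..<ks.dim S]"]) auto
qed

section \<open>Leading positions\<close>

definition leads_at :: "(nat \<Rightarrow> 'k::zero) \<Rightarrow> nat \<Rightarrow> bool" where
  "leads_at v i \<longleftrightarrow> v i \<noteq> 0 \<and> (\<forall>j<i. v j = 0)"

definition lead_set :: "(nat \<Rightarrow> 'k::zero) set \<Rightarrow> nat set" where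
  "lead_set S = {i. \<exists>v\<in>S. leads_at v i}"

lemma lead_set_subset: "S \<subseteq> coord_space n \<Longrightarrow> lead_set S \<subseteq> {..<n}"
  unfolding lead_set_def leads_at_def supported_def by auto

lemma dim_eq_dim_vanishing_at:
  fixes S :: "('i \<Rightarrow> 'k::field) set"
  assumes S: "fs.subspace S" "fs.fin_dim S"
  shows "fs.dim S = fs.dim {v \<in> S. v m = 0} + of_bool (\<exists>v\<in>S. v m \<noteq> 0)"
proof -
  define f :: "('i \<Rightarrow> 'k) \<Rightarrow> 'i \<Rightarrow> 'k" where "f v = fscale (v m) (unitv m)" for v
  have lin: "Vector_Spaces.linear fscale fscale f"
    by (rule ff.linearI) (auto simp: f_def vec_apply fun_eq_iff algebra_simps)
  have f_eq_0: "f v = 0 \<longleftrightarrow> v m = 0" for v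
    by (auto simp: f_def vec_apply fun_eq_iff unitv_def)
  have "f ` S \<subseteq> supported {m}" by (auto simp: f_def supported_def unitv_def fscale_apply)
  then have "fs.dim (f ` S) \<le> 1"
    using fs.dim_mono_fin_dim[OF fin_dim_supported[of "{m}"]] by (simp add: dim_supported)
  moreover have "fs.dim (f ` S) = 0 \<longleftrightarrow> f ` S = {0}"
    using ff.linear_subspace_image[OF lin S(1)] ff.fin_dim_image[OF lin S(2)]
    by (intro fs.dim_eq_0_iff_fin_dim)
  moreover have "f ` S = {0} \<longleftrightarrow> \<not> (\<exists>v\<in>S. v m \<noteq> 0)"
    using fs.subspace_0[OF S(1)] by (auto simp: image_iff f_eq_0 set_eq_iff) (metis f_eq_0)+
  ultimately have "fs.dim (f ` S) = of_bool (\<exists>v\<in>S. v m \<noteq> 0)" by (cases "fs.dim (f ` S)") auto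
  then show ?thesis using ff.rank_nullity[OF lin S] by (simp add: f_eq_0)
qed

lemma dim_eq_card_lead_set:
  fixes S :: "(nat \<Rightarrow> 'k::field) set"
  assumes S: "fs.subspace S" "S \<subseteq> coord_space n"
  shows "fs.dim S = card (lead_set S)"
proof -
  define T where "T m = {v \<in> S. \<forall>j<m. v j = 0}" for m
  have T: "fs.subspace (T m)" "fs.fin_dim (T m)" for m
  proof -
    show "fs.subspace (T m)" using S(1) unfolding T_def fs.subspace_def by (auto simp: vec_apply)
    show "fs.fin_dim (T m)"
      using S(2) by (intro fs.fin_dim_subset[OF fin_dim_supported[of "{..<n}"]]) (auto simp: T_def)
  qed
  have "fs.dim (T m) = card (lead_set S \<inter> {m..<n})" if "m \<le> n" for m
    using that
  proof (induction m rule: inc_induct)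
    case base
    have "v i = 0" if "v \<in> T n" for v i
      using that S(2) by (cases "i < n") (auto simp: T_def supported_def)
    then have "T n = {0}"
      using fs.subspace_0[OF T(1)] by (auto simp: fun_eq_iff vec_apply)
    then show ?case by (simp add: fs.dim_zero_set)
  next
    case (step m)
    have "{v \<in> T m. v m = 0} = T (Suc m)" by (auto simp: T_def less_Suc_eq)
    moreover have "(\<exists>v\<in>T m. v m \<noteq> 0) \<longleftrightarrow> m \<in> lead_set S" by (auto simp: T_def lead_set_def leads_at_def)
    ultimately have "fs.dim (T m) = fs.dim (T (Suc m)) + of_bool (m \<in> lead_set S)"
      using dim_eq_dim_vanishing_at[OF T, of m m] by simp
    moreover have "lead_set S \<inter> {m..<n} = (if m \<in> lead_set S then {m} else {}) \<union> (lead_set S \<inter> {Suc m..<n})"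
      using step.hyps by (auto simp: Suc_le_eq order.order_iff_strict)
    ultimately show ?case using step.IH by simp
  qed
  from this[of 0] show ?thesis
    using lead_set_subset[OF S(2)] by (simp add: T_def atLeast0LessThan Int_absorb2)
qed

section \<open>Stable Kronecker modules\<close>

locale kronecker_module =
  fixes N k n :: nat and A :: "nat \<Rightarrow> (nat \<Rightarrow> 'k::field) \<Rightarrow> nat \<Rightarrow> 'k"
  assumes linear: "\<And>s. Vector_Spaces.linear fscale fscale (A s)"
    and maps_to: "\<And>s c. s < N \<Longrightarrow> c \<in> coord_space k \<Longrightarrow> A s c \<in> coord_space n"
begin

definition subrep :: "(nat \<Rightarrow> 'k) set \<Rightarrow> (nat \<Rightarrow> 'k) set \<Rightarrow> bool" where
  "subrep C U \<longleftrightarrow> fs.subspace C \<and> C \<subseteq> coord_space k \<and> fs.subspace U \<and> U \<subseteq> coord_space n \<and>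
     (\<forall>s<N. \<forall>c\<in>C. A s c \<in> U)"

definition preimage :: "(nat \<Rightarrow> 'k) set \<Rightarrow> (nat \<Rightarrow> 'k) set" where
  "preimage U = {c \<in> coord_space k. \<forall>s<N. A s c \<in> U}"

lemma fin_dim_subrep:
  assumes "subrep C U"
  shows "fs.fin_dim C" "fs.fin_dim U"
  using assms fs.fin_dim_subset[OF fin_dim_supported[OF finite_lessThan]] unfolding subrep_def by blast+

lemma dim_subrep_eq_0_iff:
  assumes "subrep C U"
  shows "fs.dim C = 0 \<longleftrightarrow> C = {0}" "fs.dim U = 0 \<longleftrightarrow> U = {0}"
  using assms by (auto intro!: fs.dim_eq_0_iff_fin_dim fin_dim_subrep[OF assms] simp: subrep_def)

lemma subrep_eq_coord_space:
  assumes "subrep C U" "n \<le> fs.dim U"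
  shows "U = coord_space n"
  using assms by (intro fs.subspace_eq_fin_dim[OF fin_dim_supported])
    (auto simp: subrep_def dim_supported)

lemma subrep_preimage:
  assumes "fs.subspace U" "U \<subseteq> coord_space n"
  shows "subrep (preimage U) U"
  using subspace_supported[of "{..<k}"] assms unfolding subrep_def preimage_def
  by (auto simp: fs.subspace_def ff.linear_0[OF linear] ff.linear_add[OF linear]
    ff.linear_scale[OF linear])

end

locale stable_kronecker_module = kronecker_module N k n A
  for N k n and A :: "nat \<Rightarrow> (nat \<Rightarrow> 'k::field) \<Rightarrow> nat \<Rightarrow> 'k" +
  assumes stable: "subrep C U \<Longrightarrow> C \<noteq> {0} \<or> U \<noteq> {0} \<Longrightarrow> U \<noteq> coord_space n \<Longrightarrow>
    n * fs.dim C < k * fs.dim U"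
begin

lemma injective:
  assumes "0 < n" "c \<in> coord_space k" "\<And>s. s < N \<Longrightarrow> A s c = 0"
  shows "c = 0"
proof (rule ccontr)
  assume "c \<noteq> 0"
  have "fs.subspace {0 :: nat \<Rightarrow> 'k}" "{0} \<subseteq> (coord_space n :: (nat \<Rightarrow> 'k) set)"
    using fs.subspace_0[OF subspace_supported] by (auto simp: fs.subspace_single_0)
  then have "subrep (preimage {0}) {0}" by (rule subrep_preimage)
  moreover have "preimage {0} \<noteq> {0}" using assms \<open>c \<noteq> 0\<close> by (auto simp: preimage_def)
  moreover have "fs.dim {0 :: nat \<Rightarrow> 'k} \<noteq> fs.dim (coord_space n :: (nat \<Rightarrow> 'k) set)"
    using assms(1) by (simp add: fs.dim_zero_set dim_supported)
  then have "{0} \<noteq> (coord_space n :: (nat \<Rightarrow> 'k) set)" by metis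
  ultimately show False using stable[of "preimage {0}" "{0}"] by (simp add: fs.dim_zero_set)
qed

end

subsection \<open>Modules given by intervals\<close>

text \<open>The cells \<open>[l, l + 1]\<close> that touch a block \<open>[i n/k, (i + 1) n/k]\<close> with \<open>i \<in> I\<close>, when the interval
  \<open>[0, n]\<close> is cut into \<open>n\<close> cells as well as into \<open>k\<close> blocks.\<close>

definition touching :: "nat \<Rightarrow> nat \<Rightarrow> nat set \<Rightarrow> nat set" where
  "touching n k I = {l. l < n \<and> (\<exists>i\<in>I. n * i \<le> k * (l + 1) \<and> k * l \<le> n * (i + 1))}"

lemma boundary_element:
  assumes "I \<subseteq> {..<k::nat}" "I \<noteq> {}" "I \<noteq> {..<k}"
  obtains j where "Suc j < k" "(j \<in> I) \<noteq> (Suc j \<in> I)"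
proof -
  have "\<exists>j. Suc j < k \<and> (j \<in> I) \<noteq> (Suc j \<in> I)"
  proof (rule ccontr)
    assume none: "\<not> ?thesis"
    have "j \<in> I \<longleftrightarrow> 0 \<in> I" if "j < k" for j
      using that none by (induction j) auto
    then show False using assms by blast
  qed
  then show thesis using that by blast
qed

lemma div_in_touching:
  assumes "0 < k" "i \<in> I" "n * i \<le> t + 1" "t \<le> n * (i + 1)" "t < n * k"
  shows "t div k \<in> touching n k I"
proof -
  have "t div k < n" using assms by (simp add: div_less_iff_less_mult)
  moreover have "n * i \<le> k * (t div k + 1)"
    using assms(3) dividend_less_times_div[OF assms(1), of t] by simp
  moreover have "k * (t div k) \<le> n * (i + 1)"
    using assms(4) times_div_less_eq_dividend[of k t] by linarith
  ultimately show ?thesis using assms(2) unfolding touching_def by blast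
qed

text \<open>Cut \<open>[0, n]\<close> into \<open>n k\<close> atoms, \<open>n\<close> in each block and \<open>k\<close> in each cell: every atom of a block
  in \<open>I\<close> lies in a touching cell, and so does an atom next to \<open>I\<close> if \<open>I\<close> has a boundary point inside.\<close>

definition atoms :: "nat \<Rightarrow> nat \<Rightarrow> nat set \<Rightarrow> nat set" where
  "atoms k m I = {t. t < k * m \<and> t div m \<in> I}"

lemma finite_atoms: "finite (atoms k m I)"
  by (simp add: atoms_def)

lemma card_atoms:
  assumes "0 < m" "I \<subseteq> {..<k}"
  shows "card (atoms k m I) = m * card I"
proof -
  have div_eq: "t div m = i" if "t \<in> {m * i..<m * i + m}" for i t
    using that by (intro div_nat_eqI) (auto simp: algebra_simps)
  have "atoms k m I = (\<Union>i\<in>I. {m * i..<m * i + m})"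
  proof (intro equalityI subsetI)
    fix t assume "t \<in> atoms k m I"
    then show "t \<in> (\<Union>i\<in>I. {m * i..<m * i + m})"
      using dividend_less_times_div[OF assms(1), of t] by (force simp: atoms_def)
  next
    fix t assume "t \<in> (\<Union>i\<in>I. {m * i..<m * i + m})"
    then obtain i where i: "i \<in> I" "t div m = i" using div_eq by blast
    then have "t < k * m" using assms by (auto simp: div_less_iff_less_mult[symmetric])
    then show "t \<in> atoms k m I" using i by (simp add: atoms_def)
  qed
  also have "card \<dots> = (\<Sum>i\<in>I. card {m * i..<m * i + m})"
  proof (rule card_UN_disjoint)
    show "finite I" using assms finite_subset by blast
    show "\<forall>i\<in>I. \<forall>j\<in>I. i \<noteq> j \<longrightarrow> {m * i..<m * i + m} \<inter> {m * j..<m * j + m} = {}"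
      using div_eq by blast
  qed auto
  finally show ?thesis by simp
qed

lemma card_atoms_touching: "0 < k \<Longrightarrow> card (atoms n k (touching n k I)) = k * card (touching n k I)"
  by (rule card_atoms) (auto simp: touching_def)

lemma atoms_subset_atoms_touching:
  assumes "0 < n" "0 < k"
  shows "atoms k n I \<subseteq> atoms n k (touching n k I)"
proof
  fix t assume t: "t \<in> atoms k n I"
  have "n * (t div n) \<le> t + 1" by (rule trans_le_add1[OF times_div_less_eq_dividend])
  moreover have "t \<le> n * (t div n + 1)" using dividend_less_times_div[OF assms(1), of t] by simp
  ultimately have "t div k \<in> touching n k I"
    using t assms(2) by (intro div_in_touching[of k "t div n"]) (simp_all add: atoms_def mult.commute)
  then show "t \<in> atoms n k (touching n k I)" using t by (simp add: atoms_def mult.commute)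
qed

lemma card_le_card_touching:
  assumes "0 < n" "0 < k" "I \<subseteq> {..<k}"
  shows "n * card I \<le> k * card (touching n k I)"
  using card_mono[OF finite_atoms atoms_subset_atoms_touching[OF assms(1,2), of I]] assms
  by (simp add: card_atoms card_atoms_touching)

lemma card_less_card_touching:
  assumes pos: "0 < n" "0 < k" and I: "I \<subseteq> {..<k}" "I \<noteq> {}" "I \<noteq> {..<k}"
  shows "n * card I < k * card (touching n k I)"
proof -
  obtain j where j: "Suc j < k" "(j \<in> I) \<noteq> (Suc j \<in> I)" using boundary_element[OF I] .
  define t where "t = (if j \<in> I then n * Suc j else n * Suc j - 1)"
  define i where "i = (if j \<in> I then j else Suc j)"
  have "n * Suc j + n \<le> n * k" using j(1) mult_le_mono2[of "Suc (Suc j)" k n] by simp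
  then have t: "t < n * k" using pos by (auto simp: t_def)
  have "t div n = (if j \<in> I then Suc j else j)"
    using pos by (auto simp: t_def intro!: div_nat_eqI)
  then have "t \<notin> atoms k n I" using j(2) by (auto simp: atoms_def)
  moreover have "t div k \<in> touching n k I"
    using j pos t by (intro div_in_touching[of k i]) (auto simp: t_def i_def)
  then have "t \<in> atoms n k (touching n k I)" using t by (simp add: atoms_def)
  ultimately have "atoms k n I \<subset> atoms n k (touching n k I)"
    using atoms_subset_atoms_touching[OF pos, of I] by blast
  then show ?thesis
    using psubset_card_mono[OF finite_atoms] card_atoms[OF pos(1) I(1)]
      card_atoms_touching[OF pos(2)] by metis
qed

definition block_start :: "nat \<Rightarrow> nat \<Rightarrow> nat \<Rightarrow> nat" where
  "block_start n k i = (n * i + k - 1) div k"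

lemma block_start_less:
  assumes "0 < k" "k \<le> n" "i < j"
  shows "block_start n k i < block_start n k j"
proof -
  have "n * Suc i \<le> n * j" using assms(3) by (intro mult_le_mono2) simp
  then have "n * i + k - 1 + k \<le> n * j + k - 1" using assms by simp
  then have "(n * i + k - 1 + k) div k \<le> block_start n k j" unfolding block_start_def
    by (rule div_le_mono)
  moreover have "(n * i + k - 1 + k) div k = block_start n k i + 1"
    unfolding block_start_def using assms(1) by (intro div_add_self2) simp
  ultimately show ?thesis by simp
qed

lemma block_start_inj:
  assumes "0 < k" "k \<le> n" "block_start n k i = block_start n k j"
  shows "i = j"
  using block_start_less[OF assms(1,2)] assms(3) by (metis linorder_neqE_nat nat_neq_iff)

lemma touching_cell_in_interval:
  assumes "0 < k" "n + k < N * k" "n * i \<le> k * (l + 1)" "k * l \<le> n * (i + 1)"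
  shows "block_start n k i \<le> l + 1" "l + 1 < block_start n k i + N"
proof -
  have "n * i + k - 1 < (l + 2) * k" using assms(1,3) by (simp add: algebra_simps)
  then have "block_start n k i < l + 2"
    unfolding block_start_def using assms(1) by (simp add: div_less_iff_less_mult)
  then show "block_start n k i \<le> l + 1" by simp
  have "n * i \<le> k * block_start n k i"
    using dividend_less_times_div[OF assms(1), of "n * i + k - 1"] by (simp add: block_start_def)
  then have "k * (l + 1) < k * (block_start n k i + N)"
    using assms(2,4) by (simp add: algebra_simps)
  then show "l + 1 < block_start n k i + N" by (simp only: mult_less_cancel1)
qed

definition interval_map :: "nat \<Rightarrow> nat \<Rightarrow> nat \<Rightarrow> (nat \<Rightarrow> 'k::field) \<Rightarrow> nat \<Rightarrow> 'k" where
  "interval_map k n s c = (\<lambda>l. \<Sum>i<k. if l < n \<and> l + 1 = block_start n k i + s then c i else 0)"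

lemma leads_at_interval_map:
  assumes k: "0 < k" "k \<le> n" and v: "leads_at v i" and i: "i < k"
    and l: "l < n" "l + 1 = block_start n k i + s"
  shows "leads_at (interval_map k n s v) l"
  unfolding leads_at_def
proof (intro conjI allI impI)
  have "interval_map k n s v l = (\<Sum>j<k. if j = i then v i else 0)"
    unfolding interval_map_def using l by (intro sum.cong) (auto dest: block_start_inj[OF k])
  then show "interval_map k n s v l \<noteq> 0" using v i by (simp add: leads_at_def)
  fix l' assume "l' < l"
  have "v j = 0" if "l' + 1 = block_start n k j + s" for j
  proof -
    have "block_start n k j < block_start n k i" using that \<open>l' < l\<close> l by simp
    then have "j < i" using block_start_less[OF k, of i j] by (cases i j rule: linorder_cases) auto
    then show ?thesis using v by (simp add: leads_at_def)
  qed
  then show "interval_map k n s v l' = 0"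
    unfolding interval_map_def by (intro sum.neutral) auto
qed

lemma kronecker_module_interval_map:
  "kronecker_module N k n (interval_map k n :: nat \<Rightarrow> (nat \<Rightarrow> 'k::field) \<Rightarrow> nat \<Rightarrow> 'k)"
proof (rule kronecker_module.intro)
  show "Vector_Spaces.linear fscale fscale (interval_map k n s :: (nat \<Rightarrow> 'k) \<Rightarrow> nat \<Rightarrow> 'k)" for s
    by (rule ff.linearI) (auto simp: interval_map_def vec_apply fun_eq_iff sum_distrib_left
        simp flip: sum.distrib intro!: sum.cong)
qed (auto simp: supported_def interval_map_def)

lemma touching_lead_set_subset:
  assumes k: "0 < k" "k \<le> n" "n + k < N * k" and C: "C \<subseteq> coord_space k"
    and maps: "\<forall>s<N. \<forall>c\<in>C. interval_map k n s c \<in> U"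
  shows "touching n k (lead_set C) \<subseteq> lead_set U"
proof
  fix l assume "l \<in> touching n k (lead_set C)"
  then obtain i where l: "l < n" and i: "i \<in> lead_set C" "n * i \<le> k * (l + 1)" "k * l \<le> n * (i + 1)"
    by (auto simp: touching_def)
  then obtain v where v: "v \<in> C" "leads_at v i" by (auto simp: lead_set_def)
  obtain s where s: "s < N" "l + 1 = block_start n k i + s"
    using touching_cell_in_interval[OF k(1,3) i(2,3)] by (metis add_less_cancel_left le_Suc_ex)
  have "leads_at (interval_map k n s v) l"
    using i lead_set_subset[OF C] by (intro leads_at_interval_map[OF k(1,2) v(2) _ l s(2)]) auto
  then show "l \<in> lead_set U" using maps v(1) s(1) unfolding lead_set_def by blast
qed

lemma stable_interval_module:
  assumes k: "0 < k" "k \<le> n" "n + k < N * k"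
  shows "stable_kronecker_module N k n (interval_map k n :: nat \<Rightarrow> (nat \<Rightarrow> 'k::field) \<Rightarrow> nat \<Rightarrow> 'k)"
proof -
  interpret kronecker_module N k n "interval_map k n :: nat \<Rightarrow> (nat \<Rightarrow> 'k) \<Rightarrow> nat \<Rightarrow> 'k"
    by (rule kronecker_module_interval_map)
  show ?thesis
  proof
    fix C U assume sub: "subrep C U" and ne: "C \<noteq> {0} \<or> U \<noteq> {0}" "U \<noteq> coord_space n"
    have C: "fs.subspace C" "C \<subseteq> coord_space k" and U: "fs.subspace U" "U \<subseteq> coord_space n"
      using sub by (auto simp: subrep_def)
    let ?L = "lead_set C"
    have lead_C: "?L \<subseteq> {..<k}" "fs.dim C = card ?L"
      using lead_set_subset[OF C(2)] dim_eq_card_lead_set[OF C] by auto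
    have "touching n k ?L \<subseteq> lead_set U"
      using touching_lead_set_subset[OF k C(2)] sub unfolding subrep_def by blast
    then have le: "card (touching n k ?L) \<le> fs.dim U"
      using lead_set_subset[OF U(2)] finite_subset unfolding dim_eq_card_lead_set[OF U]
      by (intro card_mono) auto
    consider (expands) "n * fs.dim C < k * card (touching n k ?L)" | (zero) "fs.dim C = 0" |
      (full) "n \<le> fs.dim U"
      using card_less_card_touching[of n k ?L] card_le_card_touching[of n k ?L] k lead_C le
      by (cases "?L = {..<k}") (auto simp: card_eq_0_iff)
    then show "n * fs.dim C < k * fs.dim U"
    proof cases
      case expands
      then show ?thesis using mult_le_mono2[OF le, of k] by linarith
    next
      case zero
      then show ?thesis using ne(1) k(1) dim_subrep_eq_0_iff[OF sub] by auto
    next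
      case full
      then show ?thesis using subrep_eq_coord_space[OF sub] ne(2) by blast
    qed
  qed
qed

subsection \<open>Reflection\<close>

definition slice :: "nat \<Rightarrow> (nat \<times> nat \<Rightarrow> 'k::field) \<Rightarrow> nat \<Rightarrow> 'k" where
  "slice s w = (\<lambda>i. w (s, i))"

definition in_copy :: "nat \<Rightarrow> (nat \<Rightarrow> 'k::field) \<Rightarrow> nat \<times> nat \<Rightarrow> 'k" where
  "in_copy s v = (\<lambda>(s', i). if s' = s then v i else 0)"

definition copies :: "nat \<Rightarrow> (nat \<Rightarrow> 'k::field) set \<Rightarrow> (nat \<times> nat \<Rightarrow> 'k) set" where
  "copies N U = {w. (\<forall>s<N. slice s w \<in> U) \<and> (\<forall>s\<ge>N. slice s w = 0)}"

lemma linear_slice: "Vector_Spaces.linear fscale fscale (slice s)"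
  by (rule ff.linearI) (auto simp: slice_def fun_eq_iff vec_apply)

lemma linear_in_copy: "Vector_Spaces.linear fscale fscale (in_copy s)"
  by (rule ff.linearI) (auto simp: in_copy_def fun_eq_iff vec_apply)

lemma slice_eqI: "(\<And>s. slice s w = slice s w') \<Longrightarrow> w = w'"
  by (auto simp: slice_def fun_eq_iff)

lemma slice_in_copy: "slice s' (in_copy s v) = (if s' = s then v else 0)"
  by (auto simp: slice_def in_copy_def fun_eq_iff vec_apply)

lemma copies_expand:
  assumes "w \<in> copies N U"
  shows "w = (\<Sum>s<N. in_copy s (slice s w))"
proof (rule slice_eqI)
  fix s
  have "slice s (\<Sum>s<N. in_copy s (slice s w)) = (\<Sum>s'<N. if s = s' then slice s' w else 0)"
    by (simp add: ff.linear_sum[OF linear_slice] slice_in_copy)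
  then show "slice s w = slice s (\<Sum>s<N. in_copy s (slice s w))"
    using assms by (auto simp: copies_def)
qed

lemma copies_coord_space: "copies N (coord_space n) = supported ({..<N} \<times> {..<n})"
  by (auto simp: copies_def slice_def supported_def fun_eq_iff vec_apply) (metis not_le)

lemma copies_mono: "U \<subseteq> U' \<Longrightarrow> copies N U \<subseteq> copies N U'"
  by (auto simp: copies_def)

lemma subspace_copies: "fs.subspace U \<Longrightarrow> fs.subspace (copies N U)"
  unfolding fs.subspace_def copies_def
  by (auto simp: ff.linear_0[OF linear_slice] ff.linear_add[OF linear_slice]
    ff.linear_scale[OF linear_slice])

definition map_slices ::
  "nat \<Rightarrow> ((nat \<Rightarrow> 'k) \<Rightarrow> nat \<Rightarrow> 'k) \<Rightarrow> (nat \<times> nat \<Rightarrow> 'k::field) \<Rightarrow> nat \<times> nat \<Rightarrow> 'k" where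
  "map_slices N h w = (\<Sum>s<N. in_copy s (h (slice s w)))"

lemma slice_map_slices: "slice s (map_slices N h w) = (if s < N then h (slice s w) else 0)"
proof -
  have "slice s (map_slices N h w) = (\<Sum>s'<N. if s = s' then h (slice s' w) else 0)"
    by (simp add: map_slices_def ff.linear_sum[OF linear_slice] slice_in_copy)
  then show ?thesis by simp
qed

lemma linear_map_slices:
  assumes "Vector_Spaces.linear fscale fscale h"
  shows "Vector_Spaces.linear fscale fscale (map_slices N h)"
  by (rule ff.linearI) (simp_all add: map_slices_def sum.distrib fs.scale_sum_right
      ff.linear_add[OF linear_slice] ff.linear_add[OF assms] ff.linear_add[OF linear_in_copy]
      ff.linear_scale[OF linear_slice] ff.linear_scale[OF assms] ff.linear_scale[OF linear_in_copy])

lemma map_slices_image: "map_slices N h ` copies N S = copies N (h ` S)"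
proof (intro equalityI subsetI)
  fix x assume "x \<in> map_slices N h ` copies N S"
  then show "x \<in> copies N (h ` S)" by (auto simp: copies_def slice_map_slices)
next
  fix x assume x: "x \<in> copies N (h ` S)"
  then have "\<exists>c. c \<in> S \<and> slice s x = h c" if "s < N" for s
    using that unfolding copies_def by blast
  then obtain c where c: "\<And>s. s < N \<Longrightarrow> c s \<in> S \<and> slice s x = h (c s)" by metis
  define w where "w = (\<lambda>(s, j). if s < N then c s j else 0)"
  have slice_w: "slice s w = (if s < N then c s else 0)" for s
    by (auto simp: w_def slice_def fun_eq_iff vec_apply)
  have "x = map_slices N h w"
    using x c by (intro slice_eqI) (auto simp: slice_map_slices slice_w copies_def)
  moreover have "w \<in> copies N S" using c by (simp add: copies_def slice_w)
  ultimately show "x \<in> map_slices N h ` copies N S" by blast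
qed

lemma map_slices_eq_0D:
  assumes h: "\<And>c. c \<in> S \<Longrightarrow> h c = 0 \<Longrightarrow> c = 0" and w: "w \<in> copies N S" "map_slices N h w = 0"
  shows "w = 0"
proof (rule slice_eqI)
  fix s
  have "slice s (map_slices N h w) = 0" using w(2) by (simp add: ff.linear_0[OF linear_slice])
  then show "slice s w = slice s 0"
    using w(1) h[of "slice s w"]
    by (auto simp: slice_map_slices copies_def ff.linear_0[OF linear_slice] not_less split: if_splits)
qed

lemma dim_copies:
  fixes U :: "(nat \<Rightarrow> 'k::field) set"
  assumes U: "fs.subspace U" "fs.fin_dim U"
  shows "fs.dim (copies N U) = N * fs.dim U"
proof -
  let ?S = "coord_space (fs.dim U) :: (nat \<Rightarrow> 'k) set"
  obtain h where h: "Vector_Spaces.linear fscale fscale h" "h ` ?S = U"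
    "\<And>c. c \<in> ?S \<Longrightarrow> h c = 0 \<Longrightarrow> c = 0"
    using fs.coordinate_iso[OF U(2,1)] by metis
  have S: "copies N ?S = supported ({..<N} \<times> {..<fs.dim U})" by (rule copies_coord_space)
  have "fs.dim (map_slices N h ` copies N ?S) = fs.dim (copies N ?S)"
  proof (rule ff.dim_image_inj[OF linear_map_slices[OF h(1)]])
    show "fs.subspace (copies N ?S)" "fs.fin_dim (copies N ?S)"
      by (simp_all add: S subspace_supported fin_dim_supported)
  qed (rule map_slices_eq_0D[OF h(3)])
  then have "fs.dim (copies N U) = fs.dim (copies N ?S)" by (simp only: map_slices_image h(2))
  then show ?thesis by (simp add: S dim_supported card_cartesian_product)
qed

context kronecker_module
begin

definition stack :: "(nat \<Rightarrow> 'k) \<Rightarrow> nat \<times> nat \<Rightarrow> 'k" where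
  "stack c = (\<lambda>(s, i). if s < N then A s c i else 0)"

lemma linear_stack: "Vector_Spaces.linear fscale fscale stack"
  by (rule ff.linearI)
    (auto simp: stack_def fun_eq_iff ff.linear_add[OF linear] ff.linear_scale[OF linear] vec_apply)

lemma slice_stack: "slice s (stack c) = (if s < N then A s c else 0)"
  by (auto simp: slice_def stack_def fun_eq_iff vec_apply)

lemma stack_in_copies_iff: "stack c \<in> copies N U \<longleftrightarrow> (\<forall>s<N. A s c \<in> U)"
  by (simp add: copies_def slice_stack)

lemma stack_eq_0D: "stack c = 0 \<Longrightarrow> s < N \<Longrightarrow> A s c = 0"
  using slice_stack[of s c] by (simp add: ff.linear_0[OF linear_slice])

lemma copies_Int_stack_image: "copies N C \<inter> stack ` coord_space k = stack ` preimage C"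
  by (auto simp: preimage_def stack_in_copies_iff)

text \<open>\<open>Q\<close> is a cokernel of \<open>stack\<close>, and its restrictions to the copies of \<open>k\<^sup>n\<close> are the maps of the
  reflected module.\<close>

lemma dim_reflected_subrep:
  fixes Q :: "(nat \<times> nat \<Rightarrow> 'k) \<Rightarrow> nat \<Rightarrow> 'k"
  assumes Q: "Vector_Spaces.linear fscale fscale Q"
      "{w \<in> supported ({..<N} \<times> {..<n}). Q w = 0} = stack ` coord_space k"
    and C: "fs.subspace C" "C \<subseteq> coord_space n" and U: "fs.subspace U" "fs.fin_dim U"
    and maps: "\<And>s c. s < N \<Longrightarrow> c \<in> C \<Longrightarrow> Q (in_copy s c) \<in> U"
  shows "N * fs.dim C \<le> fs.dim U + fs.dim (preimage C)"
proof -
  have fin_C: "fs.fin_dim C" by (rule fs.fin_dim_subset[OF fin_dim_supported C(2)]) simp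
  have sub_copies: "copies N C \<subseteq> supported ({..<N} \<times> {..<n})"
    using copies_mono[OF C(2)] by (simp add: copies_coord_space)
  have fin_copies: "fs.fin_dim (copies N C)"
    by (rule fs.fin_dim_subset[OF fin_dim_supported sub_copies]) simp
  have "Q ` copies N C \<subseteq> U"
  proof safe
    fix w assume w: "w \<in> copies N C"
    have "Q w = (\<Sum>s<N. Q (in_copy s (slice s w)))"
      by (subst copies_expand[OF w]) (simp add: ff.linear_sum[OF Q(1)])
    then show "Q w \<in> U" using w maps by (auto simp: copies_def intro!: fs.subspace_sum[OF U(1)])
  qed
  then have "fs.dim (Q ` copies N C) \<le> fs.dim U" by (rule fs.dim_mono_fin_dim[OF U(2)])
  moreover have "fs.dim {w \<in> copies N C. Q w = 0} \<le> fs.dim (preimage C)"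
  proof -
    have sub: "fs.subspace (preimage C)" and fin: "fs.fin_dim (preimage C)"
      using subrep_preimage[OF C] fin_dim_subrep by (auto simp: subrep_def)
    have "{w \<in> copies N C. Q w = 0} \<subseteq> stack ` preimage C"
      unfolding copies_Int_stack_image[symmetric] using Q(2) sub_copies by blast
    then have "fs.dim {w \<in> copies N C. Q w = 0} \<le> fs.dim (stack ` preimage C)"
      by (rule fs.dim_mono_fin_dim[OF ff.fin_dim_image[OF linear_stack fin]])
    also have "\<dots> \<le> fs.dim (preimage C)" by (rule ff.dim_image_le_fin_dim[OF linear_stack sub fin])
    finally show ?thesis .
  qed
  ultimately show ?thesis
    using ff.rank_nullity[OF Q(1) subspace_copies[OF C(1)] fin_copies] dim_copies[OF C(1) fin_C, of N]
    by simp
qed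

lemma kronecker_module_reflection:
  assumes Q: "Vector_Spaces.linear fscale fscale Q" "Q ` supported ({..<N} \<times> {..<n}) = coord_space m"
  shows "kronecker_module N n m (\<lambda>s v. Q (in_copy s v))"
proof (rule kronecker_module.intro)
  show "Vector_Spaces.linear fscale fscale (\<lambda>v. Q (in_copy s v))" for s
    by (rule ff.linearI) (simp_all add: ff.linear_add[OF linear_in_copy] ff.linear_add[OF Q(1)]
        ff.linear_scale[OF linear_in_copy] ff.linear_scale[OF Q(1)])
  show "Q (in_copy s v) \<in> coord_space m" if "s < N" "v \<in> coord_space n" for s v
  proof -
    have "in_copy s v \<in> supported ({..<N} \<times> {..<n})"
      using that by (auto simp: in_copy_def supported_def)
    then show ?thesis using Q(2) by blast
  qed
qed

end

context stable_kronecker_module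
begin

lemma exists_stack_cokernel:
  assumes pos: "0 < n" and m: "k + m = N * n"
  obtains Q :: "(nat \<times> nat \<Rightarrow> 'k) \<Rightarrow> nat \<Rightarrow> 'k" where "Vector_Spaces.linear fscale fscale Q"
    "Q ` supported ({..<N} \<times> {..<n}) = coord_space m"
    "{w \<in> supported ({..<N} \<times> {..<n}). Q w = 0} = stack ` coord_space k"
proof (rule exists_quotient_map)
  show "fs.subspace (stack ` coord_space k)"
    by (rule ff.linear_subspace_image[OF linear_stack subspace_supported])
  show "stack ` coord_space k \<subseteq> supported ({..<N} \<times> {..<n})"
    using stack_in_copies_iff maps_to unfolding copies_coord_space[symmetric] by blast
  have "fs.dim (stack ` coord_space k) = k"
    using ff.dim_image_inj[OF linear_stack subspace_supported fin_dim_supported[of "{..<k}"]]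
      injective[OF pos] stack_eq_0D by (simp add: dim_supported)
  then show "fs.dim (stack ` coord_space k) + m = card ({..<N} \<times> {..<n})" using m by simp
qed (auto intro: that)

lemma exists_stable_reflection:
  assumes pos: "0 < n" and m: "k + m = N * n"
  obtains B :: "nat \<Rightarrow> (nat \<Rightarrow> 'k) \<Rightarrow> nat \<Rightarrow> 'k" where "stable_kronecker_module N n m B"
proof -
  obtain Q :: "(nat \<times> nat \<Rightarrow> 'k) \<Rightarrow> nat \<Rightarrow> 'k" where Q: "Vector_Spaces.linear fscale fscale Q"
    "Q ` supported ({..<N} \<times> {..<n}) = coord_space m"
    "{w \<in> supported ({..<N} \<times> {..<n}). Q w = 0} = stack ` coord_space k"
    by (rule exists_stack_cokernel[OF assms])
  interpret B: kronecker_module N n m "\<lambda>s v. Q (in_copy s v)"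
    by (rule kronecker_module_reflection[OF Q(1,2)])
  have "stable_kronecker_module N n m (\<lambda>s v. Q (in_copy s v))"
  proof
    fix C U assume sub: "B.subrep C U" and ne: "C \<noteq> {0} \<or> U \<noteq> {0}" "U \<noteq> coord_space m"
    then have C: "fs.subspace C" "C \<subseteq> coord_space n" and U: "fs.subspace U"
      by (auto simp: B.subrep_def)
    have bound: "N * fs.dim C \<le> fs.dim U + fs.dim (preimage C)"
      using sub B.fin_dim_subrep[OF sub]
      by (intro dim_reflected_subrep[OF Q(1,3) C U]) (auto simp: B.subrep_def)
    have "C \<noteq> coord_space n"
    proof
      assume "C = coord_space n"
      then have "preimage C = coord_space k" using maps_to by (auto simp: preimage_def)
      then have "m \<le> fs.dim U" using bound m \<open>C = coord_space n\<close> by (simp add: dim_supported)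
      then show False using B.subrep_eq_coord_space[OF sub] ne(2) by blast
    qed
    show "m * fs.dim C < n * fs.dim U"
    proof (cases "C = {0}")
      case True
      then show ?thesis using ne(1) pos B.dim_subrep_eq_0_iff[OF sub] by auto
    next
      case False
      then have "n * fs.dim (preimage C) < k * fs.dim C"
        using stable[OF subrep_preimage[OF C]] \<open>C \<noteq> coord_space n\<close> by blast
      moreover have "n * (N * fs.dim C) \<le> n * fs.dim U + n * fs.dim (preimage C)"
        using mult_le_mono2[OF bound, of n] by (simp add: distrib_left)
      moreover have "n * (N * fs.dim C) = k * fs.dim C + m * fs.dim C"
        using m by (metis distrib_right mult.assoc mult.commute)
      ultimately show ?thesis by linarith
    qed
  qed
  then show thesis by (rule that)
qed

end

subsection \<open>Existence\<close>

lemma stable_kronecker_module_0_1: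
  "stable_kronecker_module N 0 1 (\<lambda>s. 0 :: (nat \<Rightarrow> 'k::field) \<Rightarrow> nat \<Rightarrow> 'k)"
proof -
  interpret kronecker_module N 0 1 "\<lambda>s. 0 :: (nat \<Rightarrow> 'k) \<Rightarrow> nat \<Rightarrow> 'k"
    by (rule kronecker_module.intro)
      (auto simp: zero_fun_apply supported_def intro!: ff.linearI)
  show ?thesis
  proof
    fix C U :: "(nat \<Rightarrow> 'k) set"
    assume sub: "subrep C U" and ne: "C \<noteq> {0} \<or> U \<noteq> {0}" "U \<noteq> coord_space 1"
    then have C: "fs.subspace C" "C \<subseteq> coord_space 0"
      unfolding subrep_def by blast+
    have "C = {0}"
      using C(2) fs.subspace_0[OF C(1)] by (auto simp: supported_def fun_eq_iff vec_apply)
    then have "1 \<le> fs.dim U" using ne(1) dim_subrep_eq_0_iff(2)[OF sub] by linarith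
    then have "U = coord_space 1" by (rule subrep_eq_coord_space[OF sub])
    then show "1 * fs.dim C < 0 * fs.dim U" using ne(2) by blast
  qed
qed

lemma tits_form_reflection:
  fixes k m n N :: nat
  assumes "m + n = N * k" "k\<^sup>2 + n\<^sup>2 \<le> N * k * n + 1"
  shows "m\<^sup>2 + k\<^sup>2 \<le> N * m * k + 1"
proof -
  have n: "int n = int N * int k - int m"
    using assms(1) by (metis add_diff_cancel_left' of_nat_add of_nat_mult)
  have "(int k)\<^sup>2 + (int n)\<^sup>2 \<le> int N * int k * int n + 1"
    using assms(2) by (simp flip: of_nat_mult of_nat_add of_nat_power of_nat_Suc)
  then have "(int m)\<^sup>2 + (int k)\<^sup>2 \<le> int N * int m * int k + 1"
    unfolding n by (simp add: power2_eq_square algebra_simps)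
  then show ?thesis by (simp flip: of_nat_mult of_nat_add of_nat_power of_nat_Suc)
qed

lemma reflected_dimension:
  fixes k n N :: nat
  assumes k: "0 < k" "k \<le> n" "N * k \<le> n + k" and N: "2 \<le> N" "k < n \<or> 3 \<le> N"
    and tits: "k\<^sup>2 + n\<^sup>2 \<le> N * k * n + 1"
  obtains m where "m + n = N * k" "m \<le> k" "k < n" "m < k \<or> 3 \<le> N" "m\<^sup>2 + k\<^sup>2 \<le> N * m * k + 1"
proof -
  have "k < n"
  proof (rule ccontr)
    assume "\<not> k < n"
    then have "k = n" "3 * k \<le> N * k" using k(2) N(2) by auto
    then show False using k by simp
  qed
  have "n \<le> N * k"
  proof (rule ccontr)
    assume "\<not> n \<le> N * k"
    then have "(N * k + 1) * n \<le> n * n" by (intro mult_le_mono1) simp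
    then have "k\<^sup>2 + n \<le> 1" using tits by (simp add: power2_eq_square)
    then show False using k(1) \<open>k < n\<close> by simp
  qed
  define m where "m = N * k - n"
  have m: "m + n = N * k" "m \<le> k" using \<open>n \<le> N * k\<close> k(3) by (auto simp: m_def)
  have "m < k \<or> 3 \<le> N"
  proof (rule ccontr)
    assume "\<not> (m < k \<or> 3 \<le> N)"
    then have "m = k" "N = 2" using m(2) N(1) by auto
    then show False using m(1) \<open>k < n\<close> by simp
  qed
  then show thesis using that m \<open>k < n\<close> tits_form_reflection[OF m(1) tits] by blast
qed

lemma exists_stable_kronecker_module:
  assumes "2 \<le> N" "k \<le> n" "0 < n" "k\<^sup>2 + n\<^sup>2 \<le> N * k * n + 1" "k < n \<or> 3 \<le> N"
  shows "\<exists>A :: nat \<Rightarrow> (nat \<Rightarrow> 'k::field) \<Rightarrow> nat \<Rightarrow> 'k. stable_kronecker_module N k n A"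
  using assms(2-5)
proof (induction n arbitrary: k rule: less_induct)
  case (less n)
  consider (zero) "k = 0" | (interval) "0 < k" "n + k < N * k" | (reflect) "0 < k" "N * k \<le> n + k"
    by linarith
  then show ?case
  proof cases
    case zero
    then have "n\<^sup>2 \<le> 1\<^sup>2" using less.prems(3) by simp
    then have "n = 1" using less.prems(2) power2_le_imp_le[of n 1] by simp
    then show ?thesis using stable_kronecker_module_0_1 zero by blast
  next
    case interval
    then show ?thesis using stable_interval_module[OF interval(1) less.prems(1)] by blast
  next
    case reflect
    then obtain m where m: "m + n = N * k" "m \<le> k" "k < n" "m < k \<or> 3 \<le> N" "m\<^sup>2 + k\<^sup>2 \<le> N * m * k + 1"
      using reflected_dimension[OF _ less.prems(1) _ assms(1) less.prems(4,3)] by metis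
    then obtain A :: "nat \<Rightarrow> (nat \<Rightarrow> 'k) \<Rightarrow> nat \<Rightarrow> 'k" where "stable_kronecker_module N m k A"
      using less.IH[OF m(3,2) reflect(1) m(5,4)] by blast
    then show ?thesis
      using stable_kronecker_module.exists_stable_reflection[OF _ reflect(1) m(1)] by blast
  qed
qed

subsection \<open>Endomorphisms\<close>

context kronecker_module
begin

definition endomorphism :: "((nat \<Rightarrow> 'k) \<Rightarrow> nat \<Rightarrow> 'k) \<Rightarrow> ((nat \<Rightarrow> 'k) \<Rightarrow> nat \<Rightarrow> 'k) \<Rightarrow> bool" where
  "endomorphism X Y \<longleftrightarrow>
     Vector_Spaces.linear fscale fscale X \<and> X ` coord_space k \<subseteq> coord_space k \<and>
     Vector_Spaces.linear fscale fscale Y \<and> Y ` coord_space n \<subseteq> coord_space n \<and>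
     (\<forall>s<N. \<forall>c\<in>coord_space k. Y (A s c) = A s (X c))"

lemma subrep_kernel:
  assumes "endomorphism X Y"
  shows "subrep {c \<in> coord_space k. X c = 0} {u \<in> coord_space n. Y u = 0}"
  using assms ff.subspace_kernel_on[OF _ subspace_supported, of X "{..<k}"]
    ff.subspace_kernel_on[OF _ subspace_supported, of Y "{..<n}"]
  by (auto simp: endomorphism_def subrep_def maps_to ff.linear_0[OF linear])

lemma subrep_image:
  assumes "endomorphism X Y"
  shows "subrep (X ` coord_space k) (Y ` coord_space n)"
  unfolding subrep_def
proof (intro conjI allI impI ballI)
  fix s c assume s: "s < N" and "c \<in> X ` coord_space k"
  then obtain c' where c': "c' \<in> coord_space k" "c = X c'" by blast
  then have "A s c = Y (A s c')" using assms s by (simp add: endomorphism_def)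
  then show "A s c \<in> Y ` coord_space n" using maps_to[OF s c'(1)] by blast
qed (use assms in \<open>auto simp: endomorphism_def ff.linear_subspace_image[OF _ subspace_supported]\<close>)

lemma endomorphism_diff_scalar:
  assumes "endomorphism X Y"
  shows "endomorphism (\<lambda>c. X c - fscale l c) (\<lambda>u. Y u - fscale l u)"
proof -
  have lin: "Vector_Spaces.linear fscale fscale (\<lambda>c. Z c - fscale l c)"
    if "Vector_Spaces.linear fscale fscale Z" for Z :: "(nat \<Rightarrow> 'k) \<Rightarrow> nat \<Rightarrow> 'k"
    by (rule ff.linearI) (simp_all add: ff.linear_add[OF that] ff.linear_scale[OF that]
        fs.scale_right_distrib fs.scale_right_diff_distrib mult.commute)
  have maps: "Z c - fscale l c \<in> coord_space m"
    if "Z ` coord_space m \<subseteq> coord_space m" "c \<in> coord_space m" for Z :: "(nat \<Rightarrow> 'k) \<Rightarrow> nat \<Rightarrow> 'k" and c m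
  proof (rule fs.subspace_diff[OF subspace_supported])
    show "Z c \<in> coord_space m" using that by blast
    show "fscale l c \<in> coord_space m" by (rule fs.subspace_scale[OF subspace_supported that(2)])
  qed
  show ?thesis
    using assms unfolding endomorphism_def
    by (simp add: lin maps image_subset_iff ff.linear_diff[OF linear] ff.linear_scale[OF linear])
qed

end

context stable_kronecker_module
begin

lemma endomorphism_eq_0:
  assumes n: "0 < n" and XY: "endomorphism X Y" and c0: "c0 \<in> coord_space k" "c0 \<noteq> 0" "X c0 = 0"
  shows "c \<in> coord_space k \<Longrightarrow> X c = 0" and "u \<in> coord_space n \<Longrightarrow> Y u = 0"
proof -
  let ?kerX = "{c \<in> coord_space k. X c = 0}" and ?kerY = "{u \<in> coord_space n. Y u = 0}"
  let ?imX = "X ` coord_space k" and ?imY = "Y ` coord_space n"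
  have lin: "Vector_Spaces.linear fscale fscale X" "Vector_Spaces.linear fscale fscale Y"
    using XY by (simp_all add: endomorphism_def)
  have dim: "k = fs.dim ?kerX + fs.dim ?imX" "n = fs.dim ?kerY + fs.dim ?imY"
    using ff.rank_nullity[OF lin(1) subspace_supported fin_dim_supported[of "{..<k}"]]
      ff.rank_nullity[OF lin(2) subspace_supported fin_dim_supported[of "{..<n}"]]
    by (simp_all add: dim_supported)
  have "?kerX \<noteq> {0}" using c0 by blast
  have kerY: "?kerY = coord_space n"
  proof (rule ccontr)
    assume neq: "?kerY \<noteq> coord_space n"
    have ker_less: "n * fs.dim ?kerX < k * fs.dim ?kerY"
      by (rule stable[OF subrep_kernel[OF XY] disjI1[OF \<open>?kerX \<noteq> {0}\<close>] neq])
    have "?imY \<noteq> {0}" using neq by auto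
    moreover have "?imY \<noteq> coord_space n"
    proof
      assume "?imY = coord_space n"
      then show False using dim(2) ker_less by (simp add: dim_supported)
    qed
    ultimately have "n * fs.dim ?imX < k * fs.dim ?imY" using stable[OF subrep_image[OF XY]] by blast
    then have "n * (fs.dim ?kerX + fs.dim ?imX) < k * (fs.dim ?kerY + fs.dim ?imY)"
      using ker_less by (simp add: distrib_left)
    then show False unfolding dim[symmetric] by simp
  qed
  show Y_eq: "Y u = 0" if "u \<in> coord_space n" for u using that kerY by blast
  show "X c = 0" if c: "c \<in> coord_space k" for c
  proof (rule injective[OF n])
    show "X c \<in> coord_space k" using XY c by (auto simp: endomorphism_def)
    show "A s (X c) = 0" if "s < N" for s
      using Y_eq[OF maps_to[OF that c]] XY that c by (simp add: endomorphism_def)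
  qed
qed

lemma endomorphism_scalar:
  assumes closed: "alg_closed TYPE('k)" and pos: "0 < k" "0 < n" and XY: "endomorphism X Y"
  obtains l where "\<And>c. c \<in> coord_space k \<Longrightarrow> X c = fscale l c"
    "\<And>u. u \<in> coord_space n \<Longrightarrow> Y u = fscale l u"
proof -
  obtain l c0 where c0: "c0 \<in> coord_space k" "c0 \<noteq> 0" "X c0 = fscale l c0"
    by (rule exists_eigenvector[OF closed _ _ pos(1), of X]) (use XY in \<open>auto simp: endomorphism_def\<close>)
  note zero = endomorphism_eq_0[OF pos(2) endomorphism_diff_scalar[OF XY] c0(1,2), of l]
  have "X c = fscale l c" if "c \<in> coord_space k" for c using zero(1)[OF _ that] c0(3) by simp
  moreover have "Y u = fscale l u" if "u \<in> coord_space n" for u using zero(2)[OF _ that] c0(3) by simp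
  ultimately show thesis by (rule that)
qed

end

definition matrix_map :: "nat \<Rightarrow> (nat \<times> nat \<Rightarrow> 'k::field) \<Rightarrow> (nat \<Rightarrow> 'k) \<Rightarrow> nat \<Rightarrow> 'k" where
  "matrix_map k z c = (\<lambda>i. \<Sum>j<k. c j * z (j, i))"

lemma linear_matrix_map: "Vector_Spaces.linear fscale fscale (matrix_map k z)"
  by (rule ff.linearI)
    (auto simp: matrix_map_def fun_eq_iff vec_apply algebra_simps sum.distrib sum_distrib_left)

lemma matrix_map_add: "matrix_map k (\<lambda>p. z p + z' p) c = matrix_map k z c + matrix_map k z' c"
  and matrix_map_scale: "matrix_map k (\<lambda>p. a * z p) c = fscale a (matrix_map k z c)"
  by (auto simp: matrix_map_def fun_eq_iff vec_apply algebra_simps sum.distrib sum_distrib_left)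

lemma matrix_map_maps_to: "z \<in> supported ({..<k} \<times> {..<n}) \<Longrightarrow> matrix_map k z c \<in> coord_space n"
  by (auto simp: matrix_map_def supported_def)

lemma matrix_map_unitv: "j < k \<Longrightarrow> matrix_map k z (unitv j) i = z (j, i)"
proof -
  assume "j < k"
  have "matrix_map k z (unitv j) i = (\<Sum>j'<k. if j' = j then z (j', i) else 0)"
    unfolding matrix_map_def unitv_def by (rule sum.cong) auto
  then show ?thesis using \<open>j < k\<close> by simp
qed

context kronecker_module
begin

lemma intertwines_if_on_unitv:
  assumes X: "Vector_Spaces.linear fscale fscale X" and Y: "Vector_Spaces.linear fscale fscale Y"
    and unit: "\<And>j. j < k \<Longrightarrow> Y (A s (unitv j)) = A s (X (unitv j))" and c: "c \<in> coord_space k"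
  shows "Y (A s c) = A s (X c)"
  by (subst (1 2) supported_expand[OF finite_lessThan c])
    (simp add: ff.linear_sum[OF linear] ff.linear_scale[OF linear] ff.linear_sum[OF X]
      ff.linear_scale[OF X] ff.linear_sum[OF Y] ff.linear_scale[OF Y] unit)

lemma endomorphism_matrix_map:
  assumes x: "x \<in> supported ({..<k} \<times> {..<k})" and y: "y \<in> supported ({..<n} \<times> {..<n})"
    and entries: "\<And>s j i. s < N \<Longrightarrow> j < k \<Longrightarrow> i < n \<Longrightarrow>
      matrix_map n y (A s (unitv j)) i = A s (matrix_map k x (unitv j)) i"
  shows "endomorphism (matrix_map k x) (matrix_map n y)"
proof -
  have "matrix_map n y (A s (unitv j)) = A s (matrix_map k x (unitv j))" if "s < N" "j < k" for s j
  proof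
    fix i
    have "A s (matrix_map k x (unitv j)) \<in> coord_space n"
      by (rule maps_to[OF that(1) matrix_map_maps_to[OF x]])
    moreover have "matrix_map n y (A s (unitv j)) \<in> coord_space n" by (rule matrix_map_maps_to[OF y])
    ultimately show "matrix_map n y (A s (unitv j)) i = A s (matrix_map k x (unitv j)) i"
      using entries[OF that] by (cases "i < n") (simp_all add: supported_def)
  qed
  then have "matrix_map n y (A s c) = A s (matrix_map k x c)" if "s < N" "c \<in> coord_space k" for s c
    using that by (blast intro: intertwines_if_on_unitv[OF linear_matrix_map linear_matrix_map])
  then show ?thesis
    using matrix_map_maps_to[OF x] matrix_map_maps_to[OF y] linear_matrix_map
    unfolding endomorphism_def by blast
qed

text \<open>The pairs of matrices \<open>(z \<circ> Inl, z \<circ> Inr)\<close> form a space of dimension \<open>k\<^sup>2 + n\<^sup>2\<close>; the entry at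
  \<open>(0, 0)\<close> is added to the conditions of an endomorphism to exclude the nonzero scalars.\<close>

definition endomorphism_equations ::
  "(nat \<times> nat + nat \<times> nat \<Rightarrow> 'k) \<Rightarrow> (nat \<times> nat \<times> nat) option \<Rightarrow> 'k" where
  "endomorphism_equations z = (\<lambda>t. case t of
     None \<Rightarrow> z (Inl (0, 0))
   | Some (s, j, i) \<Rightarrow> if s < N \<and> j < k \<and> i < n
       then matrix_map n (\<lambda>p. z (Inr p)) (A s (unitv j)) i - A s (matrix_map k (\<lambda>p. z (Inl p)) (unitv j)) i
       else 0)"

lemma linear_endomorphism_equations: "Vector_Spaces.linear fscale fscale endomorphism_equations"
  by (rule ff.linearI) (auto simp: endomorphism_equations_def fun_eq_iff vec_apply matrix_map_add
      matrix_map_scale ff.linear_add[OF linear] ff.linear_scale[OF linear] algebra_simps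
      split: option.splits)

lemma exists_endomorphism:
  assumes "N * k * n + 1 < k\<^sup>2 + n\<^sup>2"
  obtains x y where "x \<in> supported ({..<k} \<times> {..<k})" "y \<in> supported ({..<n} \<times> {..<n})"
    "x \<noteq> 0 \<or> y \<noteq> 0" "x (0, 0) = 0" "endomorphism (matrix_map k x) (matrix_map n y)"
proof -
  let ?L = endomorphism_equations
  define T :: "(nat \<times> nat + nat \<times> nat) set"
    where "T = ({..<k} \<times> {..<k}) <+> ({..<n} \<times> {..<n})"
  define T' :: "(nat \<times> nat \<times> nat) option set"
    where "T' = insert None (Some ` ({..<N} \<times> {..<k} \<times> {..<n}))"
  have "?L ` supported T \<subseteq> supported T'"
    by (auto simp: endomorphism_equations_def supported_def T'_def split: option.splits)
  moreover have "card T' < card T"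
    using assms by (simp add: T_def T'_def card_Plus card_image card_cartesian_product power2_eq_square)
  ultimately obtain z where z: "z \<in> supported T" "z \<noteq> 0" "?L z = 0"
    using exists_kernel_vector[OF linear_endomorphism_equations, of T T'] by (auto simp: T_def T'_def)
  define x where "x = (\<lambda>p. z (Inl p))"
  define y where "y = (\<lambda>p. z (Inr p))"
  have "Inl p \<in> T \<longleftrightarrow> p \<in> {..<k} \<times> {..<k}" "Inr p \<in> T \<longleftrightarrow> p \<in> {..<n} \<times> {..<n}" for p
    by (auto simp: T_def)
  then have x: "x \<in> supported ({..<k} \<times> {..<k})" and y: "y \<in> supported ({..<n} \<times> {..<n})"
    using z(1) unfolding x_def y_def supported_def by blast+
  have "x \<noteq> 0 \<or> y \<noteq> 0"
  proof (rule ccontr)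
    assume "\<not> (x \<noteq> 0 \<or> y \<noteq> 0)"
    then have "z t = 0" for t by (cases t) (auto simp: x_def y_def fun_eq_iff vec_apply)
    then show False using z(2) by (auto simp: fun_eq_iff vec_apply)
  qed
  moreover have "x (0, 0) = 0"
    using fun_cong[OF z(3), of None] by (simp add: endomorphism_equations_def x_def zero_fun_apply)
  moreover have "matrix_map n y (A s (unitv j)) i = A s (matrix_map k x (unitv j)) i"
    if "s < N" "j < k" "i < n" for s j i
    using fun_cong[OF z(3), of "Some (s, j, i)"] that
    by (simp add: endomorphism_equations_def x_def y_def zero_fun_apply)
  ultimately show thesis using that x y endomorphism_matrix_map by blast
qed

end

theorem (in stable_kronecker_module) tits_form_le_1:
  assumes closed: "alg_closed TYPE('k)" and pos: "0 < k" "0 < n"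
  shows "k\<^sup>2 + n\<^sup>2 \<le> N * k * n + 1"
proof (rule ccontr)
  assume "\<not> ?thesis"
  then have "N * k * n + 1 < k\<^sup>2 + n\<^sup>2" by simp
  then obtain x y where x: "x \<in> supported ({..<k} \<times> {..<k})" and y: "y \<in> supported ({..<n} \<times> {..<n})"
    and xy: "x \<noteq> 0 \<or> y \<noteq> 0" "x (0, 0) = 0" "endomorphism (matrix_map k x) (matrix_map n y)"
    by (rule exists_endomorphism)
  obtain l where l: "\<And>c. c \<in> coord_space k \<Longrightarrow> matrix_map k x c = fscale l c"
    "\<And>u. u \<in> coord_space n \<Longrightarrow> matrix_map n y u = fscale l u"
    by (rule endomorphism_scalar[OF closed pos xy(3)]) (rule that)
  have x_eq: "x (j, i) = l * unitv j i" if "j < k" for j i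
    using l(1)[OF unitv_in_supported[of j]] matrix_map_unitv[OF that, of x i] that
    by (simp add: fscale_apply)
  have y_eq: "y (j, i) = l * unitv j i" if "j < n" for j i
    using l(2)[OF unitv_in_supported[of j]] matrix_map_unitv[OF that, of y i] that
    by (simp add: fscale_apply)
  have "l = 0" using x_eq[OF pos(1), of 0] xy(2) by (simp add: unitv_def)
  have "x (j, i) = 0" for j i
    using x_eq[of j i] x \<open>l = 0\<close> by (cases "j < k") (auto simp: supported_def)
  moreover have "y (j, i) = 0" for j i
    using y_eq[of j i] y \<open>l = 0\<close> by (cases "j < n") (auto simp: supported_def)
  ultimately show False using xy(1) by (auto simp: fun_eq_iff vec_apply)
qed

section \<open>Polynomial vectors\<close>

definition coeff_vec :: "nat \<Rightarrow> (nat \<Rightarrow> 'k::field poly) \<Rightarrow> nat \<Rightarrow> 'k" where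
  "coeff_vec s p = (\<lambda>i. coeff (p i) s)"

definition poly_vecs :: "nat \<Rightarrow> nat \<Rightarrow> (nat \<Rightarrow> 'k::field poly) set" where
  "poly_vecs n N = {p. (\<forall>i\<ge>n. p i = 0) \<and> (\<forall>s\<ge>N. coeff_vec s p = 0)}"

definition poly_of_slices :: "nat \<Rightarrow> (nat \<times> nat \<Rightarrow> 'k::field) \<Rightarrow> nat \<Rightarrow> 'k poly" where
  "poly_of_slices N w = (\<lambda>i. \<Sum>s<N. monom (slice s w i) s)"

definition poly_comb :: "nat \<Rightarrow> (nat \<Rightarrow> 'k::field poly) \<Rightarrow> (nat \<Rightarrow> nat \<Rightarrow> 'k poly) \<Rightarrow> nat \<Rightarrow> 'k poly" where
  "poly_comb r g q = (\<lambda>i. \<Sum>j<r. g j * q j i)"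

lemma linear_coeff_vec: "Vector_Spaces.linear pscale fscale (coeff_vec s)"
  by (rule pf.linearI) (auto simp: coeff_vec_def fun_eq_iff vec_apply)

lemma poly_vec_eqI: "(\<And>s. coeff_vec s p = coeff_vec s q) \<Longrightarrow> p = q"
  by (auto simp: coeff_vec_def fun_eq_iff poly_eq_iff)

lemma coeff_vec_in_coord_space: "(\<And>i. i \<ge> n \<Longrightarrow> p i = 0) \<Longrightarrow> coeff_vec s p \<in> coord_space n"
  by (auto simp: coeff_vec_def supported_def)

lemma poly_vecs_iff_coeff_vec:
  "p \<in> poly_vecs n N \<longleftrightarrow> (\<forall>s. coeff_vec s p \<in> coord_space n) \<and> (\<forall>s\<ge>N. coeff_vec s p = 0)"
  by (auto simp: poly_vecs_def coeff_vec_def supported_def poly_eq_iff)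

lemma coeff_vec_poly_of_slices: "coeff_vec s (poly_of_slices N w) = (if s < N then slice s w else 0)"
proof
  fix i
  have "coeff_vec s (poly_of_slices N w) i = (\<Sum>s'<N. if s = s' then slice s' w i else 0)"
    unfolding coeff_vec_def poly_of_slices_def coeff_sum by (rule sum.cong) auto
  then show "coeff_vec s (poly_of_slices N w) i = (if s < N then slice s w else 0) i"
    by (simp add: zero_fun_apply)
qed

lemma linear_poly_of_slices: "Vector_Spaces.linear fscale pscale (poly_of_slices N)"
  by (rule fp.linearI; rule poly_vec_eqI)
    (simp_all add: coeff_vec_poly_of_slices pf.linear_add[OF linear_coeff_vec]
      ff.linear_add[OF linear_slice]
      pf.linear_scale[OF linear_coeff_vec] ff.linear_scale[OF linear_slice])

lemma poly_of_slices_in_poly_vecs: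
  "w \<in> copies N (coord_space n) \<Longrightarrow> poly_of_slices N w \<in> poly_vecs n N"
  using fs.subspace_0[OF subspace_supported]
  by (auto simp: poly_vecs_iff_coeff_vec coeff_vec_poly_of_slices copies_def)

lemma poly_of_slices_eq_0D: "poly_of_slices N w = 0 \<Longrightarrow> s < N \<Longrightarrow> slice s w = 0"
  using coeff_vec_poly_of_slices[of s N w] by (simp add: pf.linear_0[OF linear_coeff_vec])

lemma poly_of_slices_image: "poly_of_slices N ` copies N (coord_space n) = poly_vecs n N"
proof (intro equalityI subsetI)
  fix p :: "nat \<Rightarrow> 'a poly" assume p: "p \<in> poly_vecs n N"
  define w where "w = (\<lambda>(s, i). if s < N then coeff (p i) s else 0)"
  have slice_w: "slice s w = (if s < N then coeff_vec s p else 0)" for s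
    by (auto simp: slice_def w_def coeff_vec_def fun_eq_iff vec_apply)
  then have "p = poly_of_slices N w"
    using p by (intro poly_vec_eqI) (simp add: coeff_vec_poly_of_slices poly_vecs_def not_less)
  moreover have "w \<in> copies N (coord_space n)"
    using p by (simp add: copies_def slice_w poly_vecs_iff_coeff_vec)
  ultimately show "p \<in> poly_of_slices N ` copies N (coord_space n)" by blast
qed (auto intro: poly_of_slices_in_poly_vecs)

lemma subspace_poly_vecs: "ps.subspace (poly_vecs n N)"
  unfolding poly_of_slices_image[symmetric] copies_coord_space
  by (rule fp.linear_subspace_image[OF linear_poly_of_slices subspace_supported])

lemma fin_dim_poly_vecs: "ps.fin_dim (poly_vecs n N)"
  unfolding poly_of_slices_image[symmetric] copies_coord_space
  by (rule fp.fin_dim_image[OF linear_poly_of_slices fin_dim_supported]) simp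

lemma dim_poly_vecs: "ps.dim (poly_vecs n N :: (nat \<Rightarrow> 'k::field poly) set) = n * N"
proof -
  have "w = 0" if "w \<in> copies N (coord_space n)" "poly_of_slices N w = 0" for w :: "nat \<times> nat \<Rightarrow> 'k"
  proof (rule slice_eqI)
    fix s show "slice s w = slice s 0"
      using that poly_of_slices_eq_0D[of N w s]
      by (cases "s < N") (auto simp: copies_def ff.linear_0[OF linear_slice])
  qed
  then show ?thesis
    using fp.dim_image_inj[OF linear_poly_of_slices[of N], of "copies N (coord_space n) :: (nat \<times> nat \<Rightarrow> 'k) set"]
    unfolding poly_of_slices_image
    by (simp add: copies_coord_space subspace_supported fin_dim_supported dim_supported
        card_cartesian_product mult.commute)
qed

lemma linear_poly_comb: "Vector_Spaces.linear pscale pscale (\<lambda>g. poly_comb r g q)"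
proof (rule pp.linearI)
  show "poly_comb r (g + h) q = poly_comb r g q + poly_comb r h q" for g h
    by (simp add: poly_comb_def fun_eq_iff vec_apply distrib_right sum.distrib)
  have smult_sum: "smult c (\<Sum>j\<in>A. f j) = (\<Sum>j\<in>A. smult c (f j))" for c and f :: "nat \<Rightarrow> 'a poly" and A
    by (induction A rule: infinite_finite_induct) (auto simp: smult_add_right)
  show "poly_comb r (pscale c g) q = pscale c (poly_comb r g q)" for c g
    by (simp add: poly_comb_def fun_eq_iff vec_apply smult_sum)
qed

lemma poly_comb_const: "poly_comb r (\<lambda>j. [:c j:]) q = (\<Sum>j<r. pscale (c j) (q j))"
  by (auto simp: poly_comb_def fun_eq_iff sum_fun_apply vec_apply)

lemma poly_comb_shift: "(\<lambda>i. monom 1 1 * poly_comb r g q i) = poly_comb r (\<lambda>j. pCons 0 (g j)) q"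
proof
  fix i
  have "pCons 0 (g j) = monom 1 1 * g j" for j
    by (rule poly_eqI) (auto simp: coeff_pCons coeff_monom_mult split: nat.splits)
  then show "monom 1 1 * poly_comb r g q i = poly_comb r (\<lambda>j. pCons 0 (g j)) q i"
    by (simp only: poly_comb_def sum_distrib_left mult.assoc)
qed

lemma poly_comb_in_poly_vecs: "\<exists>h. h \<in> poly_vecs r l \<and> poly_comb r h q = poly_comb r g q"
  if "\<And>j s. l \<le> s \<Longrightarrow> coeff (g j) s = 0"
  using that by (intro exI[of _ "\<lambda>j. if j < r then g j else 0"])
    (auto simp: poly_vecs_def coeff_vec_def poly_comb_def fun_eq_iff vec_apply)

text \<open>In the lowest degree where some coefficient does not vanish yet, only the constant terms of the
  vectors contribute to the relation.\<close>

lemma poly_relation_trivial: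
  assumes ind: "fs.indep_fam r (\<lambda>j. coeff_vec 0 (p j))" and rel: "poly_comb r g p = 0" and j: "j < r"
  shows "g j = 0"
proof -
  have "\<forall>j<r. coeff (g j) s = 0" for s
  proof (induction s rule: less_induct)
    case (less s)
    have "(\<Sum>j<r. fscale (coeff (g j) s) (coeff_vec 0 (p j))) = 0"
    proof
      fix i
      have "(\<Sum>j<r. coeff (g j) s * coeff (p j i) 0) = (\<Sum>j<r. coeff (g j * p j i) s)"
      proof (rule sum.cong)
        fix j assume "j \<in> {..<r}"
        then have "(\<Sum>t\<le>s. coeff (g j) t * coeff (p j i) (s - t)) =
          (\<Sum>t\<in>{s}. coeff (g j) t * coeff (p j i) (s - t))"
          using less by (intro sum.mono_neutral_right) auto
        then show "coeff (g j) s * coeff (p j i) 0 = coeff (g j * p j i) s" by (simp add: coeff_mult)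
      qed simp
      also have "\<dots> = coeff (poly_comb r g p i) s" by (simp add: poly_comb_def coeff_sum)
      finally show "(\<Sum>j<r. fscale (coeff (g j) s) (coeff_vec 0 (p j))) i = 0 i"
        by (simp add: rel sum_fun_apply vec_apply coeff_vec_def)
    qed
    then show ?case using fs.indep_famD[OF ind, of "\<lambda>j. coeff (g j) s"] by simp
  qed
  then show ?thesis using j by (intro poly_eqI) simp
qed

section \<open>The two lattices of a bundle\<close>

lemma tpow_eq_to_fract: "tpow m = to_fract (monom 1 m)"
  by (simp add: tpow_def to_fract_def)

lemma tpow_neq_0 [simp]: "tpow m \<noteq> 0"
  by (simp add: tpow_eq_to_fract monom_eq_0_iff)

lemma tpow_add: "tpow (l + m) = tpow l * tpow m"
  by (simp add: tpow_eq_to_fract mult_monom flip: to_fract_mult)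

lemma in_kt_iff: "in_kt x \<longleftrightarrow> (\<exists>p. x = to_fract p)"
  by (simp add: in_kt_def to_fract_def)

definition deg_le :: "'k::field poly \<Rightarrow> int \<Rightarrow> bool" where
  "deg_le p d \<longleftrightarrow> (\<forall>s. d < int s \<longrightarrow> coeff p s = 0)"

lemma deg_le_0: "deg_le 0 d"
  and deg_le_mono: "deg_le p d \<Longrightarrow> d \<le> d' \<Longrightarrow> deg_le p d'"
  and deg_le_add: "deg_le p d \<Longrightarrow> deg_le q d \<Longrightarrow> deg_le (p + q) d"
  and deg_le_monom: "deg_le (monom c m) (int m)"
  by (auto simp: deg_le_def)

lemma deg_le_iff_degree: "deg_le p (int m) \<longleftrightarrow> degree p \<le> m"
  by (auto simp: deg_le_def coeff_eq_0 intro: degree_le)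

lemma deg_le_degree: "deg_le p (int (degree p))"
  by (simp add: deg_le_iff_degree)

lemma poly_vecs_deg_le: "p \<in> poly_vecs n (Suc l) \<Longrightarrow> deg_le (p i) (int l)"
  by (auto simp: deg_le_def poly_vecs_def coeff_vec_def fun_eq_iff zero_fun_apply)

lemma deg_le_mult:
  assumes "deg_le p d" "deg_le q d'"
  shows "deg_le (p * q) (d + d')"
  unfolding deg_le_def coeff_mult
proof (intro allI impI sum.neutral ballI)
  fix s t assume "d + d' < int s" "t \<in> {..s}"
  then have "d < int t \<or> d' < int (s - t)" by auto
  then show "coeff p t * coeff q (s - t) = 0" using assms by (auto simp: deg_le_def)
qed

lemma deg_le_multD:
  assumes "deg_le (q * p) d" "q \<noteq> 0"
  shows "deg_le p d"
proof (cases "p = 0")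
  case False
  then have "coeff (q * p) (degree q + degree p) \<noteq> 0" using assms(2)
    by (simp add: coeff_mult_degree_sum)
  then have "int (degree q + degree p) \<le> d" using assms(1) by (force simp: deg_le_def)
  then show ?thesis by (intro deg_le_mono[OF deg_le_degree]) simp
qed (simp add: deg_le_0)

definition in_tpow_kinvt :: "int \<Rightarrow> 'k::field rf \<Rightarrow> bool" where
  "in_tpow_kinvt m x \<longleftrightarrow> (\<exists>p l. x * tpow l = to_fract p \<and> deg_le p (int l + m))"

lemma in_kinvt_iff: "in_kinvt x \<longleftrightarrow> in_tpow_kinvt 0 x"
proof -
  have "x = Fract p (monom 1 m) \<longleftrightarrow> x * tpow m = to_fract p" for p m
    by (simp add: Fract_conv_to_fract tpow_eq_to_fract eq_divide_eq monom_eq_0_iff)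
  then show ?thesis unfolding in_kinvt_def in_tpow_kinvt_def by (auto simp: deg_le_iff_degree)
qed

lemma in_tpow_kinvt_mono: "in_tpow_kinvt m x \<Longrightarrow> m \<le> m' \<Longrightarrow> in_tpow_kinvt m' x"
  unfolding in_tpow_kinvt_def using deg_le_mono by (meson add_left_mono)

lemma in_tpow_kinvt_add:
  assumes "in_tpow_kinvt m x" "in_tpow_kinvt m y"
  shows "in_tpow_kinvt m (x + y)"
proof -
  obtain p l where p: "x * tpow l = to_fract p" "deg_le p (int l + m)"
    using assms(1) by (auto simp: in_tpow_kinvt_def)
  obtain q l' where q: "y * tpow l' = to_fract q" "deg_le q (int l' + m)"
    using assms(2) by (auto simp: in_tpow_kinvt_def)
  have "(x + y) * tpow (l + l') = (x * tpow l) * tpow l' + (y * tpow l') * tpow l"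
    by (simp add: tpow_add algebra_simps)
  also have "\<dots> = to_fract (p * monom 1 l' + q * monom 1 l)"
    by (simp only: p q) (simp add: tpow_eq_to_fract)
  finally have "(x + y) * tpow (l + l') = to_fract (p * monom 1 l' + q * monom 1 l)" .
  moreover have "deg_le (p * monom 1 l' + q * monom 1 l) (int (l + l') + m)"
    using deg_le_mult[OF p(2) deg_le_monom[of 1 l']] deg_le_mult[OF q(2) deg_le_monom[of 1 l]]
    by (intro deg_le_add) (simp_all add: algebra_simps)
  ultimately show ?thesis unfolding in_tpow_kinvt_def by blast
qed

lemma in_tpow_kinvt_mult:
  assumes "in_tpow_kinvt m x" "in_tpow_kinvt m' y"
  shows "in_tpow_kinvt (m + m') (x * y)"
proof -
  obtain p l where p: "x * tpow l = to_fract p" "deg_le p (int l + m)"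
    using assms(1) by (auto simp: in_tpow_kinvt_def)
  obtain q l' where q: "y * tpow l' = to_fract q" "deg_le q (int l' + m')"
    using assms(2) by (auto simp: in_tpow_kinvt_def)
  have "(x * y) * tpow (l + l') = (x * tpow l) * (y * tpow l')"
    by (simp add: tpow_add algebra_simps)
  then have "(x * y) * tpow (l + l') = to_fract (p * q)" by (simp add: p q)
  moreover have "deg_le (p * q) (int (l + l') + (m + m'))"
    using deg_le_mult[OF p(2) q(2)] by (simp add: algebra_simps)
  ultimately show ?thesis unfolding in_tpow_kinvt_def by blast
qed

lemma in_tpow_kinvt_to_fract_iff: "in_tpow_kinvt m (to_fract p) \<longleftrightarrow> deg_le p m"
proof
  assume "in_tpow_kinvt m (to_fract p)"
  then obtain q l where "to_fract p * tpow l = to_fract q" "deg_le q (int l + m)"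
    by (auto simp: in_tpow_kinvt_def)
  then have "q = monom 1 l * p" "deg_le q (int l + m)"
    by (simp_all add: tpow_eq_to_fract mult.commute flip: to_fract_mult)
  then show "deg_le p m"
    unfolding deg_le_def by (auto simp: coeff_monom_mult dest: spec[where x = "l + s" for s])
next
  assume "deg_le p m"
  then show "in_tpow_kinvt m (to_fract p)"
    unfolding in_tpow_kinvt_def by (intro exI[of _ p] exI[of _ 0])
      (simp add: tpow_eq_to_fract monom_eq_1)
qed

lemma in_tpow_kinvt_0: "in_tpow_kinvt m 0"
  by (simp add: in_tpow_kinvt_to_fract_iff deg_le_0 flip: to_fract_0)

lemma in_tpow_kinvt_sum: "(\<And>j. j \<in> S \<Longrightarrow> in_tpow_kinvt m (f j)) \<Longrightarrow> in_tpow_kinvt m (\<Sum>j\<in>S. f j)"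
  by (induction S rule: infinite_finite_induct) (auto simp: in_tpow_kinvt_0 in_tpow_kinvt_add)

lemma in_tpow_kinvt_const_rf: "in_tpow_kinvt 0 (const_rf c)"
  by (simp add: const_rf_to_fract in_tpow_kinvt_to_fract_iff deg_le_def coeff_pCons split: nat.split)

lemma in_tpow_kinvt_tpow_mult_iff: "in_tpow_kinvt (m + int l) (tpow l * x) \<longleftrightarrow> in_tpow_kinvt m x"
proof
  assume "in_tpow_kinvt (m + int l) (tpow l * x)"
  then obtain p l' where "tpow l * x * tpow l' = to_fract p" "deg_le p (int l' + (m + int l))"
    by (auto simp: in_tpow_kinvt_def)
  then show "in_tpow_kinvt m x"
    unfolding in_tpow_kinvt_def by (intro exI[of _ p] exI[of _ "l + l'"])
      (simp add: tpow_add algebra_simps)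
next
  assume "in_tpow_kinvt m x"
  then show "in_tpow_kinvt (m + int l) (tpow l * x)"
    using in_tpow_kinvt_mult[of "int l" "tpow l" m x]
    by (simp add: tpow_eq_to_fract in_tpow_kinvt_to_fract_iff deg_le_monom add.commute)
qed

lemma common_denominator:
  fixes f :: "'a \<Rightarrow> 'k::field rf"
  assumes "finite S"
  obtains q g where "q \<noteq> 0" "\<And>j. j \<in> S \<Longrightarrow> f j * to_fract q = to_fract (g j)"
proof -
  have "\<exists>p q. q \<noteq> 0 \<and> f j = to_fract p / to_fract q" for j
    by (cases "f j") (auto simp: Fract_conv_to_fract)
  then obtain p q where f: "\<And>j. q j \<noteq> 0 \<and> f j = to_fract (p j) / to_fract (q j)" by metis
  show thesis
  proof
    show "(\<Prod>j\<in>S. q j) \<noteq> 0" using f assms by simp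
    show "f j * to_fract (\<Prod>j\<in>S. q j) = to_fract (p j * (\<Prod>j\<in>S - {j}. q j))" if "j \<in> S" for j
      using f[of j] that assms by (simp add: prod.remove[of S j])
  qed
qed

lemma Kcomb_eq: "Kcomb r c b = (\<Sum>j<r. fscale (c j) (b j))"
  by (simp add: Kcomb_def fun_eq_iff sum_fun_apply vec_apply)

lemma fullspace_eq: "fullspace n = coord_space n"
  by (auto simp: fullspace_def supp_lt_def supported_def)

lemma frame_iff: "frame n r b \<longleftrightarrow> (\<forall>j<r. b j \<in> coord_space n) \<and> fs.indep_fam r b"
  unfolding frame_def Klin_indep_def fs.indep_fam_def Kcomb_eq supp_lt_def supported_def
  by (auto simp: zero_fun_def)

lemma linear_Kcomb: "Vector_Spaces.linear fscale fscale (\<lambda>c. Kcomb r c b)"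
  by (rule ff.linearI)
    (simp_all add: Kcomb_eq vec_apply fs.scale_left_distrib sum.distrib fs.scale_sum_right)

lemma Kspan_eq_span: "Kspan r b = fs.span (b ` {..<r})"
proof
  show "Kspan r b \<subseteq> fs.span (b ` {..<r})"
    unfolding Kspan_def Kcomb_eq by (auto intro!: fs.span_sum intro: fs.span_scale fs.span_base)
  have "b j \<in> Kspan r b" if "j < r" for j
  proof -
    have "Kcomb r (unitv j) b = (\<Sum>i<r. if i = j then b i else 0)"
      unfolding Kcomb_eq by (rule sum.cong) (auto simp: unitv_def)
    then show ?thesis using that unfolding Kspan_def by (auto intro: exI[of _ "unitv j"])
  qed
  moreover have "Kspan r b = range (\<lambda>c. Kcomb r c b)" by (auto simp: Kspan_def)
  then have "fs.subspace (Kspan r b)"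
    using ff.linear_subspace_image[OF linear_Kcomb fs.subspace_UNIV] by metis
  ultimately show "fs.span (b ` {..<r}) \<subseteq> Kspan r b" by (intro fs.span_minimal) auto
qed

lemma frame_Kspan:
  assumes "frame n r b"
  shows "fs.subspace (Kspan r b)" "Kspan r b \<subseteq> coord_space n" "fs.dim (Kspan r b) = r"
proof -
  have b: "\<And>j. j < r \<Longrightarrow> b j \<in> coord_space n" "fs.indep_fam r b" using assms by (auto simp: frame_iff)
  show "fs.subspace (Kspan r b)" by (simp add: Kspan_eq_span)
  show "Kspan r b \<subseteq> coord_space n"
    unfolding Kspan_eq_span using b(1) by (intro fs.span_minimal subspace_supported) auto
  show "fs.dim (Kspan r b) = r"
    using b(2) unfolding Kspan_eq_span fs.dim_span
    by (simp add: fs.indep_fam_iff_independent fs.dim_eq_card_independent card_image)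
qed

lemma exists_frame:
  assumes "fs.subspace U" "U \<subseteq> coord_space n"
  obtains u where "frame n (fs.dim U) u" "Kspan (fs.dim U) u = U"
proof -
  have "fs.fin_dim U" by (rule fs.fin_dim_subset[OF fin_dim_supported assms(2)]) simp
  then obtain u where u: "fs.indep_fam (fs.dim U) u" "\<And>j. j < fs.dim U \<Longrightarrow> u j \<in> U"
    "\<And>v. v \<in> U \<Longrightarrow> \<exists>c. v = (\<Sum>j<fs.dim U. fscale (c j) (u j))"
    by (rule fs.basis_fam) (rule that)
  show thesis
  proof
    show "frame n (fs.dim U) u" using u assms(2) by (auto simp: frame_iff)
    have "Kspan (fs.dim U) u \<subseteq> U"
      unfolding Kspan_eq_span using u(2) by (intro fs.span_minimal[OF _ assms(1)]) auto
    then show "Kspan (fs.dim U) u = U" using u(3) by (auto simp: Kspan_def Kcomb_eq)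
  qed
qed

lemma frame_expand:
  assumes "frame n n b" "v \<in> coord_space n"
  obtains c where "v = (\<Sum>j<n. fscale (c j) (b j))"
proof -
  have "Kspan n b = coord_space n"
    using frame_Kspan[OF assms(1)]
    by (intro fs.subspace_eq_fin_dim[OF fin_dim_supported]) (simp_all add: dim_supported)
  then show thesis using assms(2) that by (auto simp: Kspan_def Kcomb_eq)
qed

section \<open>Degrees of subbundles\<close>

lemma antimono_int_eventually_const:
  fixes f :: "int \<Rightarrow> int"
  assumes step: "\<And>m. f (m + 1) \<le> f m" and bound: "\<forall>m\<ge>m0. b \<le> f m"
  obtains d M where "\<And>m. d \<le> f m" "\<And>m. m \<ge> M \<Longrightarrow> f m = d"
proof -
  have antimono: "f m' \<le> f m" if "m \<le> m'" for m m'
    using that by (induction m' rule: int_ge_induct) (auto intro: order.trans[OF step])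
  have below: "b \<le> f m" for m
    using antimono[of m "max m m0"] bound[rule_format, of "max m m0"] by simp
  obtain M where M: "\<And>m. nat (f M - b) \<le> nat (f m - b)"
    using ex_has_least_nat[of "\<lambda>_. True" 0 "\<lambda>m. nat (f m - b)"] by auto
  have "f M \<le> f m" for m using M[of m] below[of m] by linarith
  then show thesis using that[of "f M" M] antimono order.antisym by metis
qed

locale vec_bundle =
  fixes n :: nat and e0 einf :: "nat \<Rightarrow> 'k::field vecK"
  assumes frame0: "frame n n e0" and frame_inf: "frame n n einf"
begin

definition from_coords :: "(nat \<Rightarrow> 'k poly) \<Rightarrow> 'k vecK" where
  "from_coords p = (\<Sum>i<n. fscale (to_fract (p i)) (e0 i))"

definition lattice_inf :: "int \<Rightarrow> 'k vecK set" where
  "lattice_inf m = {\<Sum>j<n. fscale (c j) (einf j) | c. \<forall>j<n. in_tpow_kinvt m (c j)}"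

text \<open>The coordinates, in the frame \<open>e0\<close>, of the sections of the twist by \<open>m\<close> of the subbundle with generic
  fibre \<open>U\<close>. Unlike in \<open>H0\<close>, the twist may be negative.\<close>

definition section_coords :: "'k vecK set \<Rightarrow> int \<Rightarrow> (nat \<Rightarrow> 'k poly) set" where
  "section_coords U m = {p. (\<forall>i\<ge>n. p i = 0) \<and> from_coords p \<in> U \<and> from_coords p \<in> lattice_inf m}"

definition values_at_0 :: "'k vecK set \<Rightarrow> int \<Rightarrow> (nat \<Rightarrow> 'k) set" where
  "values_at_0 U m = coeff_vec 0 ` section_coords U m"

definition bundle_degree :: "'k vecK set \<Rightarrow> int" where
  "bundle_degree U = bdeg n e0 einf (fs.dim U) U"

lemma e0_mem: "j < n \<Longrightarrow> e0 j \<in> coord_space n"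
  and einf_mem: "j < n \<Longrightarrow> einf j \<in> coord_space n"
  and indep_e0: "fs.indep_fam n e0"
  using frame0 frame_inf by (auto simp: frame_iff)

lemma from_coords_mem: "from_coords p \<in> coord_space n"
  unfolding from_coords_def
  by (intro fs.subspace_sum fs.subspace_scale subspace_supported e0_mem) simp

lemma linear_from_coords: "Vector_Spaces.linear pscale kscale from_coords"
proof (rule pk.linearI)
  show "from_coords (x + y) = from_coords x + from_coords y" for x y
    by (simp add: from_coords_def vec_apply fs.scale_left_distrib sum.distrib)
  have "to_fract (smult c q) = to_fract [:c:] * to_fract q" for c and q :: "'k poly"
    by (simp flip: to_fract_mult)
  then show "from_coords (pscale c x) = kscale c (from_coords x)" for c x
    by (simp add: from_coords_def kscale_eq_fscale vec_apply fs.scale_sum_right)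
qed

lemma from_coords_mult: "from_coords (\<lambda>i. g * p i) = fscale (to_fract g) (from_coords p)"
  by (simp add: from_coords_def fs.scale_sum_right)

lemma from_coords_poly_comb:
  "from_coords (poly_comb r g p) = (\<Sum>j<r. fscale (to_fract (g j)) (from_coords (p j)))"
proof -
  have "poly_comb r g p = (\<Sum>j<r. (\<lambda>i. g j * p j i))"
    by (simp add: poly_comb_def fun_eq_iff sum_fun_apply)
  then show ?thesis by (simp add: pk.linear_sum[OF linear_from_coords] from_coords_mult)
qed

lemma from_coords_eq_0D:
  assumes "\<And>i. i \<ge> n \<Longrightarrow> p i = 0" "from_coords p = 0"
  shows "p = 0"
proof
  fix i show "p i = 0 i"
    using fs.indep_famD[OF indep_e0, of "\<lambda>i. to_fract (p i)" i] assms
    by (cases "i < n") (auto simp: from_coords_def zero_fun_apply)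
qed

lemma lattice_inf_0: "0 \<in> lattice_inf m"
  unfolding lattice_inf_def by (intro CollectI exI[of _ "\<lambda>_. 0"]) (auto simp: in_tpow_kinvt_0)

lemma lattice_inf_add:
  assumes "v \<in> lattice_inf m" "w \<in> lattice_inf m"
  shows "v + w \<in> lattice_inf m"
proof -
  obtain c d where "v = (\<Sum>j<n. fscale (c j) (einf j))" "\<forall>j<n. in_tpow_kinvt m (c j)"
    "w = (\<Sum>j<n. fscale (d j) (einf j))" "\<forall>j<n. in_tpow_kinvt m (d j)"
    using assms by (auto simp: lattice_inf_def)
  then show ?thesis unfolding lattice_inf_def
    by (intro CollectI exI[of _ "\<lambda>j. c j + d j"])
      (auto simp: fs.scale_left_distrib sum.distrib in_tpow_kinvt_add)
qed

lemma lattice_inf_fscale: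
  assumes "v \<in> lattice_inf m" "\<And>x. in_tpow_kinvt m x \<Longrightarrow> in_tpow_kinvt m' (a * x)"
  shows "fscale a v \<in> lattice_inf m'"
proof -
  obtain c where "v = (\<Sum>j<n. fscale (c j) (einf j))" "\<forall>j<n. in_tpow_kinvt m (c j)"
    using assms(1) by (auto simp: lattice_inf_def)
  then show ?thesis unfolding lattice_inf_def
    by (intro CollectI exI[of _ "\<lambda>j. a * c j"]) (auto simp: fs.scale_sum_right assms(2))
qed

lemma lattice_inf_kscale: "v \<in> lattice_inf m \<Longrightarrow> kscale c v \<in> lattice_inf m"
  using in_tpow_kinvt_mult[OF in_tpow_kinvt_const_rf]
  by (auto simp: kscale_eq_fscale const_rf_to_fract intro: lattice_inf_fscale)

lemma lattice_inf_mono: "m \<le> m' \<Longrightarrow> lattice_inf m \<subseteq> lattice_inf m'"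
  using lattice_inf_fscale[of _ m m' 1] in_tpow_kinvt_mono by auto

lemma lattice_inf_tpow_iff: "fscale (tpow l) v \<in> lattice_inf (m + int l) \<longleftrightarrow> v \<in> lattice_inf m"
proof
  assume "fscale (tpow l) v \<in> lattice_inf (m + int l)"
  then have "fscale (inverse (tpow l)) (fscale (tpow l) v) \<in> lattice_inf m"
  proof (rule lattice_inf_fscale)
    show "in_tpow_kinvt m (inverse (tpow l) * x)" if "in_tpow_kinvt (m + int l) x" for x
      using in_tpow_kinvt_tpow_mult_iff[of m l "inverse (tpow l) * x"] that by (simp flip: mult.assoc)
  qed
  then show "v \<in> lattice_inf m" by simp
qed (rule lattice_inf_fscale, auto simp: in_tpow_kinvt_tpow_mult_iff)

lemma lattice0_eq: "lattice0 n e0 = {from_coords p | p. \<forall>i\<ge>n. p i = 0}"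
proof (intro equalityI subsetI)
  fix v assume "v \<in> lattice0 n e0"
  then obtain c where c: "v = Kcomb n c e0" "\<forall>j<n. in_kt (c j)" by (auto simp: lattice0_def)
  then obtain p where p: "\<And>j. j < n \<Longrightarrow> c j = to_fract (p j)" unfolding in_kt_iff by metis
  have "v = from_coords (\<lambda>i. if i < n then p i else 0)"
    unfolding c Kcomb_eq from_coords_def by (rule sum.cong) (auto simp: p)
  then show "v \<in> {from_coords p | p. \<forall>i\<ge>n. p i = 0}" by fastforce
next
  fix v assume "v \<in> {from_coords p | p. \<forall>i\<ge>n. p i = 0}"
  then obtain p where "v = from_coords p" by blast
  then show "v \<in> lattice0 n e0"
    unfolding lattice0_def Kcomb_eq from_coords_def in_kt_iff
    by (intro CollectI exI[of _ "\<lambda>i. to_fract (p i)"]) auto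
qed

lemma latticeInf_eq: "latticeInf n einf m = lattice_inf (int m)"
proof -
  have "{Kcomb n c einf | c. \<forall>j<n. in_kinvt (c j)} = lattice_inf 0"
    by (simp add: lattice_inf_def Kcomb_eq in_kinvt_iff)
  then have "latticeInf n einf m = fscale (tpow m) ` lattice_inf 0"
    unfolding latticeInf_def fscale_def by auto
  also have "\<dots> = lattice_inf (int m)"
  proof (intro equalityI subsetI)
    fix v assume "v \<in> lattice_inf (int m)"
    then have "fscale (inverse (tpow m)) v \<in> lattice_inf 0"
      using lattice_inf_tpow_iff[of m "fscale (inverse (tpow m)) v" 0] by simp
    moreover have "v = fscale (tpow m) (fscale (inverse (tpow m)) v)" by simp
    ultimately show "v \<in> fscale (tpow m) ` lattice_inf 0" by blast
  qed (use lattice_inf_tpow_iff[of m _ 0] in auto)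
  finally show ?thesis .
qed

lemma H0_eq: "H0 n e0 einf U m = from_coords ` section_coords U (int m)"
  unfolding H0_def lattice0_eq latticeInf_eq by (auto simp: section_coords_def)

lemma subspace_section_coords:
  assumes "fs.subspace U"
  shows "ps.subspace (section_coords U m)"
proof (rule ps.subspaceI)
  show "0 \<in> section_coords U m"
    using fs.subspace_0[OF assms] lattice_inf_0 pk.linear_0[OF linear_from_coords]
    by (simp add: section_coords_def vec_apply)
  show "x + y \<in> section_coords U m" if "x \<in> section_coords U m" "y \<in> section_coords U m" for x y
    using that fs.subspace_add[OF assms] lattice_inf_add pk.linear_add[OF linear_from_coords]
    by (simp add: section_coords_def vec_apply)
  show "pscale c x \<in> section_coords U m" if "x \<in> section_coords U m" for c x
    using that fs.subspace_scale[OF assms] lattice_inf_kscale pk.linear_scale[OF linear_from_coords]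
    by (simp add: section_coords_def vec_apply kscale_eq_fscale)
qed

lemma section_coords_mono: "m \<le> m' \<Longrightarrow> section_coords U m \<subseteq> section_coords U m'"
  using lattice_inf_mono by (auto simp: section_coords_def)

lemma section_coords_mult:
  assumes "fs.subspace U" "p \<in> section_coords U m" "deg_le g d"
  shows "(\<lambda>i. g * p i) \<in> section_coords U (m + d)"
proof -
  have "fscale (to_fract g) (from_coords p) \<in> lattice_inf (m + d)"
    using assms(2,3) in_tpow_kinvt_mult[of d "to_fract g" m]
    by (intro lattice_inf_fscale[where m = m])
      (auto simp: section_coords_def in_tpow_kinvt_to_fract_iff add.commute)
  then show ?thesis
    using assms fs.subspace_scale[OF assms(1)] by (simp add: section_coords_def from_coords_mult)
qed

lemma section_coords_shift_iff:
  assumes "fs.subspace U"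
  shows "(\<lambda>i. monom 1 1 * p i) \<in> section_coords U (m + 1) \<longleftrightarrow> p \<in> section_coords U m"
proof -
  have "fscale (tpow 1) (from_coords p) \<in> U \<longleftrightarrow> from_coords p \<in> U"
    using fs.subspace_scale[OF assms, of "fscale (tpow 1) (from_coords p)" "inverse (tpow 1)"]
      fs.subspace_scale[OF assms, of "from_coords p" "tpow 1"] by auto
  moreover have "monom (1::'k) 1 \<noteq> 0" by (simp add: monom_eq_0_iff)
  ultimately show ?thesis
    using lattice_inf_tpow_iff[of 1 "from_coords p" m]
    by (simp add: section_coords_def from_coords_mult del: One_nat_def flip: tpow_eq_to_fract)
qed

lemma coords_change_frame:
  assumes T: "\<And>j. j < n \<Longrightarrow> einf j = (\<Sum>i<n. fscale (T j i) (e0 i))"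
    and c: "from_coords p = (\<Sum>j<n. fscale (c j) (einf j))" and i: "i < n"
  shows "to_fract (p i) = (\<Sum>j<n. c j * T j i)"
proof -
  have "from_coords p = (\<Sum>j<n. \<Sum>i<n. fscale (c j * T j i) (e0 i))"
    unfolding c by (rule sum.cong) (auto simp: T fs.scale_sum_right)
  also have "\<dots> = (\<Sum>i<n. fscale (\<Sum>j<n. c j * T j i) (e0 i))"
    by (subst sum.swap) (simp add: fs.scale_sum_left)
  finally have "(\<Sum>i<n. fscale (to_fract (p i) - (\<Sum>j<n. c j * T j i)) (e0 i)) = 0"
    by (simp add: from_coords_def fs.scale_left_diff_distrib sum_subtractf)
  from fs.indep_famD[OF indep_e0 this i] show ?thesis by simp
qed

lemma section_coords_deg_bound:
  "\<exists>D. \<forall>m U p. p \<in> section_coords U m \<longrightarrow> (\<forall>i. deg_le (p i) (m + D))"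
proof -
  have "\<exists>c. einf j = (\<Sum>i<n. fscale (c i) (e0 i))" if "j < n" for j
    using frame_expand[OF frame0 einf_mem[OF that]] by metis
  then obtain T where T: "\<And>j. j < n \<Longrightarrow> einf j = (\<Sum>i<n. fscale (T j i) (e0 i))" by metis
  let ?S = "{..<n} \<times> {..<n}"
  obtain q g where q: "q \<noteq> 0" "\<And>t. t \<in> ?S \<Longrightarrow> case_prod T t * to_fract q = to_fract (g t)"
    by (rule common_denominator[of ?S "case_prod T"]) auto
  define D where "D = (\<Sum>t\<in>?S. degree (g t))"
  have "deg_le (p i) (m + int D)" if p: "p \<in> section_coords U m" for U m p i
  proof (cases "i < n")
    case True
    obtain c where c: "from_coords p = (\<Sum>j<n. fscale (c j) (einf j))"
      "\<And>j. j < n \<Longrightarrow> in_tpow_kinvt m (c j)"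
      using p by (auto simp: section_coords_def lattice_inf_def)
    have "to_fract (q * p i) = (\<Sum>j<n. c j * (T j i * to_fract q))"
      using coords_change_frame[OF T c(1) True] by (simp add: sum_distrib_left mult_ac)
    moreover have "in_tpow_kinvt (m + int D) (c j * (T j i * to_fract q))" if "j < n" for j
    proof (intro in_tpow_kinvt_mult c(2)[OF that])
      have "degree (g (j, i)) \<le> D"
        unfolding D_def using that True by (intro member_le_sum) auto
      then show "in_tpow_kinvt (int D) (T j i * to_fract q)"
        using q(2)[of "(j, i)"] that True by (simp add: in_tpow_kinvt_to_fract_iff deg_le_iff_degree)
    qed
    ultimately have "in_tpow_kinvt (m + int D) (to_fract (q * p i))"
      by (auto intro: in_tpow_kinvt_sum)
    then show ?thesis
      using deg_le_multD[OF _ q(1)] by (simp add: in_tpow_kinvt_to_fract_iff del: to_fract_mult)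
  next
    case False
    then show ?thesis using p by (simp add: section_coords_def deg_le_0)
  qed
  then show ?thesis by blast
qed

lemma fin_dim_section_coords: "ps.fin_dim (section_coords U m)"
proof -
  obtain D where D: "\<And>p i. p \<in> section_coords U m \<Longrightarrow> deg_le (p i) (m + D)"
    using section_coords_deg_bound by blast
  have "coeff (p i) s = 0" if "p \<in> section_coords U m" "nat (m + D + 1) \<le> s" for p i s
    using D[OF that(1), of i] that(2) by (auto simp: deg_le_def)
  then have "section_coords U m \<subseteq> poly_vecs n (nat (m + D + 1))"
    by (auto simp: poly_vecs_def section_coords_def coeff_vec_def fun_eq_iff zero_fun_apply)
  then show ?thesis by (rule ps.fin_dim_subset[OF fin_dim_poly_vecs])
qed

lemma
  assumes "ps.subspace S" "S \<subseteq> section_coords U m"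
  shows dim_from_coords_image: "ks.dim (from_coords ` S) = ps.dim S"
    and fin_dim_from_coords_image: "ks.fin_dim (from_coords ` S)"
proof -
  have fin: "ps.fin_dim S" by (rule ps.fin_dim_subset[OF fin_dim_section_coords assms(2)])
  have "p = 0" if "p \<in> S" "from_coords p = 0" for p
    using that assms(2) by (intro from_coords_eq_0D) (auto simp: section_coords_def)
  then show "ks.dim (from_coords ` S) = ps.dim S"
    by (intro pk.dim_image_inj[OF linear_from_coords assms(1) fin])
  show "ks.fin_dim (from_coords ` S)" by (rule pk.fin_dim_image[OF linear_from_coords fin])
qed

lemma kdim_H0: "fs.subspace U \<Longrightarrow> kdim (H0 n e0 einf U m) = ps.dim (section_coords U (int m))"
  unfolding H0_eq
  by (simp add: kdim_eq_dim dim_from_coords_image[OF subspace_section_coords subset_refl]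
      fin_dim_from_coords_image[OF subspace_section_coords subset_refl])

lemma subspace_values_at_0: "fs.subspace U \<Longrightarrow> fs.subspace (values_at_0 U m)"
  unfolding values_at_0_def
  by (rule pf.linear_subspace_image[OF linear_coeff_vec subspace_section_coords])

lemma values_at_0_subset: "values_at_0 U m \<subseteq> coord_space n"
  by (auto simp: values_at_0_def section_coords_def intro: coeff_vec_in_coord_space)

lemma fin_dim_values_at_0: "fs.fin_dim (values_at_0 U m)"
  by (rule fs.fin_dim_subset[OF fin_dim_supported values_at_0_subset]) simp

lemma values_at_0_mono: "m \<le> m' \<Longrightarrow> values_at_0 U m \<subseteq> values_at_0 U m'"
  unfolding values_at_0_def using section_coords_mono by blast

lemma section_vanishing_at_0:
  assumes U: "fs.subspace U" and p: "p \<in> section_coords U (m + 1)" "coeff_vec 0 p = 0"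
  obtains q where "q \<in> section_coords U m" "p = (\<lambda>i. monom 1 1 * q i)"
proof -
  define q where "q i = poly_shift 1 (p i)" for i
  have "coeff (p i) 0 = 0" for i using p(2) by (simp add: coeff_vec_def fun_eq_iff zero_fun_apply)
  then have "p i = monom 1 1 * q i" for i
    by (intro poly_eqI) (auto simp: q_def coeff_monom_mult coeff_poly_shift not_le)
  then have "p = (\<lambda>i. monom 1 1 * q i)" by blast
  moreover from this have "q \<in> section_coords U m" using p(1) section_coords_shift_iff[OF U] by simp
  ultimately show thesis using that by blast
qed

lemma dim_section_coords_step:
  assumes U: "fs.subspace U"
  shows "ps.dim (section_coords U (m + 1)) = ps.dim (section_coords U m) +
    fs.dim (values_at_0 U (m + 1))"
proof -
  define X :: "(nat \<Rightarrow> 'k poly) \<Rightarrow> nat \<Rightarrow> 'k poly" where "X p = (\<lambda>i. monom 1 1 * p i)" for p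
  have lin: "Vector_Spaces.linear pscale pscale X"
    by (rule pp.linearI) (auto simp: X_def fun_eq_iff vec_apply algebra_simps)
  have "{p \<in> section_coords U (m + 1). coeff_vec 0 p = 0} = X ` section_coords U m"
  proof (intro equalityI subsetI)
    fix p assume "p \<in> {p \<in> section_coords U (m + 1). coeff_vec 0 p = 0}"
    then show "p \<in> X ` section_coords U m"
      unfolding X_def using section_vanishing_at_0[OF U, of p m] by blast
  next
    fix p assume "p \<in> X ` section_coords U m"
    then show "p \<in> {p \<in> section_coords U (m + 1). coeff_vec 0 p = 0}"
      using section_coords_shift_iff[OF U]
      by (auto simp: X_def coeff_vec_def fun_eq_iff zero_fun_apply coeff_monom_mult)
  qed
  moreover have "ps.dim (X ` section_coords U m) = ps.dim (section_coords U m)"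
    by (rule pp.dim_image_inj[OF lin subspace_section_coords[OF U] fin_dim_section_coords])
      (simp add: X_def fun_eq_iff zero_fun_apply monom_eq_0_iff)
  ultimately show ?thesis
    using pf.rank_nullity[OF linear_coeff_vec[of 0] subspace_section_coords[OF U]
      fin_dim_section_coords[of U "m + 1"]]
    by (simp add: values_at_0_def)
qed

lemma indep_from_coords:
  assumes supp: "\<And>j i. j < r \<Longrightarrow> i \<ge> n \<Longrightarrow> p j i = 0"
    and ind: "fs.indep_fam r (\<lambda>j. coeff_vec 0 (p j))"
  shows "fs.indep_fam r (\<lambda>j. from_coords (p j))"
  unfolding fs.indep_fam_def
proof (intro allI impI)
  fix c j assume rel: "(\<Sum>j<r. fscale (c j) (from_coords (p j))) = 0" and j: "j < r"
  obtain q g where q: "q \<noteq> 0" "\<And>j. j \<in> {..<r} \<Longrightarrow> c j * to_fract q = to_fract (g j)"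
    by (rule common_denominator[of "{..<r}" c]) auto
  have "from_coords (poly_comb r g p) = fscale (to_fract q) (\<Sum>j<r. fscale (c j) (from_coords (p j)))"
    unfolding from_coords_poly_comb fs.scale_sum_right
    by (rule sum.cong) (auto simp: q(2)[symmetric] mult.commute)
  also have "\<dots> = 0" by (simp add: rel)
  finally have "poly_comb r g p = 0"
    using supp by (intro from_coords_eq_0D) (auto simp: poly_comb_def)
  then have "g j = 0" using poly_relation_trivial[OF ind _ j] by blast
  then show "c j = 0" using q(1) q(2)[of j] j by simp
qed

lemma dim_values_at_0_le:
  assumes U: "fs.subspace U" "U \<subseteq> coord_space n"
  shows "fs.dim (values_at_0 U m) \<le> fs.dim U"
proof -
  define r where "r = fs.dim (values_at_0 U m)"
  obtain b where b: "fs.indep_fam r b" "\<And>j. j < r \<Longrightarrow> b j \<in> values_at_0 U m"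
    unfolding r_def using fs.basis_fam[OF fin_dim_values_at_0] by metis
  then have "\<exists>p. p \<in> section_coords U m \<and> b j = coeff_vec 0 p" if "j < r" for j
    using that by (auto simp: values_at_0_def)
  then obtain p where p: "\<And>j. j < r \<Longrightarrow> p j \<in> section_coords U m \<and> b j = coeff_vec 0 (p j)"
    by metis
  then have "fs.indep_fam r (\<lambda>j. coeff_vec 0 (p j))"
    using b(1) fs.indep_fam_cong[of r b "\<lambda>j. coeff_vec 0 (p j)"] by simp
  then have "fs.indep_fam r (\<lambda>j. from_coords (p j))"
    using p by (intro indep_from_coords) (auto simp: section_coords_def)
  moreover have "fs.fin_dim U" by (rule fs.fin_dim_subset[OF fin_dim_supported U(2)]) simp
  ultimately show ?thesis
    using p fs.indep_fam_le_dim[of U r "\<lambda>j. from_coords (p j)"] by (auto simp: section_coords_def r_def)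
qed

lemma poly_comb_in_section_coords:
  assumes U: "fs.subspace U" and p: "\<And>j. j < r \<Longrightarrow> p j \<in> section_coords U m"
    and g: "\<And>j. j < r \<Longrightarrow> deg_le (g j) d"
  shows "poly_comb r g p \<in> section_coords U (m + d)"
proof -
  have "poly_comb r g p = (\<Sum>j<r. (\<lambda>i. g j * p j i))"
    by (simp add: poly_comb_def fun_eq_iff sum_fun_apply)
  then show ?thesis
    using section_coords_mult[OF U p g]
      by (auto intro!: ps.subspace_sum[OF subspace_section_coords[OF U]])
qed

lemma dim_section_coords_ge:
  assumes U: "fs.subspace U" and p: "\<And>j. j < r \<Longrightarrow> p j \<in> section_coords U m"
    and ind: "fs.indep_fam r (\<lambda>j. from_coords (p j))"
  shows "r * (l + 1) \<le> ps.dim (section_coords U (m + int l))"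
proof -
  let ?P = "poly_vecs r (Suc l) :: (nat \<Rightarrow> 'k poly) set"
  have inj: "g = 0" if g: "g \<in> ?P" "poly_comb r g p = 0" for g
  proof
    fix j
    have "(\<Sum>j<r. fscale (to_fract (g j)) (from_coords (p j))) = 0"
      using g(2) pk.linear_0[OF linear_from_coords] by (simp flip: from_coords_poly_comb)
    then show "g j = 0 j"
      using fs.indep_famD[OF ind, of "\<lambda>j. to_fract (g j)" j] g(1)
      by (cases "j < r") (auto simp: poly_vecs_def zero_fun_apply)
  qed
  have "(\<lambda>g. poly_comb r g p) ` ?P \<subseteq> section_coords U (m + int l)"
    using poly_comb_in_section_coords[of U r p m, OF U p] poly_vecs_deg_le[of _ r l] by auto
  then have "ps.dim ((\<lambda>g. poly_comb r g p) ` ?P) \<le> ps.dim (section_coords U (m + int l))"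
    by (rule ps.dim_mono_fin_dim[OF fin_dim_section_coords])
  then show ?thesis
    using pp.dim_image_inj[OF linear_poly_comb subspace_poly_vecs fin_dim_poly_vecs inj]
    by (simp add: dim_poly_vecs)
qed

lemma exists_section_multiple:
  assumes U: "fs.subspace U" "u \<in> U" "U \<subseteq> coord_space n"
  obtains q p m where "q \<noteq> 0" "p \<in> section_coords U m" "from_coords p = fscale (to_fract q) u"
proof -
  have u: "u \<in> coord_space n" using U by blast
  obtain c where c: "u = (\<Sum>j<n. fscale (c j) (e0 j))" by (rule frame_expand[OF frame0 u])
  obtain d where d: "u = (\<Sum>j<n. fscale (d j) (einf j))" by (rule frame_expand[OF frame_inf u])
  obtain q g where q: "q \<noteq> 0"
    "\<And>t. t \<in> {..<n} <+> {..<n} \<Longrightarrow> case_sum c d t * to_fract q = to_fract (g t)"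
    by (rule common_denominator[of "{..<n} <+> {..<n}" "case_sum c d"]) auto
  have c_q: "c j * to_fract q = to_fract (g (Inl j))" and d_q: "d j * to_fract q = to_fract (g (Inr j))"
    if "j < n" for j
    using q(2)[of "Inl j"] q(2)[of "Inr j"] that by auto
  define p where "p i = (if i < n then g (Inl i) else 0)" for i
  define m where "m = (\<Sum>j<n. degree (g (Inr j)))"
  have p_eq: "from_coords p = fscale (to_fract q) u"
    unfolding from_coords_def c fs.scale_sum_right
    by (rule sum.cong) (auto simp: p_def mult.commute simp flip: c_q)
  have "fscale (to_fract q) u = (\<Sum>j<n. fscale (to_fract (g (Inr j))) (einf j))"
    unfolding d fs.scale_sum_right by (rule sum.cong) (auto simp: mult.commute simp flip: d_q)
  moreover have "in_tpow_kinvt (int m) (to_fract (g (Inr j)))" if "j < n" for j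
    unfolding m_def in_tpow_kinvt_to_fract_iff deg_le_iff_degree using that
      by (intro member_le_sum) auto
  ultimately have "from_coords p \<in> lattice_inf (int m)"
    unfolding p_eq lattice_inf_def
    by (intro CollectI exI[of _ "\<lambda>j. to_fract (g (Inr j))"]) blast
  moreover have "from_coords p \<in> U" unfolding p_eq by (rule fs.subspace_scale[OF U(1,2)])
  ultimately have "p \<in> section_coords U (int m)" by (simp add: section_coords_def p_def)
  then show thesis using that q(1) p_eq by blast
qed

lemma exists_independent_sections:
  assumes U: "fs.subspace U" "U \<subseteq> coord_space n"
  obtains p m where "\<And>j. j < fs.dim U \<Longrightarrow> p j \<in> section_coords U m"
    "fs.indep_fam (fs.dim U) (\<lambda>j. from_coords (p j))"
proof -
  have "fs.fin_dim U" by (rule fs.fin_dim_subset[OF fin_dim_supported U(2)]) simp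
  then obtain b where b: "fs.indep_fam (fs.dim U) b" "\<And>j. j < fs.dim U \<Longrightarrow> b j \<in> U"
    using fs.basis_fam[of U] by metis
  have "\<exists>q p m. q \<noteq> 0 \<and> p \<in> section_coords U m \<and> from_coords p = fscale (to_fract q) (b j)"
    if "j < fs.dim U" for j
    using exists_section_multiple[OF U(1) b(2)[OF that] U(2)] by metis
  then obtain q p m where qpm: "\<And>j. j < fs.dim U \<Longrightarrow>
      q j \<noteq> 0 \<and> p j \<in> section_coords U (m j) \<and> from_coords (p j) = fscale (to_fract (q j)) (b j)"
        by metis
  define M where "M = (\<Sum>j<fs.dim U. \<bar>m j\<bar>)"
  have "p j \<in> section_coords U M" if "j < fs.dim U" for j
  proof -
    have "\<bar>m j\<bar> \<le> M" unfolding M_def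
      using that by (intro member_le_sum[of j "{..<fs.dim U}" "\<lambda>j. \<bar>m j\<bar>"]) auto
    then have "m j \<le> M" by linarith
    then show ?thesis using qpm[OF that] section_coords_mono by blast
  qed
  moreover have "fs.indep_fam (fs.dim U) (\<lambda>j. from_coords (p j))"
    using fs.indep_fam_scale[OF b(1), of "\<lambda>j. to_fract (q j)"] qpm
      fs.indep_fam_cong[of "fs.dim U" "\<lambda>j. from_coords (p j)"] by simp
  ultimately show thesis using that by blast
qed

lemma hilbert_polynomial:
  assumes U: "fs.subspace U" "U \<subseteq> coord_space n"
  obtains d M where "\<And>m. d + int (fs.dim U) * (m + 1) \<le> int (ps.dim (section_coords U m))"
    "\<And>m. m \<ge> M \<Longrightarrow> int (ps.dim (section_coords U m)) = d + int (fs.dim U) * (m + 1)"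
proof -
  let ?r = "fs.dim U"
  define f where "f m = int (ps.dim (section_coords U m)) - int ?r * (m + 1)" for m
  obtain p m0 where p: "\<And>j. j < ?r \<Longrightarrow> p j \<in> section_coords U m0"
    "fs.indep_fam ?r (\<lambda>j. from_coords (p j))"
    by (rule exists_independent_sections[OF U]) (rule that)
  have step: "f (m + 1) \<le> f m" for m
    using dim_section_coords_step[OF U(1), of m] dim_values_at_0_le[OF U, of "m + 1"]
    by (simp add: f_def algebra_simps)
  have bound: "\<forall>m\<ge>m0. - int ?r * m0 \<le> f m"
  proof (intro allI impI)
    fix m assume "m \<ge> m0"
    have "int (?r * (nat (m - m0) + 1)) \<le> int (ps.dim (section_coords U m))"
      using dim_section_coords_ge[OF U(1) p, of "nat (m - m0)"] \<open>m \<ge> m0\<close>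
        by (simp only: of_nat_le_iff) simp
    then show "- int ?r * m0 \<le> f m" using \<open>m \<ge> m0\<close> by (simp add: f_def algebra_simps)
  qed
  obtain d M where "\<And>m. d \<le> f m" "\<And>m. m \<ge> M \<Longrightarrow> f m = d"
    by (rule antimono_int_eventually_const[of f, OF step bound]) (rule that)
  then show thesis using that[of d M] by (simp add: f_def algebra_simps)
qed

lemma
  assumes U: "fs.subspace U" "U \<subseteq> coord_space n"
  shows bundle_degree_le_dim_sections:
      "bundle_degree U + int (fs.dim U) * (m + 1) \<le> int (ps.dim (section_coords U m))"
    and eventually_dim_sections:
      "\<exists>M. \<forall>m\<ge>M. int (ps.dim (section_coords U m)) = bundle_degree U + int (fs.dim U) * (m + 1)"
proof -
  obtain d M where d: "\<And>m. d + int (fs.dim U) * (m + 1) \<le> int (ps.dim (section_coords U m))"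
    "\<And>m. m \<ge> M \<Longrightarrow> int (ps.dim (section_coords U m)) = d + int (fs.dim U) * (m + 1)"
    by (rule hilbert_polynomial[OF U]) (rule that)
  have "bundle_degree U = d"
    unfolding bundle_degree_def bdeg_def
  proof (rule the_equality)
    show "has_degree n e0 einf (fs.dim U) U d"
      unfolding has_degree_def kdim_H0[OF U(1)] using d(2) by (intro exI[of _ "nat M"]) auto
    fix d' assume "has_degree n e0 einf (fs.dim U) U d'"
    then obtain M' where
      M': "\<And>m. m \<ge> M' \<Longrightarrow> int (ps.dim (section_coords U (int m))) = d' + int (fs.dim U) * (int m + 1)"
      unfolding has_degree_def kdim_H0[OF U(1)] by blast
    then show "d' = d" using M'[of "max M' (nat M)"] d(2)[of "int (max M' (nat M))"] by simp
  qed
  then show "bundle_degree U + int (fs.dim U) * (m + 1) \<le> int (ps.dim (section_coords U m))"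
    "\<exists>M. \<forall>m\<ge>M. int (ps.dim (section_coords U m)) = bundle_degree U + int (fs.dim U) * (m + 1)"
    using d by auto
qed

lemma bundle_degree_ge:
  assumes U: "fs.subspace U" "U \<subseteq> coord_space n"
    and p: "\<And>j. j < fs.dim U \<Longrightarrow> p j \<in> section_coords U m"
      "fs.indep_fam (fs.dim U) (\<lambda>j. from_coords (p j))"
  shows "- int (fs.dim U) * m \<le> bundle_degree U"
proof -
  obtain M where
    M: "\<And>m. m \<ge> M \<Longrightarrow> int (ps.dim (section_coords U m)) = bundle_degree U + int (fs.dim U) * (m + 1)"
    using eventually_dim_sections[OF U] by blast
  let ?l = "nat (M - m)"
  have "int (fs.dim U * (?l + 1)) \<le> int (ps.dim (section_coords U (m + int ?l)))"
    using dim_section_coords_ge[OF U(1) p] by (simp only: of_nat_le_iff)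
  also have "\<dots> = bundle_degree U + int (fs.dim U) * (m + int ?l + 1)" by (rule M) simp
  finally show ?thesis by (simp add: algebra_simps)
qed

lemma vanishing_combination_at_0:
  assumes U: "fs.subspace U" and q: "\<And>j. j < r \<Longrightarrow> q j \<in> section_coords U (m + 1)"
    and p: "p \<in> section_coords U (m + 1)"
    and c: "coeff_vec 0 p = (\<Sum>j<r. fscale (c j) (coeff_vec 0 (q j)))"
  obtains p' where "p' \<in> section_coords U m" "p = poly_comb r (\<lambda>j. [:c j:]) q + (\<lambda>i. monom 1 1 * p' i)"
proof -
  let ?q = "poly_comb r (\<lambda>j. [:c j:]) q"
  have "?q \<in> section_coords U (m + 1)"
    unfolding poly_comb_const using q
    by (intro ps.subspace_sum ps.subspace_scale subspace_section_coords[OF U]) auto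
  then have "p - ?q \<in> section_coords U (m + 1)"
    by (rule ps.subspace_diff[OF subspace_section_coords[OF U] p])
  moreover have "coeff_vec 0 (p - ?q) = 0"
    by (simp add: poly_comb_const c pf.linear_diff[OF linear_coeff_vec]
      pf.linear_sum[OF linear_coeff_vec]
        pf.linear_scale[OF linear_coeff_vec])
  ultimately obtain p' where "p' \<in> section_coords U m" "p - ?q = (\<lambda>i. monom 1 1 * p' i)"
    by (rule section_vanishing_at_0[OF U])
  then show thesis using that[of p'] by (metis add.commute diff_add_cancel)
qed

lemma sections_generated:
  assumes U: "fs.subspace U" and below: "section_coords U (m - 1) = {0}"
    and q: "\<And>j. j < r \<Longrightarrow> q j \<in> section_coords U m"
    and span: "\<And>m' v. v \<in> values_at_0 U m' \<Longrightarrow> \<exists>c. v = (\<Sum>j<r. fscale (c j) (coeff_vec 0 (q j)))"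
    and p: "p \<in> section_coords U (m - 1 + int l)"
  shows "\<exists>g\<in>poly_vecs r l. p = poly_comb r g q"
proof -
  have "\<exists>g. (\<forall>j s. l \<le> s \<longrightarrow> coeff (g j) s = 0) \<and> p = poly_comb r g q"
    using p
  proof (induction l arbitrary: p)
    case 0
    then have "p = 0" using below by simp
    then show ?case by (intro exI[of _ "\<lambda>_. 0"]) (simp add: poly_comb_def zero_fun_def)
  next
    case (Suc l)
    let ?m = "m - 1 + int l"
    have p: "p \<in> section_coords U (?m + 1)" using Suc.prems by (simp add: algebra_simps)
    then obtain c where c: "coeff_vec 0 p = (\<Sum>j<r. fscale (c j) (coeff_vec 0 (q j)))"
      using span unfolding values_at_0_def by blast
    have "q j \<in> section_coords U (?m + 1)" if "j < r" for j
      using q[OF that] section_coords_mono[of m "?m + 1"] by auto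
    then obtain p' where p': "p' \<in> section_coords U ?m"
      "p = poly_comb r (\<lambda>j. [:c j:]) q + (\<lambda>i. monom 1 1 * p' i)"
      using vanishing_combination_at_0[OF U _ p c] by blast
    obtain g where g: "\<forall>j s. l \<le> s \<longrightarrow> coeff (g j) s = 0" "p' = poly_comb r g q"
      using Suc.IH[OF p'(1)] by blast
    have "p = poly_comb r (\<lambda>j. pCons (c j) (g j)) q"
      unfolding p'(2) g(2) poly_comb_shift
      by (simp add: poly_comb_def fun_eq_iff plus_fun_apply sum.distrib[symmetric] algebra_simps)
    moreover have "\<forall>j s. Suc l \<le> s \<longrightarrow> coeff (pCons (c j) (g j)) s = 0"
      using g(1) by (auto simp: coeff_pCons split: nat.splits)
    ultimately show ?case by (intro exI[of _ "\<lambda>j. pCons (c j) (g j)"]) blast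
  qed
  then show ?thesis using poly_comb_in_poly_vecs[of l _ r q] by metis
qed

text \<open>The hypotheses say that the twist by \<open>m\<close> of the subbundle is a trivial bundle, and the vectors \<open>q j\<close> are
  the coordinates of a basis of its sections.\<close>

lemma balanced_subbundle:
  assumes U: "fs.subspace U" "U \<subseteq> coord_space n" and below: "section_coords U (m - 1) = {0}"
    and degree: "- int (fs.dim U) * m \<le> bundle_degree U"
  obtains q where "\<And>j. j < fs.dim U \<Longrightarrow> q j \<in> section_coords U m"
    "fs.indep_fam (fs.dim U) (\<lambda>j. coeff_vec 0 (q j))"
    "\<And>l p. p \<in> section_coords U (m - 1 + int l) \<Longrightarrow>
      \<exists>g\<in>poly_vecs (fs.dim U) l. p = poly_comb (fs.dim U) g q"
proof -
  let ?r = "fs.dim U"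
  have "ps.dim (section_coords U m) = fs.dim (values_at_0 U m)"
    using dim_section_coords_step[OF U(1), of "m - 1"] by (simp add: below ps.dim_zero_set)
  then have r: "fs.dim (values_at_0 U m) = ?r"
    using bundle_degree_le_dim_sections[OF U, of m] degree dim_values_at_0_le[OF U, of m]
    by (simp add: algebra_simps)
  obtain b where b: "fs.indep_fam ?r b" "\<And>j. j < ?r \<Longrightarrow> b j \<in> values_at_0 U m"
    "\<And>v. v \<in> values_at_0 U m \<Longrightarrow> \<exists>c. v = (\<Sum>j<?r. fscale (c j) (b j))"
    using fs.basis_fam[OF fin_dim_values_at_0, of U m] unfolding r by metis
  have "\<exists>q. q \<in> section_coords U m \<and> b j = coeff_vec 0 q" if "j < ?r" for j
    using b(2)[OF that] by (auto simp: values_at_0_def)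
  then obtain q where q: "\<And>j. j < ?r \<Longrightarrow> q j \<in> section_coords U m \<and> b j = coeff_vec 0 (q j)"
    by metis
  have same: "values_at_0 U m' \<subseteq> values_at_0 U m" for m'
  proof -
    have "values_at_0 U m = values_at_0 U (max m m')"
      using dim_values_at_0_le[OF U, of "max m m'"] r
      by (intro fs.subspace_eq_fin_dim[OF fin_dim_values_at_0 subspace_values_at_0[OF U(1)]]
        values_at_0_mono)
        auto
    then show ?thesis using values_at_0_mono[of m' "max m m'"] by simp
  qed
  show thesis
  proof
    show "fs.indep_fam ?r (\<lambda>j. coeff_vec 0 (q j))"
      using b(1) q fs.indep_fam_cong[of ?r b "\<lambda>j. coeff_vec 0 (q j)"] by simp
    fix l p assume p: "p \<in> section_coords U (m - 1 + int l)"
    have "\<exists>c. v = (\<Sum>j<?r. fscale (c j) (coeff_vec 0 (q j)))" if "v \<in> values_at_0 U m'" for m' v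
      using b(3)[of v] same that q by auto
    then show "\<exists>g\<in>poly_vecs ?r l. p = poly_comb ?r g q"
      using q by (intro sections_generated[OF U(1) below _ _ p]) auto
  qed (use q in blast)
qed

end

section \<open>Stability\<close>

lemma alpha_slope_less_iff:
  assumes r: "0 < r" "r \<le> n" and w: "w \<le> k" and \<alpha>: "0 < \<alpha>" "\<alpha> * real k < 1"
  shows "alpha_slope \<alpha> d r w < alpha_slope \<alpha> (int n * a) n k \<longleftrightarrow>
    d < int r * a \<or> (d = int r * a \<and> n * w < k * r)"
proof -
  define e where "e = d - int r * a"
  have "alpha_slope \<alpha> d r w < alpha_slope \<alpha> d' n k \<longleftrightarrow>
      (real_of_int d + \<alpha> * real w) * real n < (real_of_int d' + \<alpha> * real k) * real r" for d'
    using r by (simp add: alpha_slope_def divide_less_eq less_divide_eq flip: add_divide_distrib)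
  then have "alpha_slope \<alpha> d r w < alpha_slope \<alpha> (int n * a) n k \<longleftrightarrow>
      (real_of_int d + \<alpha> * real w) * real n < (real_of_int (int n * a) + \<alpha> * real k) * real r" .
  also have "\<dots> \<longleftrightarrow> real_of_int e * real n < \<alpha> * (real k * real r) - \<alpha> * (real n * real w)"
    by (simp add: e_def algebra_simps)
  also have "\<dots> \<longleftrightarrow> e < 0 \<or> (e = 0 \<and> n * w < k * r)"
  proof (cases e "0 :: int" rule: linorder_cases)
    case less
    have "\<alpha> * real w \<le> \<alpha> * real k" using w \<alpha> by simp
    then have "\<alpha> * real w < 1" using \<alpha>(2) by linarith
    then have "(\<alpha> * real w) * real n < 1 * real n" using r by (intro mult_strict_right_mono) auto
    moreover have "real_of_int e * real n \<le> (- 1) * real n"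
      using less by (intro mult_right_mono) auto
    moreover have "0 \<le> \<alpha> * (real k * real r)" using \<alpha> by simp
    ultimately show ?thesis using less by (simp add: algebra_simps)
  next
    case equal
    have "\<alpha> * (real n * real w) < \<alpha> * (real k * real r) \<longleftrightarrow> n * w < k * r"
      using \<alpha> by (simp flip: of_nat_mult)
    then show ?thesis using equal by simp
  next
    case greater
    have "(\<alpha> * real k) * real r < 1 * real n"
      using r \<alpha> by (intro mult_less_le_imp_less) auto
    moreover have "1 * real n \<le> real_of_int e * real n"
      using greater by (intro mult_right_mono) auto
    moreover have "0 \<le> \<alpha> * (real n * real w)" using \<alpha> by simp
    ultimately show ?thesis using greater by (simp add: algebra_simps)
  qed
  finally show ?thesis by (simp add: e_def)
qed

context vec_bundle
begin

text \<open>For small \<open>\<alpha>\<close> the slopes are compared lexicographically.\<close>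

definition lex_less :: "int \<Rightarrow> 'k vecK set \<Rightarrow> 'k vecK set \<Rightarrow> 'k vecK set \<Rightarrow> bool" where
  "lex_less a V U W \<longleftrightarrow> bundle_degree U < int (fs.dim U) * a \<or>
    (bundle_degree U = int (fs.dim U) * a \<and> n * ks.dim W < ks.dim V * fs.dim U)"

definition lex_stable :: "int \<Rightarrow> 'k vecK set \<Rightarrow> bool" where
  "lex_stable a V \<longleftrightarrow>
    (\<forall>U W. fs.subspace U \<and> U \<subseteq> coord_space n \<and> U \<noteq> {0} \<and> ks.subspace W \<and> W \<subseteq> V \<inter> U \<and>
        (U \<noteq> coord_space n \<or> W \<noteq> V) \<longrightarrow> lex_less a V U W)"

lemma dim_le_rank: "U \<subseteq> coord_space n \<Longrightarrow> fs.dim U \<le> n" for U :: "'k vecK set"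
  using fs.dim_mono_fin_dim[OF fin_dim_supported[of "{..<n}"], of U] by (simp add: dim_supported)

lemma dim_less_rank_iff:
  assumes "fs.subspace U" "U \<subseteq> coord_space n"
  shows "fs.dim U < n \<longleftrightarrow> U \<noteq> (coord_space n :: 'k vecK set)"
  using fs.subspace_eq_fin_dim[OF fin_dim_supported[of "{..<n}"] assms] dim_le_rank[OF assms(2)]
  by (auto simp: dim_supported)

lemma dim_pos_iff:
  assumes "fs.subspace U" "U \<subseteq> coord_space n"
  shows "0 < fs.dim U \<longleftrightarrow> U \<noteq> ({0} :: 'k vecK set)"
  using fs.dim_eq_0_iff_fin_dim[OF fs.fin_dim_subset[OF fin_dim_supported assms(2)] assms(1)] by auto

lemma alpha_slope_less_iff_lex:
  assumes degree: "bdeg n e0 einf n (fullspace n) = int n * a"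
    and V: "ks.fin_dim V" and \<alpha>: "0 < \<alpha>" "\<alpha> * real (ks.dim V) < 1"
    and U: "U \<subseteq> coord_space n" "0 < fs.dim U" and W: "W \<subseteq> V"
  shows "alpha_slope \<alpha> (bdeg n e0 einf (fs.dim U) U) (fs.dim U) (kdim W)
        < alpha_slope \<alpha> (bdeg n e0 einf n (fullspace n)) n (kdim V) \<longleftrightarrow>
      lex_less a V U W"
proof -
  have "ks.fin_dim W" "ks.dim W \<le> ks.dim V"
    using ks.fin_dim_subset[OF V W] ks.dim_mono_fin_dim[OF V W] by auto
  then show ?thesis
    using U V \<alpha> dim_le_rank[OF U(1)]
    by (simp add: degree kdim_eq_dim bundle_degree_def alpha_slope_less_iff lex_less_def)
qed

lemma alpha_stable_iff_lex_stable:
  assumes degree: "bdeg n e0 einf n (fullspace n) = int n * a"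
    and V: "ks.fin_dim V" and \<alpha>: "0 < \<alpha>" "\<alpha> * real (ks.dim V) < 1"
  shows "alpha_stable \<alpha> n e0 einf V \<longleftrightarrow> lex_stable a V"
proof
  assume stable: "alpha_stable \<alpha> n e0 einf V"
  show "lex_stable a V"
    unfolding lex_stable_def
  proof (intro allI impI, elim conjE)
    fix U W assume U: "fs.subspace U" "U \<subseteq> coord_space n" "U \<noteq> {0}" and W: "ks.subspace W" "W \<subseteq> V \<inter> U"
      and proper: "U \<noteq> coord_space n \<or> W \<noteq> V"
    obtain u where u: "frame n (fs.dim U) u" "Kspan (fs.dim U) u = U" by (rule exists_frame[OF U(1,2)])
    have pos: "0 < fs.dim U" using dim_pos_iff[OF U(1,2)] U(3) by simp
    moreover have "fs.dim U < n \<or> W \<noteq> V" using proper dim_less_rank_iff[OF U(1,2)] by simp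
    ultimately have "alpha_slope \<alpha> (bdeg n e0 einf (fs.dim U) U) (fs.dim U) (kdim W)
        < alpha_slope \<alpha> (bdeg n e0 einf n (fullspace n)) n (kdim V)"
      using stable u W dim_le_rank[OF U(2)] unfolding alpha_stable_def ksubspace_iff
      by (elim allE[of _ "fs.dim U"] allE[of _ u] allE[of _ W]) auto
    then show "lex_less a V U W"
      using alpha_slope_less_iff_lex[OF assms U(2) pos] W(2) by blast
  qed
next
  assume lex: "lex_stable a V"
  show "alpha_stable \<alpha> n e0 einf V"
    unfolding alpha_stable_def ksubspace_iff
  proof (intro allI impI, elim conjE)
    fix r u W assume r: "1 \<le> r" "frame n r u" and W: "ks.subspace W" "W \<subseteq> V \<inter> Kspan r u"
      and proper: "r < n \<or> W \<noteq> V"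
    have U: "fs.subspace (Kspan r u)" "Kspan r u \<subseteq> coord_space n" "fs.dim (Kspan r u) = r"
      using frame_Kspan[OF r(2)] by auto
    have "Kspan r u \<noteq> {0}" using U(3) r(1) by (auto simp: fs.dim_zero_set)
    moreover have "Kspan r u \<noteq> coord_space n \<or> W \<noteq> V" using proper dim_less_rank_iff[OF U(1,2)] U(3)
      by simp
    ultimately have "lex_less a V (Kspan r u) W"
      using lex U(1,2) W unfolding lex_stable_def by blast
    moreover have "W \<subseteq> V" using W(2) by blast
    ultimately show "alpha_slope \<alpha> (bdeg n e0 einf r (Kspan r u)) r (kdim W)
        < alpha_slope \<alpha> (bdeg n e0 einf n (fullspace n)) n (kdim V)"
      using alpha_slope_less_iff_lex[OF assms U(2), of W] U(3) r(1) by simp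
  qed
qed

lemma zero_plus_stable_iff_lex_stable:
  assumes degree: "bdeg n e0 einf n (fullspace n) = int n * a"
    and V: "ks.fin_dim V" "0 < ks.dim V"
  shows "zero_plus_stable n e0 einf V \<longleftrightarrow> lex_stable a V"
proof -
  let ?\<alpha> = "1 / real (ks.dim V)"
  have small: "alpha_stable \<alpha> n e0 einf V \<longleftrightarrow> lex_stable a V" if "0 < \<alpha>" "\<alpha> < ?\<alpha>" for \<alpha>
    using that V(2) by (intro alpha_stable_iff_lex_stable[OF degree V(1)]) (simp_all add: field_simps)
  show ?thesis
  proof
    assume "zero_plus_stable n e0 einf V"
    then obtain \<alpha>0 where \<alpha>0: "0 < \<alpha>0" "\<And>\<alpha>. 0 < \<alpha> \<Longrightarrow> \<alpha> < \<alpha>0 \<Longrightarrow> alpha_stable \<alpha> n e0 einf V"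
      by (auto simp: zero_plus_stable_def)
    obtain \<alpha> where "0 < \<alpha>" "\<alpha> < min \<alpha>0 ?\<alpha>"
      using dense[of 0 "min \<alpha>0 ?\<alpha>"] \<alpha>0(1) V(2) by auto
    then show "lex_stable a V" using \<alpha>0(2)[of \<alpha>] small[of \<alpha>] by simp
  next
    assume "lex_stable a V"
    then show "zero_plus_stable n e0 einf V"
      unfolding zero_plus_stable_def using V(2) small by (intro exI[of _ ?\<alpha>]) auto
  qed
qed

end

lemma zero_plus_stable_cong_H0:
  assumes "\<And>U m. H0 n e0 einf U m = H0 n e0' einf' U m"
  shows "bdeg n e0 einf = bdeg n e0' einf'" "zero_plus_stable n e0 einf = zero_plus_stable n e0' einf'"
proof -
  show "bdeg n e0 einf = bdeg n e0' einf'"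
    by (simp add: fun_eq_iff bdeg_def has_degree_def assms)
  then show "zero_plus_stable n e0 einf = zero_plus_stable n e0' einf'"
    by (simp add: fun_eq_iff zero_plus_stable_def alpha_stable_def)
qed

section \<open>Coherent systems on sums of copies of a line bundle\<close>

locale split_bundle =
  fixes n a :: nat and f :: "nat \<Rightarrow> 'k::field vecK"
  assumes frame_f: "frame n n f"
begin

sublocale vec_bundle n f "\<lambda>j. fscale (tpow a) (f j)"
proof
  show "frame n n (\<lambda>j. fscale (tpow a) (f j))"
    using frame_f fs.indep_fam_scale[of n f "\<lambda>_. tpow a"] fs.subspace_scale[OF subspace_supported]
    by (auto simp: frame_iff)
qed (rule frame_f)

lemma from_coords_in_lattice_inf_iff:
  "from_coords p \<in> lattice_inf m \<longleftrightarrow> (\<forall>i<n. deg_le (p i) (m + int a))"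
proof -
  have "from_coords p = (\<Sum>j<n. fscale (c j) (fscale (tpow a) (f j))) \<longleftrightarrow>
      (\<forall>j<n. to_fract (p j) = tpow a * c j)" for c
  proof
    assume "from_coords p = (\<Sum>j<n. fscale (c j) (fscale (tpow a) (f j)))"
    then have "(\<Sum>j<n. fscale (to_fract (p j) - tpow a * c j) (f j)) = 0"
      by (simp add: from_coords_def fs.scale_left_diff_distrib sum_subtractf mult.commute)
    then show "\<forall>j<n. to_fract (p j) = tpow a * c j"
      using fs.indep_famD[OF indep_e0, of "\<lambda>j. to_fract (p j) - tpow a * c j"] by simp
  qed (simp add: from_coords_def mult.commute)
  then have "from_coords p \<in> lattice_inf m \<longleftrightarrow>
      (\<exists>c. \<forall>j<n. to_fract (p j) = tpow a * c j \<and> in_tpow_kinvt m (c j))"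
    unfolding lattice_inf_def by blast
  also have "\<dots> \<longleftrightarrow> (\<forall>j<n. in_tpow_kinvt (m + int a) (to_fract (p j)))"
  proof
    have "in_tpow_kinvt m (x / tpow a) \<longleftrightarrow> in_tpow_kinvt (m + int a) x" for x :: "'k rf"
      using in_tpow_kinvt_tpow_mult_iff[of m a "x / tpow a"] by simp
    moreover assume "\<forall>j<n. in_tpow_kinvt (m + int a) (to_fract (p j))"
    ultimately show "\<exists>c. \<forall>j<n. to_fract (p j) = tpow a * c j \<and> in_tpow_kinvt m (c j)"
      by (intro exI[of _ "\<lambda>j. to_fract (p j) / tpow a"]) simp
  qed (auto simp: in_tpow_kinvt_tpow_mult_iff)
  finally show ?thesis by (simp add: in_tpow_kinvt_to_fract_iff)
qed

lemma section_coords_eq: "section_coords U (int l - int a - 1) = {p \<in> poly_vecs n l. from_coords p \<in> U}"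
proof -
  have "deg_le p (int l - 1) \<longleftrightarrow> (\<forall>s\<ge>l. coeff p s = 0)" for p :: "'k poly"
    unfolding deg_le_def by auto
  then show ?thesis
    unfolding section_coords_def from_coords_in_lattice_inf_iff poly_vecs_def coeff_vec_def
      fun_eq_iff zero_fun_apply
    by (auto simp: algebra_simps) (metis coeff_0 not_less)
qed

lemma H0_full: "H0 n f (\<lambda>j. fscale (tpow a) (f j)) (fullspace n) 0 = from_coords ` poly_vecs n (Suc a)"
  using section_coords_eq[of "coord_space n" "Suc a"] from_coords_mem by (simp add: H0_eq fullspace_eq)

lemma section_coords_below: "fs.subspace U \<Longrightarrow> section_coords U (- int a - 1) = {0}"
proof -
  assume U: "fs.subspace U"
  have "poly_vecs n 0 = ({0} :: (nat \<Rightarrow> 'k poly) set)"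
    by (auto simp: poly_vecs_def coeff_vec_def fun_eq_iff zero_fun_apply poly_eq_iff)
  then show ?thesis
    using section_coords_eq[of U 0] pk.linear_0[OF linear_from_coords] fs.subspace_0[OF U] by auto
qed

lemma bundle_degree_le:
  assumes "fs.subspace U" "U \<subseteq> coord_space n"
  shows "bundle_degree U \<le> int (fs.dim U) * int a"
  using bundle_degree_le_dim_sections[OF assms, of "- int a - 1"]
  by (simp add: section_coords_below[OF assms(1)] ps.dim_zero_set)

definition const_vec :: "(nat \<Rightarrow> 'k) \<Rightarrow> nat \<Rightarrow> 'k poly" where
  "const_vec w = (\<lambda>i. [:w i:])"

abbreviation constants :: "'k vecK set \<Rightarrow> (nat \<Rightarrow> 'k) set" where
  "constants U \<equiv> values_at_0 U (- int a)"

lemma section_coords_const: "section_coords U (- int a) = {p \<in> poly_vecs n 1. from_coords p \<in> U}"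
  using section_coords_eq[of U 1] by simp

lemma coeff_vec_const_vec: "coeff_vec s (const_vec w) = (if s = 0 then w else 0)"
  by (auto simp: coeff_vec_def const_vec_def fun_eq_iff zero_fun_apply coeff_pCons split: nat.split)

lemma const_vec_in_poly_vecs: "w \<in> coord_space n \<Longrightarrow> const_vec w \<in> poly_vecs n 1"
  using fs.subspace_0[OF subspace_supported] by (auto simp: poly_vecs_iff_coeff_vec coeff_vec_const_vec)

lemma const_vec_coeff_vec: "p \<in> poly_vecs n 1 \<Longrightarrow> const_vec (coeff_vec 0 p) = p"
  by (rule poly_vec_eqI) (auto simp: coeff_vec_const_vec poly_vecs_def)

lemma coeff_vec_poly_comb_const:
  "coeff_vec s (poly_comb r g (\<lambda>j. const_vec (w j))) = (\<Sum>j<r. fscale (coeff (g j) s) (w j))"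
  by (simp add: coeff_vec_def poly_comb_def const_vec_def fun_eq_iff
    sum_fun_apply fscale_apply coeff_sum
      mult.commute)

lemma
  assumes U: "fs.subspace U" "U \<subseteq> coord_space n" and degree: "bundle_degree U = int (fs.dim U) * int a"
  shows dim_constants: "fs.dim (constants U) = fs.dim U"
    and coeff_vec_in_constants: "p \<in> poly_vecs n l \<Longrightarrow> from_coords p \<in> U \<Longrightarrow> coeff_vec s p \<in> constants U"
proof -
  let ?r = "fs.dim U"
  obtain q where q: "\<And>j. j < ?r \<Longrightarrow> q j \<in> section_coords U (- int a)"
    "fs.indep_fam ?r (\<lambda>j. coeff_vec 0 (q j))"
    "\<And>l p. p \<in> section_coords U (- int a - 1 + int l) \<Longrightarrow> \<exists>g\<in>poly_vecs ?r l. p = poly_comb ?r g q"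
    by (rule balanced_subbundle[OF U section_coords_below[OF U(1)]]) (simp add: degree, rule that)
  have mem: "coeff_vec 0 (q j) \<in> constants U" if "j < ?r" for j
    using q(1)[OF that] by (auto simp: values_at_0_def)
  then show "fs.dim (constants U) = ?r"
    using fs.indep_fam_le_dim[OF fin_dim_values_at_0 _ q(2)] dim_values_at_0_le[OF U]
      by (simp add: le_antisym)
  assume p: "p \<in> poly_vecs n l" "from_coords p \<in> U"
  then have "p \<in> section_coords U (- int a - 1 + int l)" using section_coords_eq[of U l]
    by (simp add: algebra_simps)
  then obtain g where "p = poly_comb ?r g q" using q(3) by blast
  also have "\<dots> = poly_comb ?r g (\<lambda>j. const_vec (coeff_vec 0 (q j)))"
    using q(1) by (simp add: poly_comb_def section_coords_const const_vec_coeff_vec)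
  finally have "coeff_vec s p = (\<Sum>j<?r. fscale (coeff (g j) s) (coeff_vec 0 (q j)))"
    by (simp add: coeff_vec_poly_comb_const)
  also have "\<dots> \<in> constants U"
    using mem by (intro fs.subspace_sum fs.subspace_scale subspace_values_at_0[OF U(1)]) auto
  finally show "coeff_vec s p \<in> constants U" .
qed

lemma poly_comb_of_constants:
  assumes p: "p \<in> poly_vecs n l" "\<forall>s<l. coeff_vec s p \<in> S"
    and span: "\<And>v. v \<in> S \<Longrightarrow> \<exists>c. v = (\<Sum>j<r. fscale (c j) (w j))"
  obtains g where "p = poly_comb r g (\<lambda>j. const_vec (w j))"
proof -
  have "\<exists>c. coeff_vec s p = (\<Sum>j<r. fscale (c j) (w j))" if "s < l" for s
    using span p(2) that by blast
  then obtain c where c: "\<And>s. s < l \<Longrightarrow> coeff_vec s p = (\<Sum>j<r. fscale (c s j) (w j))" by metis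
  define g where "g = poly_of_slices l (\<lambda>(s, j). c s j)"
  have coeff_g: "coeff (g j) s = (if s < l then c s j else 0)" for j s
    using fun_cong[OF coeff_vec_poly_of_slices[of s l "\<lambda>(s, j). c s j"], of j]
    by (simp add: g_def coeff_vec_def slice_def zero_fun_apply split: if_splits)
  have "p = poly_comb r g (\<lambda>j. const_vec (w j))"
  proof (rule poly_vec_eqI)
    fix s show "coeff_vec s p = coeff_vec s (poly_comb r g (\<lambda>j. const_vec (w j)))"
      using p(1) by (cases "s < l") (simp_all add: coeff_vec_poly_comb_const coeff_g c poly_vecs_def)
  qed
  then show thesis by (rule that)
qed

lemma exists_subbundle_of_constants:
  assumes S: "fs.subspace S" "S \<subseteq> coord_space n"
  obtains U where "fs.subspace U" "U \<subseteq> coord_space n" "fs.dim U = fs.dim S"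
    "bundle_degree U = int (fs.dim U) * int a"
    "\<And>p l. p \<in> poly_vecs n l \<Longrightarrow> \<forall>s<l. coeff_vec s p \<in> S \<Longrightarrow> from_coords p \<in> U"
proof -
  let ?r = "fs.dim S"
  have "fs.fin_dim S" by (rule fs.fin_dim_subset[OF fin_dim_supported S(2)]) simp
  then obtain w where w: "fs.indep_fam ?r w" "\<And>j. j < ?r \<Longrightarrow> w j \<in> S"
    "\<And>v. v \<in> S \<Longrightarrow> \<exists>c. v = (\<Sum>j<?r. fscale (c j) (w j))"
    by (rule fs.basis_fam) (rule that)
  define u where "u = (\<lambda>j. from_coords (const_vec (w j)))"
  have const_poly: "const_vec (w j) \<in> poly_vecs n 1" if "j < ?r" for j
    using w(2)[OF that] S(2) by (intro const_vec_in_poly_vecs) auto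
  have ind: "fs.indep_fam ?r u"
    unfolding u_def using const_poly w(1)
    by (intro indep_from_coords) (auto simp: poly_vecs_def coeff_vec_const_vec)
  then have frame: "frame n ?r u" by (simp add: frame_iff u_def from_coords_mem)
  define U where "U = Kspan ?r u"
  have U: "fs.subspace U" "U \<subseteq> coord_space n" "fs.dim U = ?r"
    unfolding U_def by (rule frame_Kspan[OF frame])+
  have u: "u j \<in> U" if "j < ?r" for j
    unfolding U_def Kspan_eq_span using that by (intro fs.span_base) auto
  have "const_vec (w j) \<in> section_coords U (- int a)" if "j < fs.dim U" for j
    using const_poly u that U(3) by (simp add: section_coords_const u_def)
  then have "int (fs.dim U) * int a \<le> bundle_degree U"
    using bundle_degree_ge[OF U(1,2), of "\<lambda>j. const_vec (w j)" "- int a"] ind U(3) by (simp add: u_def)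
  then have degree: "bundle_degree U = int (fs.dim U) * int a" using bundle_degree_le[OF U(1,2)] by simp
  have "from_coords p \<in> U" if p: "p \<in> poly_vecs n l" "\<forall>s<l. coeff_vec s p \<in> S" for p l
  proof -
    obtain g where "p = poly_comb ?r g (\<lambda>j. const_vec (w j))"
      by (rule poly_comb_of_constants[OF p w(3)])
    then have "from_coords p = (\<Sum>j<?r. fscale (to_fract (g j)) (u j))"
      by (simp add: from_coords_poly_comb u_def)
    then show ?thesis
      using u by (auto intro!: fs.subspace_sum[OF U(1)] intro: fs.subspace_scale[OF U(1)])
  qed
  then show thesis by (rule that[OF U degree])
qed

lemma bundle_degree_full: "bundle_degree (coord_space n) = int n * int a"
proof -
  obtain U where U: "fs.subspace U" "U \<subseteq> coord_space n" "fs.dim U = n"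
    "bundle_degree U = int (fs.dim U) * int a"
    using exists_subbundle_of_constants[OF subspace_supported subset_refl]
    by (metis card_lessThan dim_supported finite_lessThan)
  then have "U = coord_space n" using dim_less_rank_iff[OF U(1,2)] by simp
  then show ?thesis using U(3,4) by simp
qed

end

text \<open>The subspace of sections defined by a Kronecker module: the coefficient of \<open>t\<^sup>s\<close> in the section of \<open>c\<close>
  is \<open>A s c\<close>.\<close>

locale split_system = split_bundle n a f + kronecker_module "Suc a" k n A
  for n a k :: nat and f :: "nat \<Rightarrow> 'k::field vecK" and A :: "nat \<Rightarrow> (nat \<Rightarrow> 'k) \<Rightarrow> nat \<Rightarrow> 'k" +
  assumes injective: "c \<in> coord_space k \<Longrightarrow> (\<And>s. s < Suc a \<Longrightarrow> A s c = 0) \<Longrightarrow> c = 0"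
begin

definition section_poly :: "(nat \<Rightarrow> 'k) \<Rightarrow> nat \<Rightarrow> 'k poly" where
  "section_poly c = poly_of_slices (Suc a) (stack c)"

definition to_section :: "(nat \<Rightarrow> 'k) \<Rightarrow> 'k vecK" where
  "to_section c = from_coords (section_poly c)"

lemma coeff_vec_section_poly: "coeff_vec s (section_poly c) = (if s < Suc a then A s c else 0)"
  by (simp add: section_poly_def coeff_vec_poly_of_slices slice_stack)

lemma section_poly_in_poly_vecs: "c \<in> coord_space k \<Longrightarrow> section_poly c \<in> poly_vecs n (Suc a)"
  unfolding section_poly_def by (rule poly_of_slices_in_poly_vecs)
    (simp add: stack_in_copies_iff maps_to)

lemma linear_to_section: "Vector_Spaces.linear fscale kscale to_section"
  unfolding to_section_def section_poly_def
  by (rule fk.linearI)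
    (simp_all add: ff.linear_add[OF linear_stack] ff.linear_scale[OF linear_stack]
      fp.linear_add[OF linear_poly_of_slices] fp.linear_scale[OF linear_poly_of_slices]
      pk.linear_add[OF linear_from_coords] pk.linear_scale[OF linear_from_coords])

lemma to_section_eq_0D:
  assumes "c \<in> coord_space k" "to_section c = 0"
  shows "c = 0"
proof (rule injective[OF assms(1)])
  have "section_poly c = 0"
    using section_poly_in_poly_vecs[OF assms(1)] assms(2)
    by (intro from_coords_eq_0D) (auto simp: poly_vecs_def to_section_def)
  then show "A s c = 0" if "s < Suc a" for s
    using coeff_vec_section_poly[of s c] that by (simp add: pf.linear_0[OF linear_coeff_vec])
qed

lemma
  assumes "fs.subspace C" "C \<subseteq> coord_space k"
  shows subspace_to_section_image: "ks.subspace (to_section ` C)"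
    and fin_dim_to_section_image: "ks.fin_dim (to_section ` C)"
    and dim_to_section_image: "ks.dim (to_section ` C) = fs.dim C"
proof -
  have "fs.fin_dim C" by (rule fs.fin_dim_subset[OF fin_dim_supported assms(2)]) simp
  then show "ks.subspace (to_section ` C)" "ks.fin_dim (to_section ` C)"
    "ks.dim (to_section ` C) = fs.dim C"
    using fk.linear_subspace_image[OF linear_to_section assms(1)] fk.fin_dim_image[OF linear_to_section]
      fk.dim_image_inj[OF linear_to_section assms(1)] to_section_eq_0D assms(2) by blast+
qed

definition system :: "'k vecK set" where
  "system = to_section ` coord_space k"

lemma subspace_system: "ks.subspace system" and fin_dim_system: "ks.fin_dim system"
  and dim_system: "ks.dim system = k"
  unfolding system_def
  by (simp_all add: subspace_to_section_image fin_dim_to_section_image dim_to_section_image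
      subspace_supported dim_supported)

lemma subrep_constants:
  assumes U: "fs.subspace U" "U \<subseteq> coord_space n" and degree: "bundle_degree U = int (fs.dim U) * int a"
    and W: "ks.subspace W" "W \<subseteq> U"
  shows "subrep {c \<in> coord_space k. to_section c \<in> W} (constants U)"
proof -
  have "fs.subspace {c \<in> coord_space k. to_section c \<in> W}"
    using fs.subspace_inter[OF subspace_supported fk.linear_subspace_vimage[OF linear_to_section W(1)]]
    by (simp add: vimage_def Int_def)
  moreover have "A s c \<in> constants U" if "c \<in> coord_space k" "to_section c \<in> W" "s < Suc a" for c s
    using coeff_vec_in_constants[OF U degree section_poly_in_poly_vecs, of c s] that W(2)
    by (auto simp: to_section_def coeff_vec_section_poly)
  ultimately show ?thesis
    using subspace_values_at_0[OF U(1)] values_at_0_subset by (auto simp: subrep_def)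
qed

lemma lex_stable_if_stable:
  assumes "stable_kronecker_module (Suc a) k n A"
  shows "lex_stable (int a) system"
  unfolding lex_stable_def
proof (intro allI impI, elim conjE)
  interpret stable_kronecker_module "Suc a" k n A by (rule assms)
  fix U W assume U: "fs.subspace U" "U \<subseteq> coord_space n" "U \<noteq> {0}"
    and W: "ks.subspace W" "W \<subseteq> system \<inter> U"
    and proper: "U \<noteq> coord_space n \<or> W \<noteq> system"
  have "n * ks.dim W < k * fs.dim U" if degree: "bundle_degree U = int (fs.dim U) * int a"
  proof (cases "constants U = coord_space n")
    case True
    then have dim_U: "fs.dim U = n" using dim_constants[OF U(1,2) degree] by (simp add: dim_supported)
    then have "W \<noteq> system" using proper dim_less_rank_iff[OF U(1,2)] by simp
    then have "ks.dim W < k"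
      using ks.subspace_eq_fin_dim[OF fin_dim_system W(1)] W(2) dim_system by force
    moreover have "0 < n" using dim_pos_iff[OF U(1,2)] U(3) dim_U by simp
    ultimately show ?thesis using dim_U by (simp add: mult.commute)
  next
    case False
    define C where "C = {c \<in> coord_space k. to_section c \<in> W}"
    have sub: "subrep C (constants U)"
      unfolding C_def using W by (intro subrep_constants[OF U(1,2) degree]) auto
    have "to_section ` C = W" using W(2) by (auto simp: C_def system_def)
    then have "ks.dim W = fs.dim C" using dim_to_section_image[of C] sub by (simp add: subrep_def)
    moreover have "constants U \<noteq> {0}"
      using dim_constants[OF U(1,2) degree] dim_pos_iff[OF U(1,2)] U(3) by (auto simp: fs.dim_zero_set)
    ultimately show ?thesis using stable[OF sub _ False] dim_constants[OF U(1,2) degree] by simp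
  qed
  then show "lex_less (int a) system U W"
    using bundle_degree_le[OF U(1,2)] unfolding lex_less_def dim_system by linarith
qed

lemma stable_if_lex_stable:
  assumes lex: "lex_stable (int a) system"
  shows "stable_kronecker_module (Suc a) k n A"
proof
  fix C S assume sub: "subrep C S" and ne: "C \<noteq> {0} \<or> S \<noteq> {0}" "S \<noteq> coord_space n"
  then have C: "fs.subspace C" "C \<subseteq> coord_space k" and S: "fs.subspace S" "S \<subseteq> coord_space n"
    by (auto simp: subrep_def)
  have "S \<noteq> {0}"
  proof
    assume "S = {0}"
    then have "A s c = 0" if "c \<in> C" "s < Suc a" for s c using sub that unfolding subrep_def by blast
    then have "C \<subseteq> {0}" using C(2) injective by blast
    then show False using ne(1) \<open>S = {0}\<close> fs.subspace_0[OF C(1)] by blast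
  qed
  obtain U where U: "fs.subspace U" "U \<subseteq> coord_space n" "fs.dim U = fs.dim S"
    "bundle_degree U = int (fs.dim U) * int a"
    "\<And>p l. p \<in> poly_vecs n l \<Longrightarrow> \<forall>s<l. coeff_vec s p \<in> S \<Longrightarrow> from_coords p \<in> U"
    by (rule exists_subbundle_of_constants[OF S]) (rule that)
  have "coeff_vec s (section_poly c) \<in> S" if "c \<in> C" "s < Suc a" for c s
    using sub that by (simp add: coeff_vec_section_poly subrep_def)
  then have "to_section c \<in> U" if "c \<in> C" for c
    using U(5)[OF section_poly_in_poly_vecs[of c]] C(2) that by (auto simp: to_section_def)
  then have "to_section ` C \<subseteq> system \<inter> U" using C(2) by (auto simp: system_def)
  moreover have "U \<noteq> {0}" using U(3) \<open>S \<noteq> {0}\<close> dim_subrep_eq_0_iff(2)[OF sub]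
    by (auto simp: fs.dim_zero_set)
  moreover have "U \<noteq> coord_space n"
    using U(3) subrep_eq_coord_space[OF sub] ne(2) by (auto simp: dim_supported)
  ultimately have "lex_less (int a) system U (to_section ` C)"
    using lex U(1,2) subspace_to_section_image[OF C] unfolding lex_stable_def by blast
  then have "n * ks.dim (to_section ` C) < ks.dim system * fs.dim U"
    using U(4) by (simp add: lex_less_def)
  then show "n * fs.dim C < k * fs.dim S"
    by (simp add: dim_system dim_to_section_image[OF C] U(3))
qed

end

context split_bundle
begin

lemma exists_split_system:
  assumes V: "ks.subspace V" "V \<subseteq> from_coords ` poly_vecs n (Suc a)"
  obtains A where "split_system n a (ks.dim V) f A" "split_system.system n a (ks.dim V) f A = V"
proof -
  let ?k = "ks.dim V" and ?P = "poly_vecs n (Suc a) :: (nat \<Rightarrow> 'k poly) set"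
  define P where "P = {p \<in> ?P. from_coords p \<in> V}"
  have P: "ps.subspace P" "ps.fin_dim P" "from_coords ` P = V"
    using ps.subspace_inter[OF subspace_poly_vecs pk.linear_subspace_vimage[OF linear_from_coords V(1)]]
      ps.fin_dim_subset[OF fin_dim_poly_vecs, of P n "Suc a"] V(2)
    by (auto simp: P_def vimage_def Int_def)
  have "p = 0" if "p \<in> P" "from_coords p = 0" for p
    using that by (intro from_coords_eq_0D) (auto simp: P_def poly_vecs_def)
  then have "ps.dim P = ?k" using pk.dim_image_inj[OF linear_from_coords P(1,2)] P(3) by simp
  then obtain h where h: "Vector_Spaces.linear fscale pscale h" "h ` coord_space ?k = P"
    "\<And>c. c \<in> coord_space ?k \<Longrightarrow> h c = 0 \<Longrightarrow> c = 0"
    using ps.coordinate_iso[OF P(2,1)] by metis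
  define A where "A s c = coeff_vec s (h c)" for s c
  have h_poly: "h c \<in> ?P" if "c \<in> coord_space ?k" for c using h(2) that by (auto simp: P_def)
  interpret split_system n a ?k f A
  proof (intro split_system.intro kronecker_module.intro split_system_axioms.intro)
    show "split_bundle n f" ..
    show "Vector_Spaces.linear fscale fscale (A s)" for s
      by (rule ff.linearI) (simp_all add: A_def fp.linear_add[OF h(1)] fp.linear_scale[OF h(1)]
          pf.linear_add[OF linear_coeff_vec] pf.linear_scale[OF linear_coeff_vec])
    show "A s c \<in> coord_space n" if "c \<in> coord_space ?k" for s c
      using h_poly[OF that] by (simp add: A_def poly_vecs_iff_coeff_vec)
    show "c = 0" if "c \<in> coord_space ?k" "\<And>s. s < Suc a \<Longrightarrow> A s c = 0" for c
    proof (rule h(3)[OF that(1)], rule poly_vec_eqI)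
      show "coeff_vec s (h c) = coeff_vec s 0" for s
        using that(2)[of s] h_poly[OF that(1)]
        by (cases "s < Suc a") (auto simp: A_def poly_vecs_def pf.linear_0[OF linear_coeff_vec])
    qed
  qed
  have "section_poly c = h c" if "c \<in> coord_space ?k" for c
    using h_poly[OF that]
    by (intro poly_vec_eqI) (auto simp: coeff_vec_section_poly A_def poly_vecs_def)
  then have "system = from_coords ` h ` coord_space ?k"
    by (auto simp: system_def to_section_def image_image)
  then show thesis using that[of A] split_system_axioms h(2) P(3) by simp
qed

end

section \<open>Splitting\<close>

context vec_bundle
begin

lemma lex_stable_no_sections:
  assumes lex: "lex_stable a V" and V: "ks.subspace V" and n: "1 < n"
  shows "section_coords (coord_space n) (- a - 1) = {0}"
proof (rule ccontr)
  assume "\<not> ?thesis"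
  moreover have "0 \<in> section_coords (coord_space n) (- a - 1)"
    by (rule ps.subspace_0[OF subspace_section_coords[OF subspace_supported]])
  ultimately obtain p where p: "p \<in> section_coords (coord_space n) (- a - 1)" "p \<noteq> 0" by blast
  then have "from_coords p \<noteq> 0" using from_coords_eq_0D[of p] by (auto simp: section_coords_def)
  then have ind: "fs.indep_fam 1 (\<lambda>_. from_coords p)" by (simp add: fs.indep_fam_def)
  then have frame: "frame n 1 (\<lambda>_. from_coords p)" by (simp add: frame_iff from_coords_mem)
  define U where "U = Kspan 1 (\<lambda>_. from_coords p)"
  have U: "fs.subspace U" "U \<subseteq> coord_space n" "fs.dim U = 1"
    unfolding U_def by (rule frame_Kspan[OF frame])+
  have "p \<in> section_coords U (- a - 1)"
    using p(1) by (auto simp: section_coords_def U_def Kspan_eq_span intro: fs.span_base)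
  then have "a + 1 \<le> bundle_degree U"
    using bundle_degree_ge[OF U(1,2), of "\<lambda>_. p" "- a - 1"] ind U(3) by simp
  moreover have "bundle_degree U < a \<or> bundle_degree U = a"
  proof -
    have "U \<noteq> {0}" "U \<noteq> coord_space n"
      using dim_pos_iff[OF U(1,2)] dim_less_rank_iff[OF U(1,2)] U(3) n by auto
    moreover have "{0} \<subseteq> V \<inter> U" using ks.subspace_0[OF V] fs.subspace_0[OF U(1)] by blast
    ultimately have "lex_less a V U {0}"
      using lex U(1,2) ks.subspace_single_0 unfolding lex_stable_def by blast
    then show ?thesis using U(3) by (auto simp: lex_less_def)
  qed
  ultimately show False by simp
qed

lemma H0_eq_Int_full: "H0 n e0 einf U m = U \<inter> H0 n e0 einf (fullspace n) m"
  unfolding H0_def lattice0_eq using from_coords_mem by (auto simp: fullspace_eq)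

text \<open>Only the sections are compared: the two lattices themselves need not agree with those of the split
  bundle, since frames \<open>e0\<close> and \<open>einf\<close> are not required to be compatible away from 0 and infinity.\<close>

lemma exists_split_bundle:
  assumes below: "section_coords (coord_space n) (- int a - 1) = {0}"
    and degree: "bundle_degree (coord_space n) = int n * int a"
  obtains f where "frame n n f" "\<And>U m. H0 n e0 einf U m = H0 n f (\<lambda>j. fscale (tpow a) (f j)) U m"
proof -
  let ?F = "coord_space n :: 'k vecK set"
  have F: "fs.subspace ?F" "fs.dim ?F = n" by (simp_all add: subspace_supported dim_supported)
  obtain q where q: "\<And>j. j < n \<Longrightarrow> q j \<in> section_coords ?F (- int a)"
    "fs.indep_fam n (\<lambda>j. coeff_vec 0 (q j))"
    "\<And>l p. p \<in> section_coords ?F (- int a - 1 + int l) \<Longrightarrow> \<exists>g\<in>poly_vecs n l. p = poly_comb n g q"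
    using balanced_subbundle[OF F(1) subset_refl below] degree unfolding F(2) by auto
  define f where "f j = from_coords (q j)" for j
  have "fs.indep_fam n f"
    unfolding f_def[abs_def] using q(1,2) by (intro indep_from_coords) (auto simp: section_coords_def)
  then have frame: "frame n n f" by (simp add: frame_iff f_def from_coords_mem)
  interpret split: split_bundle n a f by unfold_locales (rule frame)
  have from_coords_comb: "from_coords (poly_comb n g q) = split.from_coords g" for g
    by (simp add: from_coords_poly_comb split.from_coords_def f_def)
  have "section_coords ?F (int m) = (\<lambda>g. poly_comb n g q) ` poly_vecs n (m + a + 1)" for m
  proof (intro equalityI subsetI)
    fix p assume "p \<in> section_coords ?F (int m)"
    then show "p \<in> (\<lambda>g. poly_comb n g q) ` poly_vecs n (m + a + 1)"
      using q(3)[of p "m + a + 1"] by auto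
  next
    fix p assume "p \<in> (\<lambda>g. poly_comb n g q) ` poly_vecs n (m + a + 1)"
    then obtain g where g: "g \<in> poly_vecs n (m + a + 1)" "p = poly_comb n g q" by blast
    have "deg_le (g j) (int (m + a))" for j using g(1) poly_vecs_deg_le[of g n "m + a"] by simp
    then have "poly_comb n g q \<in> section_coords ?F (- int a + int (m + a))"
      by (intro poly_comb_in_section_coords[OF F(1)] q(1))
    then show "p \<in> section_coords ?F (int m)" by (simp add: g(2))
  qed
  then have "from_coords ` section_coords ?F (int m) = split.from_coords ` poly_vecs n (m + a + 1)"
    for m
    by (simp add: image_image from_coords_comb)
  moreover have "split.section_coords ?F (int m) = poly_vecs n (m + a + 1)" for m
    using split.section_coords_eq[of ?F "m + a + 1"] by (simp add: split.from_coords_mem)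
  ultimately have "H0 n e0 einf (fullspace n) m = H0 n f (\<lambda>j. fscale (tpow a) (f j))
    (fullspace n) m" for m
    by (simp add: H0_eq split.H0_eq fullspace_eq)
  then have "H0 n e0 einf U m = H0 n f (\<lambda>j. fscale (tpow a) (f j)) U m" for U m
    using H0_eq_Int_full split.H0_eq_Int_full by metis
  then show thesis by (rule that[OF frame])
qed

lemma lex_stable_slope_nonneg:
  assumes lex: "lex_stable a V" and V: "ks.subspace V" "V \<noteq> {0}"
    "V \<subseteq> H0 n e0 einf (fullspace n) 0" and n: "1 < n"
  shows "0 \<le> a"
proof (rule ccontr)
  assume "\<not> 0 \<le> a"
  then have "section_coords (coord_space n) 0 \<subseteq> {0}"
    using section_coords_mono[of 0 "- a - 1" "coord_space n"] lex_stable_no_sections[OF lex V(1) n]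
      by auto
  then have "V \<subseteq> {0}" using V(3) pk.linear_0[OF linear_from_coords] by (auto simp: H0_eq fullspace_eq)
  then show False using V(1,2) ks.subspace_0 by blast
qed

end

lemma exists_stable_kronecker_module_if_coherent_system:
  fixes e0 einf :: "nat \<Rightarrow> 'k::field vecK"
  assumes cs: "coherent_system n (int n * a) k e0 einf V" and st: "zero_plus_stable n e0 einf V"
    and k: "0 < k" "1 < n"
  obtains A :: "nat \<Rightarrow> (nat \<Rightarrow> 'k) \<Rightarrow> nat \<Rightarrow> 'k" where "0 \<le> a" "stable_kronecker_module (Suc (nat a)) k n A"
proof -
  interpret vec_bundle n e0 einf using cs by unfold_locales (auto simp: coherent_system_def)
  have V: "ks.subspace V" "V \<subseteq> H0 n e0 einf (fullspace n) 0" "kdim V = k"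
    and degree: "bdeg n e0 einf n (fullspace n) = int n * a"
    using cs by (auto simp: coherent_system_def ksubspace_iff)
  have fin: "ks.fin_dim V"
    using ks.fin_dim_subset[OF _ V(2)] pk.fin_dim_image[OF linear_from_coords fin_dim_section_coords]
    by (simp add: H0_eq)
  then have dim: "ks.dim V = k" using V(3) by (simp add: kdim_eq_dim)
  have lex: "lex_stable a V"
    using st zero_plus_stable_iff_lex_stable[OF degree fin] dim k(1) by simp
  have "V \<noteq> {0}" using dim k(1) by (auto simp: ks.dim_zero_set)
  then have "0 \<le> a" using lex_stable_slope_nonneg[OF lex V(1) _ V(2) k(2)] by simp
  then obtain b where a: "a = int b" using nonneg_int_cases by blast
  have "section_coords (coord_space n) (- int b - 1) = {0}"
    using lex_stable_no_sections[OF lex V(1) k(2)] by (simp add: a)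
  moreover have "bundle_degree (coord_space n) = int n * int b"
    using degree by (simp add: bundle_degree_def dim_supported fullspace_eq a)
  ultimately obtain f where f: "frame n n f"
    "\<And>U m. H0 n e0 einf U m = H0 n f (\<lambda>j. fscale (tpow b) (f j)) U m"
    using exists_split_bundle by metis
  interpret split: split_bundle n b f by unfold_locales (rule f(1))
  have "V \<subseteq> split.from_coords ` poly_vecs n (Suc b)" using V(2) f(2) split.H0_full by simp
  then obtain A where A: "split_system n b k f A" "split_system.system n b k f A = V"
    using split.exists_split_system[OF V(1)] unfolding dim by metis
  interpret sys: split_system n b k f A by (rule A(1))
  have "split.lex_stable (int b) V"
    using st degree split.zero_plus_stable_iff_lex_stable[OF _ fin, of "int b"]
      zero_plus_stable_cong_H0[OF f(2)] dim k(1) a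
    by simp
  then have "stable_kronecker_module (Suc b) k n A" using sys.stable_if_lex_stable A(2) by simp
  then show thesis using that \<open>0 \<le> a\<close> by (simp add: a)
qed

lemma exists_stable_coherent_system:
  fixes A :: "nat \<Rightarrow> (nat \<Rightarrow> 'k::field) \<Rightarrow> nat \<Rightarrow> 'k"
  assumes A: "stable_kronecker_module (Suc a) k n A" and pos: "0 < k" "0 < n"
  shows "\<exists>(e0 :: nat \<Rightarrow> 'k vecK) einf V.
    coherent_system n (int n * int a) k e0 einf V \<and> zero_plus_stable n e0 einf V"
proof -
  interpret stable_kronecker_module "Suc a" k n A by (rule A)
  have "frame n n (unitv :: nat \<Rightarrow> 'k vecK)"
    by (auto simp: frame_iff indep_unitv intro: unitv_in_supported)
  then interpret sys: split_system n a k "unitv :: nat \<Rightarrow> 'k vecK" A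
    by unfold_locales (use injective[OF pos(2)] in auto)
  have degree: "bdeg n unitv (\<lambda>j. fscale (tpow a) (unitv j)) n
    (fullspace n :: 'k vecK set) = int n * int a"
    using sys.bundle_degree_full by (simp add: sys.bundle_degree_def dim_supported fullspace_eq)
  have "sys.system \<subseteq> H0 n unitv (\<lambda>j. fscale (tpow a) (unitv j)) (fullspace n) 0"
    using sys.section_poly_in_poly_vecs by (auto simp: sys.system_def sys.to_section_def sys.H0_full)
  then have "coherent_system n (int n * int a) k unitv (\<lambda>j. fscale (tpow a) (unitv j)) sys.system"
    using sys.frame0 sys.frame_inf degree sys.subspace_system sys.fin_dim_system sys.dim_system
    by (simp add: coherent_system_def ksubspace_iff kdim_eq_dim)
  moreover have "zero_plus_stable n unitv (\<lambda>j. fscale (tpow a) (unitv j)) sys.system"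
    using sys.zero_plus_stable_iff_lex_stable[OF degree sys.fin_dim_system]
      sys.lex_stable_if_stable[OF A]
      sys.dim_system pos(1) by simp
  ultimately show ?thesis by blast
qed

lemma exists_stable_coherent_system_iff:
  assumes "0 < k" "1 < n"
  shows "(\<exists>(e0 :: nat \<Rightarrow> 'k::field vecK) einf V.
      coherent_system n (int n * a) k e0 einf V \<and> zero_plus_stable n e0 einf V) \<longleftrightarrow>
    0 \<le> a \<and> (\<exists>A :: nat \<Rightarrow> (nat \<Rightarrow> 'k) \<Rightarrow> nat \<Rightarrow> 'k. stable_kronecker_module (Suc (nat a)) k n A)"
proof (intro iffI; elim exE conjE)
  fix e0 einf :: "nat \<Rightarrow> 'k vecK" and V
  assume "coherent_system n (int n * a) k e0 einf V" "zero_plus_stable n e0 einf V"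
  then show "0 \<le> a \<and> (\<exists>A :: nat \<Rightarrow> (nat \<Rightarrow> 'k) \<Rightarrow> nat \<Rightarrow> 'k. stable_kronecker_module (Suc (nat a)) k n A)"
    using exists_stable_kronecker_module_if_coherent_system[OF _ _ assms] by metis
next
  fix A :: "nat \<Rightarrow> (nat \<Rightarrow> 'k) \<Rightarrow> nat \<Rightarrow> 'k"
  assume "0 \<le> a" "stable_kronecker_module (Suc (nat a)) k n A"
  then show "\<exists>(e0 :: nat \<Rightarrow> 'k vecK) einf V.
      coherent_system n (int n * a) k e0 einf V \<and> zero_plus_stable n e0 einf V"
    using exists_stable_coherent_system[of "nat a" k n A] assms by simp
qed

section \<open>The numerical criterion\<close>

lemma exists_stable_kronecker_module_iff:
  assumes closed: "alg_closed TYPE('k::field)" and k: "0 < k" "k < n"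
  shows "(\<exists>A :: nat \<Rightarrow> (nat \<Rightarrow> 'k) \<Rightarrow> nat \<Rightarrow> 'k. stable_kronecker_module N k n A) \<longleftrightarrow>
    k\<^sup>2 + n\<^sup>2 \<le> N * k * n + 1"
proof
  assume "\<exists>A :: nat \<Rightarrow> (nat \<Rightarrow> 'k) \<Rightarrow> nat \<Rightarrow> 'k. stable_kronecker_module N k n A"
  then show "k\<^sup>2 + n\<^sup>2 \<le> N * k * n + 1"
    using stable_kronecker_module.tits_form_le_1[OF _ closed k(1)] k by auto
next
  assume tits: "k\<^sup>2 + n\<^sup>2 \<le> N * k * n + 1"
  have "2 \<le> N"
  proof (rule ccontr)
    assume "\<not> 2 \<le> N"
    then have "N * k * n \<le> k * n" by (cases "N = 0") (auto simp: not_le less_2_cases_iff)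
    moreover have "n + k * n \<le> n\<^sup>2"
      using mult_le_mono1[of "Suc k" n n] k(2) by (simp add: power2_eq_square)
    ultimately have "k\<^sup>2 + n \<le> 1" using tits by linarith
    then show False using k by simp
  qed
  then show "\<exists>A :: nat \<Rightarrow> (nat \<Rightarrow> 'k) \<Rightarrow> nat \<Rightarrow> 'k. stable_kronecker_module N k n A"
    using tits k by (intro exists_stable_kronecker_module) auto
qed

lemma numerical_condition_iff:
  fixes n k :: nat and a :: int
  assumes "0 < n" "0 < k"
  shows "real k * real_of_int a \<ge> real n - real k + (real k ^ 2 - 1) / real n \<longleftrightarrow>
    0 \<le> a \<and> k\<^sup>2 + n\<^sup>2 \<le> Suc (nat a) * k * n + 1"
proof -
  have "real k * real_of_int a \<ge> real n - real k + (real k ^ 2 - 1) / real n \<longleftrightarrow>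
      (real n - real k) * real n + (real k ^ 2 - 1) \<le> real k * real_of_int a * real n"
    using assms by (simp add: field_simps)
  also have "\<dots> \<longleftrightarrow> real_of_int (int (k\<^sup>2 + n\<^sup>2)) \<le> real_of_int ((a + 1) * int (k * n) + 1)"
    by (simp add: power2_eq_square algebra_simps)
  also have "\<dots> \<longleftrightarrow> int (k\<^sup>2 + n\<^sup>2) \<le> (a + 1) * int (k * n) + 1" by (simp only: of_int_le_iff)
  also have "\<dots> \<longleftrightarrow> 0 \<le> a \<and> k\<^sup>2 + n\<^sup>2 \<le> Suc (nat a) * k * n + 1"
  proof (cases "0 \<le> a")
    case True
    then have "(a + 1) * int (k * n) + 1 = int (Suc (nat a) * k * n + 1)" by (simp add: algebra_simps)
    then show ?thesis using True by (simp only: of_nat_le_iff simp_thms)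
  next
    case False
    then have "(a + 1) * int (k * n) \<le> 0" by (intro mult_nonpos_nonneg) auto
    moreover have "0 < k\<^sup>2" "0 < n\<^sup>2" using assms by simp_all
    then have "2 \<le> k\<^sup>2 + n\<^sup>2" by linarith
    ultimately have "\<not> int (k\<^sup>2 + n\<^sup>2) \<le> (a + 1) * int (k * n) + 1" by linarith
    then show ?thesis using False by simp
  qed
  finally show ?thesis .
qed

theorem theorem4p5:
  fixes n kk :: nat and a :: int
  assumes "alg_closed TYPE('k::field)"
    and "0 < kk" and "kk < n"
  shows "(\<exists>(e0 :: nat \<Rightarrow> 'k vecK) einf V.
            coherent_system n (int n * a) kk e0 einf V \<and> zero_plus_stable n e0 einf V)
         \<longleftrightarrow> real kk * real_of_int a \<ge> real n - real kk + (real kk ^ 2 - 1) / real n"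
proof -
  have n: "0 < n" "1 < n" using assms(2,3) by auto
  show ?thesis
    unfolding exists_stable_coherent_system_iff[OF assms(2) n(2)]
      exists_stable_kronecker_module_iff[OF assms]
      numerical_condition_iff[OF n(1) assms(2)] ..
qed

end
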